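(* Let $\gamma\in(0,1)$, let $z_0=(x_0,y_0)\in(0,\infty)^2$ be the starting point and $t_0=x_0+y_0$. The exit densities are given by the following formulas: for $y>t_0$, $$f_1(y)=\frac{e^{-t_0(1-\gamma)-y_0\gamma}}{\sqrt{2\pi}}\,\frac{e^{-\frac12(1-\gamma)^2(y-t_0)}}{\sqrt{(y-t_0)^3}}\sum_{n\in\mathbb{Z}}((2n+1)t_0-y_0)\,e^{-\frac12\frac{((2n+1)t_0-y_0)^2}{y-t_0}+(2n+1)y_0-2n(n+1)t_0},$$ and for $x>t_0$, $$f_2(x)=\frac{e^{-t_0\gamma-x_0(1-\gamma)}}{\sqrt{2\pi}}\,\frac{e^{-\frac12\gamma^2(x-t_0)}}{\sqrt{(x-t_0)^3}}\sum_{n\in\mathbb{Z}}((2n+1)t_0-x_0)\,e^{-\frac12\frac{((2n+1)t_0-x_0)^2}{x-t_0}+(2n+1)x_0-2n(n+1)t_0}.$$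
   Context: Let $W$ be a standard one-dimensional Brownian motion and $Z(t)=(X(t),Y(t))=(x_0-W(t)+(1-\gamma)t,\ y_0+W(t)+\gamma t)$. Let $T_1=\inf\{t\ge0: Z(t)\in\{0\}\times\mathbb{R}_+\}$ and $T_2=\inf\{t\ge0: Z(t)\in\mathbb{R}_+\times\{0\}\}$. The exit density $f_1$ is the density of the measure $S\mapsto\mathbb{P}(Y(T_1)\in S,\ T_1<T_2)$ and $f_2$ the density of the measure $S\mapsto\mathbb{P}(X(T_2)\in S,\ T_2<T_1)$ on $(0,\infty)$. Since $X(t)+Y(t)=t_0+t$, both measures are supported on $[t_0,\infty)$. *)

theory Defs
  imports "HOL-Probability.Probability"
begin

(* The time index is a real number; W t is only constrained for t \<ge> 0.
   Starting value and path continuity are required almost surely. *)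
definition standard_brownian_motion :: "'a measure \<Rightarrow> (real \<Rightarrow> 'a \<Rightarrow> real) \<Rightarrow> bool" where
  "standard_brownian_motion M W \<longleftrightarrow>
     prob_space M \<and>
     (\<forall>t\<ge>0. W t \<in> borel_measurable M) \<and>
     (AE \<omega> in M. W 0 \<omega> = 0) \<and>
     (\<forall>s t. 0 \<le> s \<and> s < t \<longrightarrow>
        distributed M lborel (\<lambda>\<omega>. W t \<omega> - W s \<omega>) (\<lambda>x. ennreal (normal_density 0 (sqrt (t - s)) x))) \<and>
     (\<forall>(n::nat) (\<tau> :: nat \<Rightarrow> real). 0 \<le> \<tau> 0 \<and> (\<forall>i<n. \<tau> i < \<tau> (Suc i)) \<longrightarrow>
        prob_space.indep_vars M (\<lambda>_. borel) (\<lambda>i \<omega>. W (\<tau> (Suc i)) \<omega> - W (\<tau> i) \<omega>) {..<n}) \<and>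
     (AE \<omega> in M. continuous_on {0..} (\<lambda>t. W t \<omega>))"

definition Z_process :: "(real \<Rightarrow> 'a \<Rightarrow> real) \<Rightarrow> real \<Rightarrow> real \<Rightarrow> real \<Rightarrow> real \<Rightarrow> 'a \<Rightarrow> real \<times> real" where
  "Z_process W \<gamma> x0 y0 t \<omega> = (x0 - W t \<omega> + (1 - \<gamma>) * t, y0 + W t \<omega> + \<gamma> * t)"

(* Value \<infinity> if the set is never hit, since Inf {} = \<infinity> in ereal. *)
definition hitting_time :: "(real \<Rightarrow> 'a \<Rightarrow> 'b) \<Rightarrow> 'b set \<Rightarrow> 'a \<Rightarrow> ereal" where
  "hitting_time Z A \<omega> = Inf (ereal ` {t. 0 \<le> t \<and> Z t \<omega> \<in> A})"

definition T1 :: "(real \<Rightarrow> 'a \<Rightarrow> real \<times> real) \<Rightarrow> 'a \<Rightarrow> ereal" where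
  "T1 Z = hitting_time Z ({0} \<times> {0..})"

definition T2 :: "(real \<Rightarrow> 'a \<Rightarrow> real \<times> real) \<Rightarrow> 'a \<Rightarrow> ereal" where
  "T2 Z = hitting_time Z ({0..} \<times> {0})"

(* f is a Lebesgue density on (0,\<infinity>) of the finite measure S \<mapsto> P(V \<in> S, E).
   The probability is taken in the completion of M, which extends M: as the paths of W are
   only almost surely continuous, hitting times need not be measurable with respect to M itself.
   Measurability of the event is demanded, so that emeasure is not 0 by convention. *)
definition density_of_law_on_event :: "'a measure \<Rightarrow> ('a \<Rightarrow> real) \<Rightarrow> ('a \<Rightarrow> bool) \<Rightarrow> (real \<Rightarrow> real) \<Rightarrow> bool" where
  "density_of_law_on_event M V E f \<longleftrightarrow>
     f \<in> borel_measurable borel \<and> (\<forall>x>0. 0 \<le> f x) \<and>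
     (\<forall>S\<in>sets borel. S \<subseteq> {0<..} \<longrightarrow>
        {\<omega> \<in> space M. V \<omega> \<in> S \<and> E \<omega>} \<in> sets (completion M) \<and>
        emeasure (completion M) {\<omega> \<in> space M. V \<omega> \<in> S \<and> E \<omega>} = (\<integral>\<^sup>+x\<in>S. ennreal (f x) \<partial>lborel))"

(* On the event in question the relevant hitting time is finite, so real_of_ereal is harmless. *)
definition is_exit_density1 :: "'a measure \<Rightarrow> (real \<Rightarrow> 'a \<Rightarrow> real \<times> real) \<Rightarrow> (real \<Rightarrow> real) \<Rightarrow> bool" where
  "is_exit_density1 M Z f \<longleftrightarrow>
     density_of_law_on_event M (\<lambda>\<omega>. snd (Z (real_of_ereal (T1 Z \<omega>)) \<omega>)) (\<lambda>\<omega>. T1 Z \<omega> < T2 Z \<omega>) f"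

definition is_exit_density2 :: "'a measure \<Rightarrow> (real \<Rightarrow> 'a \<Rightarrow> real \<times> real) \<Rightarrow> (real \<Rightarrow> real) \<Rightarrow> bool" where
  "is_exit_density2 M Z f \<longleftrightarrow>
     density_of_law_on_event M (\<lambda>\<omega>. fst (Z (real_of_ereal (T2 Z \<omega>)) \<omega>)) (\<lambda>\<omega>. T2 Z \<omega> < T1 Z \<omega>) f"

definition exit_series_term :: "real \<Rightarrow> real \<Rightarrow> real \<Rightarrow> int \<Rightarrow> real" where
  "exit_series_term t0 a s n =
     ((2 * of_int n + 1) * t0 - a) *
     exp (- (1/2) * (((2 * of_int n + 1) * t0 - a)\<^sup>2 / s) + (2 * of_int n + 1) * a
          - 2 * of_int n * (of_int n + 1) * t0)"

end

theory Submission imports Defs "HOL-Real_Asymp.Real_Asymp" begin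

text \<open>
  In the coordinates of \<open>W\<close>, the process meets the vertical axis when \<open>W\<close> meets the line \<open>x0 + (1 - \<gamma>) t\<close>
  from below, and the horizontal axis when \<open>-W\<close> meets \<open>y0 + \<gamma> t\<close>. So \<open>T1 < T2\<close> means that \<open>W\<close> leaves a wedge
  that widens linearly in time through its upper side, and then \<open>Y(T1) = t0 + T1\<close>: up to the shift by
  \<open>t0\<close>, the first exit density is the density of \<open>T1\<close> on the event \<open>T1 < T2\<close>. The second one is the first one
  for \<open>-W\<close>, with the two coordinates exchanged.

  The density is found through its Laplace transform. If \<open>\<theta> > 2(1 - \<gamma>)\<close> or \<open>\<theta> < -2\<gamma>\<close>, then the martingale
  \<open>exp (\<theta> W(t) - \<theta>\<^sup>2 t / 2)\<close> is bounded inside the wedge and decays there exponentially in time, so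
  that stopping it at the exit gives (\<open>expectation_exit_functional\<close>, \<open>laplace_relation\<close>)
  \<open>exp (\<theta> x0) L1 (\<theta>\<^sup>2/2 - (1 - \<gamma>) \<theta>) + exp (- \<theta> y0) L2 (\<theta>\<^sup>2/2 + \<gamma> \<theta>) = 1\<close>,
  where \<open>L1\<close> and \<open>L2\<close> are the Laplace transforms of the two exit times on the respective events. The argument
  of \<open>L2\<close> is invariant under \<open>\<theta> \<mapsto> -2\<gamma> - \<theta>\<close> and that of \<open>L1\<close> under \<open>\<theta> \<mapsto> 2(1 - \<gamma>) - \<theta>\<close>; the composition
  of the two reflections is the shift by \<open>2\<close>. Eliminating \<open>L2\<close> between the relations at \<open>\<theta>\<close> and
  \<open>-2\<gamma> - \<theta>\<close> therefore expresses \<open>L1\<close> at \<open>\<theta>\<close> through \<open>L1\<close> at \<open>\<theta> + 2\<close>, with a factor that is small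
  enough to iterate (\<open>upper_laplace_recursion\<close>, \<open>laplace_recursion_solution\<close>).

  Each term of the resulting series is a constant times \<open>exp (- b \<theta>)\<close> with \<open>b = (2k + 1) t0 \<mp> y0\<close>. This is the
  Laplace transform of the density of the time at which a Brownian motion, killed at a constant rate, reaches the level \<open>b\<close>
  (\<open>nn_integral_killed_hitting_density\<close>), and these densities are the terms of the claimed
  series, the upper sign giving the indices \<open>n \<ge> 0\<close> and the lower sign \<open>n < 0\<close>. Uniqueness of Laplace transforms
  (\<open>measure_add_eq_of_laplace\<close>) finishes the identification. The terms with \<open>n < 0\<close> are negative; they are put on
  the side of the unknown law, so that only finite measures are compared. That the difference is nonnegative at every
  point, and not just almost everywhere, comes from its continuity.

  Optional stopping is reduced to the independence of increments. On a finite grid it is a finite induction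
  (\<open>optional_stopping_grid\<close>). For the passage to continuous time the path is stopped when it is strictly outside
  a slightly smaller wedge: this is an open condition, so fine grids detect it, and the overshoot is controlled by
  second moments (\<open>optional_stopping_wedge\<close>). Finally the smaller wedge grows to the original one.
\<close>

section \<open>The exponential martingale on a time grid\<close>

definition exp_martingale :: "real \<Rightarrow> real \<Rightarrow> real \<Rightarrow> real" where
  "exp_martingale \<theta> s w = exp (\<theta> * w - \<theta>\<^sup>2 * s / 2)"

lemma exp_martingale_pos: "0 < exp_martingale \<theta> s w"
  by (simp add: exp_martingale_def)

lemma exp_martingale_add:
  "exp_martingale \<theta> (s + s') (w + w') = exp_martingale \<theta> s w * exp_martingale \<theta> s' w'"
  unfolding exp_martingale_def exp_add[symmetric] by (simp add: field_simps)

text \<open>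
  The second moment at parameter \<open>\<theta>\<close> is a first moment at parameter \<open>2 \<theta>\<close>; this yields uniform
  integrability of the stopped martingale.
\<close>

lemma exp_martingale_square:
  "(exp_martingale \<theta> s w)\<^sup>2 = exp (\<theta>\<^sup>2 * s) * exp_martingale (2 * \<theta>) s w"
  unfolding exp_martingale_def exp_add[symmetric] power2_eq_square by (simp add: field_simps)

lemma measurable_exp_martingale [measurable]:
  assumes [measurable]: "f \<in> borel_measurable M" "g \<in> borel_measurable M"
  shows "(\<lambda>x. exp_martingale \<theta> (f x) (g x)) \<in> borel_measurable M"
  unfolding exp_martingale_def by measurable

text \<open>Completing the square: weighting a centred normal density by the martingale moves its mean.\<close>

lemma normal_density_exponential_tilt:
  assumes "0 < v"
  shows "normal_density 0 (sqrt v) x * exp_martingale \<theta> v x = normal_density (\<theta> * v) (sqrt v) x"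
proof -
  have "- (x\<^sup>2) / (2 * v) + (\<theta> * x - \<theta>\<^sup>2 * v / 2) = - ((x - \<theta> * v)\<^sup>2) / (2 * v)"
    using assms by (simp add: field_simps power2_eq_square)
  then have "exp (- (x\<^sup>2) / (2 * v)) * exp (\<theta> * x - \<theta>\<^sup>2 * v / 2) = exp (- ((x - \<theta> * v)\<^sup>2) / (2 * v))"
    by (simp flip: exp_add)
  then show ?thesis
    using assms by (simp add: normal_density_def exp_martingale_def)
qed

text \<open>
  The index of the first point \<open>j \<delta>\<close> of the grid at which \<open>Q\<close> fails, capped at \<open>k\<close>. The recursion in the cap
  \<open>k\<close> is the one that the optional stopping argument follows.
\<close>

fun stop_index :: "(real \<Rightarrow> real \<Rightarrow> bool) \<Rightarrow> real \<Rightarrow> (real \<Rightarrow> real) \<Rightarrow> nat \<Rightarrow> nat" where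
  "stop_index Q \<delta> w 0 = 0"
| "stop_index Q \<delta> w (Suc k) =
    (if stop_index Q \<delta> w k = k \<and> Q (real k * \<delta>) (w (real k * \<delta>)) then Suc k else stop_index Q \<delta> w k)"

lemma stop_index_le: "stop_index Q \<delta> w k \<le> k"
  by (induction k) auto

lemma stop_index_before: "j < stop_index Q \<delta> w k \<Longrightarrow> Q (real j * \<delta>) (w (real j * \<delta>))"
proof (induction k)
  case (Suc k)
  then show ?case
    by (cases "stop_index Q \<delta> w k = k \<and> Q (real k * \<delta>) (w (real k * \<delta>))") (auto simp: less_Suc_eq)
qed auto

lemma stop_index_at: "stop_index Q \<delta> w k < k \<Longrightarrow>
    \<not> Q (real (stop_index Q \<delta> w k) * \<delta>) (w (real (stop_index Q \<delta> w k) * \<delta>))"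
proof (induction k)
  case (Suc k)
  then show ?case using stop_index_le[of Q \<delta> w k]
    by (cases "stop_index Q \<delta> w k = k") (auto split: if_splits)
qed auto

lemma stop_index_eq_iff: "stop_index Q \<delta> w k = k \<longleftrightarrow> (\<forall>j<k. Q (real j * \<delta>) (w (real j * \<delta>)))"
  by (metis stop_index_at stop_index_before stop_index_le le_neq_implies_less)

text \<open>
  A Brownian motion for which the start at zero and the continuity hold for every sample point, so that hitting
  times are measurable without completing the measure.
\<close>

locale continuous_brownian_motion = prob_space M for M :: "'a measure" +
  fixes W :: "real \<Rightarrow> 'a \<Rightarrow> real"
  assumes random_variable: "0 \<le> t \<Longrightarrow> W t \<in> borel_measurable M"
    and start_zero: "\<omega> \<in> space M \<Longrightarrow> W 0 \<omega> = 0"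
    and continuous_path: "\<omega> \<in> space M \<Longrightarrow> continuous_on {0..} (\<lambda>t. W t \<omega>)"
    and normal_increment: "0 \<le> s \<Longrightarrow> s < t \<Longrightarrow>
      distributed M lborel (\<lambda>\<omega>. W t \<omega> - W s \<omega>) (\<lambda>x. ennreal (normal_density 0 (sqrt (t - s)) x))"
    and indep_increments: "0 \<le> \<tau> 0 \<Longrightarrow> (\<And>i. i < n \<Longrightarrow> \<tau> i < \<tau> (Suc i)) \<Longrightarrow>
      indep_vars (\<lambda>_. borel) (\<lambda>i \<omega>. W (\<tau> (Suc i)) \<omega> - W (\<tau> i) \<omega>) {..<n}"
begin

lemma
  assumes "0 \<le> s" "s < t"
  shows integrable_increment_exp: "integrable M (\<lambda>\<omega>. exp_martingale \<theta> (t - s) (W t \<omega> - W s \<omega>))"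
    and expectation_increment_exp: "expectation (\<lambda>\<omega>. exp_martingale \<theta> (t - s) (W t \<omega> - W s \<omega>)) = 1"
proof -
  note D = normal_increment[OF assms]
  have *: "normal_density 0 (sqrt (t - s)) x * exp_martingale \<theta> (t - s) x
      = normal_density (\<theta> * (t - s)) (sqrt (t - s)) x" for x
    using assms by (intro normal_density_exponential_tilt) auto
  have "integrable lborel (\<lambda>x. normal_density 0 (sqrt (t - s)) x * exp_martingale \<theta> (t - s) x)"
    using assms unfolding * by simp
  then show "integrable M (\<lambda>\<omega>. exp_martingale \<theta> (t - s) (W t \<omega> - W s \<omega>))"
    by (subst (asm) distributed_integrable[OF D]) auto
  show "expectation (\<lambda>\<omega>. exp_martingale \<theta> (t - s) (W t \<omega> - W s \<omega>)) = 1"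
    using assms by (subst distributed_integral[OF D, symmetric]) (auto simp: *)
qed

context
  fixes Q :: "real \<Rightarrow> real \<Rightarrow> bool" and \<delta> \<theta> :: real
  assumes Q_measurable [measurable]: "\<And>s. Measurable.pred borel (Q s)" and step_pos: "0 < \<delta>"
begin

abbreviation "increment i \<omega> \<equiv> W (real (Suc i) * \<delta>) \<omega> - W (real i * \<delta>) \<omega>"

lemma grid_value_eq_sum: "\<omega> \<in> space M \<Longrightarrow> W (real k * \<delta>) \<omega> = (\<Sum>i<k. increment i \<omega>)"
  using sum_lessThan_telescope[of "\<lambda>i. W (real i * \<delta>) \<omega>" k] by (simp add: start_zero)

text \<open>All increments up to time \<open>k \<delta>\<close>, taken as one vector, are independent of the next one.\<close>

lemma indep_past_increment:
  "indep_var (PiM {..<k} (\<lambda>_. borel)) (\<lambda>\<omega>. \<lambda>i\<in>{..<k}. increment i \<omega>)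
     (PiM {k} (\<lambda>_. borel)) (\<lambda>\<omega>. \<lambda>i\<in>{k}. increment i \<omega>)"
proof -
  have "indep_vars (\<lambda>_. borel) increment {..<Suc k}"
    using step_pos by (intro indep_increments[where \<tau> = "\<lambda>i. real i * \<delta>"]) auto
  then show ?thesis
    by (rule indep_var_restrict) auto
qed

lemma
  fixes F :: "(nat \<Rightarrow> real) \<Rightarrow> real"
  assumes F [measurable]: "F \<in> borel_measurable (PiM {..<k} (\<lambda>_. borel))"
    and int: "integrable M (\<lambda>\<omega>. F (\<lambda>i\<in>{..<k}. increment i \<omega>))"
  shows integrable_past_times_increment:
      "integrable M (\<lambda>\<omega>. F (\<lambda>i\<in>{..<k}. increment i \<omega>) * exp_martingale \<theta> \<delta> (increment k \<omega>))"
    and expectation_past_times_increment: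
      "expectation (\<lambda>\<omega>. F (\<lambda>i\<in>{..<k}. increment i \<omega>) * exp_martingale \<theta> \<delta> (increment k \<omega>))
        = expectation (\<lambda>\<omega>. F (\<lambda>i\<in>{..<k}. increment i \<omega>))"
proof -
  define G where "G v = exp_martingale \<theta> \<delta> (v k)" for v :: "nat \<Rightarrow> real"
  have [measurable]: "G \<in> borel_measurable (PiM {k} (\<lambda>_. borel))"
    unfolding G_def by measurable
  have ind: "indep_var borel (F \<circ> (\<lambda>\<omega>. \<lambda>i\<in>{..<k}. increment i \<omega>)) borel (G \<circ> (\<lambda>\<omega>. \<lambda>i\<in>{k}. increment i \<omega>))"
    by (rule indep_var_compose[OF indep_past_increment]) auto
  have st: "0 \<le> real k * \<delta>" "real k * \<delta> < real (Suc k) * \<delta>" "real (Suc k) * \<delta> - real k * \<delta> = \<delta>"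
    using step_pos by (auto simp: field_simps)
  have intG: "integrable M (\<lambda>\<omega>. exp_martingale \<theta> \<delta> (increment k \<omega>))"
    and EG: "expectation (\<lambda>\<omega>. exp_martingale \<theta> \<delta> (increment k \<omega>)) = 1"
    using integrable_increment_exp[OF st(1,2), of \<theta>] expectation_increment_exp[OF st(1,2), of \<theta>]
    unfolding st(3) by auto
  show "integrable M (\<lambda>\<omega>. F (\<lambda>i\<in>{..<k}. increment i \<omega>) * exp_martingale \<theta> \<delta> (increment k \<omega>))"
    using indep_var_integrable[OF ind] int intG by (simp add: o_def G_def)
  show "expectation (\<lambda>\<omega>. F (\<lambda>i\<in>{..<k}. increment i \<omega>) * exp_martingale \<theta> \<delta> (increment k \<omega>))
        = expectation (\<lambda>\<omega>. F (\<lambda>i\<in>{..<k}. increment i \<omega>))"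
    using indep_var_lebesgue_integral[OF ind] int intG EG by (simp add: o_def G_def)
qed

abbreviation "grid_stop k \<omega> \<equiv> stop_index Q \<delta> (\<lambda>t. W t \<omega>) k"

lemma integrable_grid: "integrable M (\<lambda>\<omega>. exp_martingale \<theta> (real k * \<delta>) (W (real k * \<delta>) \<omega>))"
proof (cases k)
  case 0
  then show ?thesis by (simp add: exp_martingale_def start_zero cong: Bochner_Integration.integrable_cong)
next
  case (Suc n)
  then show ?thesis
    using integrable_increment_exp[of 0 "real k * \<delta>" \<theta>] step_pos
    by (simp add: start_zero cong: Bochner_Integration.integrable_cong)
qed

text \<open>
  Raising the cap from \<open>k\<close> to \<open>k + 1\<close> changes the stopped martingale only where the path has not been
  stopped up to time \<open>k \<delta>\<close>. This event and the current value are functions of the past increments, and the factor that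
  comes in is independent of them with mean one.
\<close>

lemma optional_stopping_grid:
  "integrable M (\<lambda>\<omega>. exp_martingale \<theta> (real (grid_stop k \<omega>) * \<delta>) (W (real (grid_stop k \<omega>) * \<delta>) \<omega>)) \<and>
   expectation (\<lambda>\<omega>. exp_martingale \<theta> (real (grid_stop k \<omega>) * \<delta>) (W (real (grid_stop k \<omega>) * \<delta>) \<omega>)) = 1"
proof (induction k)
  case 0
  have "exp_martingale \<theta> (real (grid_stop 0 \<omega>) * \<delta>) (W (real (grid_stop 0 \<omega>) * \<delta>) \<omega>) = 1"
    if "\<omega> \<in> space M" for \<omega>
    using start_zero[OF that] by (simp add: exp_martingale_def)
  then show ?case
    by (simp add: prob_space cong: Bochner_Integration.integrable_cong Bochner_Integration.integral_cong)
next
  case (Suc k)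
  let ?E = "\<lambda>i \<omega>. exp_martingale \<theta> (real i * \<delta>) (W (real i * \<delta>) \<omega>)"
  let ?past = "\<lambda>\<omega>. \<lambda>i\<in>{..<k}. increment i \<omega>"
  \<comment> \<open>the martingale at time \<open>k \<delta>\<close> on the event of not being stopped, as a function of the increments\<close>
  define F where "F v = (if \<forall>j\<in>{..k}. Q (real j * \<delta>) (\<Sum>i<j. v i)
      then exp_martingale \<theta> (real k * \<delta>) (\<Sum>i<k. v i) else 0)" for v :: "nat \<Rightarrow> real"
  have sum_measurable: "(\<lambda>v. \<Sum>i<j. v i) \<in> borel_measurable (PiM {..<k} (\<lambda>_. borel::real measure))" if "j \<le> k" for j
    using that by (intro borel_measurable_sum measurable_component_singleton) auto
  have F_measurable: "F \<in> borel_measurable (PiM {..<k} (\<lambda>_. borel))"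
  proof -
    have [measurable]: "Measurable.pred (PiM {..<k} (\<lambda>_. borel)) (\<lambda>v. Q (real j * \<delta>) (\<Sum>i<j. v i))"
      if "j \<in> {..k}" for j
      using measurable_compose[OF sum_measurable[of j] Q_measurable[of "real j * \<delta>"]] that by simp
    have "Measurable.pred (PiM {..<k} (\<lambda>_. borel)) (\<lambda>v. \<forall>j\<in>{..k}. Q (real j * \<delta>) (\<Sum>i<j. v i))"
      by (intro pred_intros_finite) auto
    then show ?thesis
      unfolding F_def using sum_measurable[OF order_refl]
      by (intro measurable_If borel_measurable_const measurable_exp_martingale) (auto simp: pred_def)
  qed
  have F_eq: "F (?past \<omega>) =
      (if grid_stop k \<omega> = k \<and> Q (real k * \<delta>) (W (real k * \<delta>) \<omega>) then ?E k \<omega> else 0)"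
    if "\<omega> \<in> space M" for \<omega>
  proof -
    have s: "(\<Sum>i<j. ?past \<omega> i) = W (real j * \<delta>) \<omega>" if "j \<in> {..k}" for j
      using that by (intro trans[OF _ grid_value_eq_sum[OF \<open>\<omega> \<in> space M\<close>, symmetric]] sum.cong) auto
    have "(\<forall>j\<in>{..k}. Q (real j * \<delta>) (W (real j * \<delta>) \<omega>)) \<longleftrightarrow>
        grid_stop k \<omega> = k \<and> Q (real k * \<delta>) (W (real k * \<delta>) \<omega>)"
      unfolding stop_index_eq_iff by (metis atMost_iff le_less)
    then show ?thesis
      unfolding F_def s[OF atMost_iff[THEN iffD2, OF order_refl]] by (simp only: s cong: ball_cong)
  qed
  have past_measurable: "?past \<in> measurable M (PiM {..<k} (\<lambda>_. borel))"
    using indep_past_increment[of k] by (rule indep_var_rv1)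
  have "(\<lambda>\<omega>. F (?past \<omega>)) \<in> borel_measurable M"
    by (rule measurable_compose[OF past_measurable F_measurable])
  then have intF: "integrable M (\<lambda>\<omega>. F (?past \<omega>))"
  proof (rule Bochner_Integration.integrable_bound[OF integrable_grid[of k]], intro AE_I2)
    show "norm (F (?past \<omega>)) \<le> norm (?E k \<omega>)" if "\<omega> \<in> space M" for \<omega>
      unfolding F_eq[OF that] by simp
  qed
  let ?D = "\<lambda>\<omega>. F (?past \<omega>) * exp_martingale \<theta> \<delta> (increment k \<omega>) - F (?past \<omega>)"
  note intFD = integrable_past_times_increment[OF F_measurable intF]
  have D: "integrable M ?D" "expectation ?D = 0"
    using Bochner_Integration.integrable_diff[OF intFD intF] Bochner_Integration.integral_diff[OF intFD intF]
      expectation_past_times_increment[OF F_measurable intF] by argo+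
  have step: "?E (grid_stop (Suc k) \<omega>) \<omega> = ?E (grid_stop k \<omega>) \<omega> + ?D \<omega>" if "\<omega> \<in> space M" for \<omega>
  proof -
    have "real k * \<delta> + \<delta> = real (Suc k) * \<delta>" "W (real k * \<delta>) \<omega> + increment k \<omega> = W (real (Suc k) * \<delta>) \<omega>"
      by (simp_all add: algebra_simps)
    then have "?E (Suc k) \<omega> = ?E k \<omega> * exp_martingale \<theta> \<delta> (increment k \<omega>)"
      using exp_martingale_add[of \<theta> "real k * \<delta>" \<delta> "W (real k * \<delta>) \<omega>" "increment k \<omega>"] by metis
    then show ?thesis
      unfolding F_eq[OF that] stop_index.simps by (cases "grid_stop k \<omega> = k \<and> Q (real k * \<delta>) (W (real k * \<delta>) \<omega>)") auto
  qed
  note stopped = Suc[THEN conjunct1] Suc[THEN conjunct2]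
  show ?case
  proof
    show "integrable M (\<lambda>\<omega>. ?E (grid_stop (Suc k) \<omega>) \<omega>)"
      by (rule Bochner_Integration.integrable_cong[OF refl step, THEN iffD2, OF _ Bochner_Integration.integrable_add[OF stopped(1) D(1)]])
    have "expectation (\<lambda>\<omega>. ?E (grid_stop (Suc k) \<omega>) \<omega>) = expectation (\<lambda>\<omega>. ?E (grid_stop k \<omega>) \<omega> + ?D \<omega>)"
      by (rule Bochner_Integration.integral_cong[OF refl step])
    also have "\<dots> = 1"
      unfolding Bochner_Integration.integral_add[OF stopped(1) D(1)] stopped(2) D(2) by simp
    finally show "expectation (\<lambda>\<omega>. ?E (grid_stop (Suc k) \<omega>) \<omega>) = 1" .
  qed
qed

end

end

section \<open>Leaving a wedge along a continuous path\<close>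

definition wedge :: "real \<Rightarrow> real \<Rightarrow> real \<Rightarrow> real \<Rightarrow> real \<Rightarrow> real \<Rightarrow> bool" where
  "wedge b c \<alpha> \<beta> s x \<longleftrightarrow> x \<le> b + \<alpha> * s \<and> - x \<le> c + \<beta> * s"

lemma pred_wedge [measurable]: "Measurable.pred borel (wedge b c \<alpha> \<beta> s)"
  unfolding wedge_def by measurable

text \<open>The first time at which \<open>Q\<close> fails, capped at \<open>t\<close>; the cap belongs to the set, so the infimum exists.\<close>

definition exit_time :: "(real \<Rightarrow> real \<Rightarrow> bool) \<Rightarrow> (real \<Rightarrow> real) \<Rightarrow> real \<Rightarrow> real" where
  "exit_time Q w t = Inf (insert t {s. 0 \<le> s \<and> s \<le> t \<and> \<not> Q s (w s)})"

lemma exit_time_lower: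
  assumes "s = t \<or> 0 \<le> s \<and> s \<le> t \<and> \<not> Q s (w s)" "0 \<le> t"
  shows "exit_time Q w t \<le> s"
  unfolding exit_time_def using assms by (intro cInf_lower) (auto intro: bdd_belowI[of _ 0])

lemma exit_time_le: "0 \<le> t \<Longrightarrow> exit_time Q w t \<le> t"
  by (rule exit_time_lower) auto

lemma exit_time_greatest:
  assumes "u \<le> t" "\<And>s. 0 \<le> s \<Longrightarrow> s \<le> t \<Longrightarrow> \<not> Q s (w s) \<Longrightarrow> u \<le> s"
  shows "u \<le> exit_time Q w t"
  unfolding exit_time_def using assms by (intro cInf_greatest) auto

lemma exit_time_nonneg: "0 \<le> t \<Longrightarrow> 0 \<le> exit_time Q w t"
  by (rule exit_time_greatest) auto

lemma before_exit_time:
  assumes "0 \<le> s" "s < exit_time Q w t" "0 \<le> t"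
  shows "Q s (w s)"
proof (rule ccontr)
  assume "\<not> Q s (w s)"
  moreover have "s \<le> t" using assms exit_time_le[of t Q w] by auto
  ultimately have "exit_time Q w t \<le> s" using assms by (intro exit_time_lower) auto
  with assms show False by simp
qed

lemma wedge_at_exit_time:
  assumes cont: "continuous_on {0..} w" and "w 0 = 0" "0 \<le> b" "0 \<le> c" "0 \<le> t"
  shows "wedge b c \<alpha> \<beta> (exit_time (wedge b c \<alpha> \<beta>) w t) (w (exit_time (wedge b c \<alpha> \<beta>) w t))"
proof -
  define \<sigma> where "\<sigma> = exit_time (wedge b c \<alpha> \<beta>) w t"
  have "0 \<le> \<sigma>" unfolding \<sigma>_def by (rule exit_time_nonneg) fact
  have inside: "w s \<le> b + \<alpha> * s \<and> - w s \<le> c + \<beta> * s" if "s \<in> {0..<\<sigma>}" for s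
    using that before_exit_time[of s "wedge b c \<alpha> \<beta>" w t] \<open>0 \<le> t\<close> unfolding \<sigma>_def wedge_def by simp
  have "wedge b c \<alpha> \<beta> \<sigma> (w \<sigma>)"
  proof (cases "\<sigma> = 0")
    case True
    with assms show ?thesis by (simp add: wedge_def)
  next
    case False
    with \<open>0 \<le> \<sigma>\<close> have cl: "closure {0..<\<sigma>} = {0..\<sigma>}" by simp
    have cw: "continuous_on (closure {0..<\<sigma>}) w"
      unfolding cl by (rule continuous_on_subset[OF cont]) auto
    have mem: "\<sigma> \<in> closure {0..<\<sigma>}" unfolding cl using \<open>0 \<le> \<sigma>\<close> by simp
    have "0 \<le> b + \<alpha> * \<sigma> - w \<sigma>"
      by (rule continuous_ge_on_closure[OF _ mem]) (intro continuous_intros cw, use inside in force)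
    moreover have "0 \<le> c + \<beta> * \<sigma> + w \<sigma>"
      by (rule continuous_ge_on_closure[OF _ mem]) (intro continuous_intros cw, use inside in force)
    ultimately show ?thesis by (simp add: wedge_def)
  qed
  then show ?thesis by (simp add: \<sigma>_def)
qed

text \<open>
  The wedge is closed, so a path that is outside stays outside for a while. A grid of mesh less than \<open>\<eta>\<close> cannot
  miss such a time interval.
\<close>

lemma outside_wedge_open:
  assumes cont: "continuous_on {0..} w" and "0 \<le> s" "\<not> wedge b c \<alpha> \<beta> s (w s)"
  obtains \<eta> where "0 < \<eta>" "\<And>r. s \<le> r \<Longrightarrow> r < s + \<eta> \<Longrightarrow> \<not> wedge b c \<alpha> \<beta> r (w r)"
proof -
  let ?f = "\<lambda>r. max (w r - (b + \<alpha> * r)) (- w r - (c + \<beta> * r))"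
  have out: "\<not> wedge b c \<alpha> \<beta> r (w r) \<longleftrightarrow> 0 < ?f r" for r by (auto simp: wedge_def)
  have "continuous_on {0..} ?f" by (intro continuous_intros cont)
  then have "(?f \<longlongrightarrow> ?f s) (at s within {0..})" using assms by (auto simp: continuous_on_def)
  then have "\<forall>\<^sub>F r in at s within {0..}. 0 < ?f r"
    by (rule order_tendstoD) (use assms out in blast)
  then obtain \<eta> where "0 < \<eta>" and \<eta>: "\<And>r. 0 \<le> r \<Longrightarrow> r \<noteq> s \<Longrightarrow> dist r s < \<eta> \<Longrightarrow> 0 < ?f r"
    unfolding eventually_at by auto
  show thesis
  proof (rule that[OF \<open>0 < \<eta>\<close>])
    fix r assume "s \<le> r" "r < s + \<eta>"
    then show "\<not> wedge b c \<alpha> \<beta> r (w r)"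
      using \<eta>[of r] assms out by (cases "r = s") (auto simp: dist_real_def)
  qed
qed

lemma grid_stop_tendsto_exit_time:
  fixes w :: "real \<Rightarrow> real" and b c \<alpha> \<beta> :: real
  assumes cont: "continuous_on {0..} w" and "0 < t"
  defines "Q \<equiv> wedge b c \<alpha> \<beta>"
  defines "\<tau> \<equiv> (\<lambda>n. real (stop_index Q (t / real (Suc n)) w (Suc n)) * (t / real (Suc n)))"
  shows "\<tau> \<longlonglongrightarrow> exit_time Q w t"
proof (rule order_tendstoI)
  have \<tau>_le: "\<tau> n \<le> t" for n
  proof -
    have "real (stop_index Q (t / real (Suc n)) w (Suc n)) \<le> real (Suc n)"
      using stop_index_le[of Q "t / real (Suc n)" w "Suc n"] by (simp only: of_nat_le_iff)
    then have "\<tau> n \<le> real (Suc n) * (t / real (Suc n))"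
      unfolding \<tau>_def using \<open>0 < t\<close> by (intro mult_right_mono) auto
    then show ?thesis by simp
  qed
  have ge: "exit_time Q w t \<le> \<tau> n" for n
  proof (rule exit_time_lower)
    show "\<tau> n = t \<or> 0 \<le> \<tau> n \<and> \<tau> n \<le> t \<and> \<not> Q (\<tau> n) (w (\<tau> n))"
    proof (cases "stop_index Q (t / real (Suc n)) w (Suc n) = Suc n")
      case True
      then show ?thesis unfolding \<tau>_def by (simp del: stop_index.simps)
    next
      case False
      then have "stop_index Q (t / real (Suc n)) w (Suc n) < Suc n"
        using stop_index_le[of Q "t / real (Suc n)" w "Suc n"] by simp
      from stop_index_at[OF this] \<tau>_le[of n] \<open>0 < t\<close> show ?thesis unfolding \<tau>_def by auto
    qed
  qed (use \<open>0 < t\<close> in simp)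
  show "\<forall>\<^sub>F n in sequentially. u < \<tau> n" if "u < exit_time Q w t" for u
    using ge that by (intro always_eventually) (auto intro: less_le_trans)
  fix u assume u: "exit_time Q w t < u"
  then obtain s where s: "s = t \<or> 0 \<le> s \<and> s \<le> t \<and> \<not> Q s (w s)" "s < u"
    unfolding exit_time_def by (subst (asm) cInf_less_iff) (use \<open>0 < t\<close> in \<open>auto intro: bdd_belowI[of _ 0]\<close>)
  show "\<forall>\<^sub>F n in sequentially. \<tau> n < u"
  proof (cases "s = t")
    case True
    with \<tau>_le s show ?thesis by (intro always_eventually) (auto intro: le_less_trans)
  next
    case False
    with s have s': "0 \<le> s" "s < t" "\<not> wedge b c \<alpha> \<beta> s (w s)" by (auto simp: Q_def)
    obtain \<eta> where \<eta>: "0 < \<eta>" "\<And>r. s \<le> r \<Longrightarrow> r < s + \<eta> \<Longrightarrow> \<not> wedge b c \<alpha> \<beta> r (w r)"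
      using outside_wedge_open[OF cont s'(1,3)] by blast
    define d where "d = min \<eta> (min (t - s) (u - s))"
    have "0 < d" using \<eta> s s' by (simp add: d_def)
    have "(\<lambda>n. t / real (Suc n)) \<longlonglongrightarrow> 0"
      using tendsto_mult[OF tendsto_const[of t] LIMSEQ_inverse_real_of_nat] by (simp add: divide_inverse)
    then have "\<forall>\<^sub>F n in sequentially. t / real (Suc n) < d"
      using \<open>0 < d\<close> by (rule order_tendstoD)
    then show ?thesis
    proof eventually_elim
      case (elim n)
      define \<delta> where "\<delta> = t / real (Suc n)"
      define k where "k = nat \<lceil>s / \<delta>\<rceil>"
      have "0 < \<delta>" "\<delta> < d" using \<open>0 < t\<close> elim by (auto simp: \<delta>_def)
      have "0 \<le> s / \<delta>" using s' \<open>0 < \<delta>\<close> by simp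
      then have k: "s / \<delta> \<le> real k" "real k < s / \<delta> + 1"
        unfolding k_def by linarith+
      have k1: "s \<le> real k * \<delta>" using k(1) \<open>0 < \<delta>\<close> by (simp add: pos_divide_le_eq)
      have "real k * \<delta> < (s / \<delta> + 1) * \<delta>" using k(2) \<open>0 < \<delta>\<close> by (intro mult_strict_right_mono)
      then have k2: "real k * \<delta> < s + \<delta>" using \<open>0 < \<delta>\<close> by (simp add: distrib_right)
      have "\<not> Q (real k * \<delta>) (w (real k * \<delta>))"
        unfolding Q_def by (rule \<eta>(2)) (use k1 k2 \<open>\<delta> < d\<close> in \<open>auto simp: d_def\<close>)
      then have "stop_index Q \<delta> w (Suc n) \<le> k"
        using stop_index_before[of k Q \<delta> w "Suc n"] by (meson not_le)
      then have "\<tau> n \<le> real k * \<delta>"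
        unfolding \<tau>_def \<delta>_def[symmetric] using \<open>0 < \<delta>\<close> by (intro mult_right_mono) (simp_all only: of_nat_le_iff less_imp_le)
      with k2 \<open>\<delta> < d\<close> show "\<tau> n < u" by (simp add: d_def)
    qed
  qed
qed

text \<open>
  The first hit of the line \<open>b + \<alpha> t\<close>. The lower side of a wedge is covered by applying it to the negated path.
\<close>

definition hit_time :: "real \<Rightarrow> real \<Rightarrow> (real \<Rightarrow> real) \<Rightarrow> ereal" where
  "hit_time b \<alpha> w = Inf (ereal ` {t. 0 \<le> t \<and> w t = b + \<alpha> * t})"

lemma below_line_if_no_hit:
  fixes w :: "real \<Rightarrow> real"
  assumes cont: "continuous_on {0..} w" and "w 0 = 0" "0 < b"
    and no: "\<And>s. 0 \<le> s \<Longrightarrow> s \<le> u \<Longrightarrow> w s \<noteq> b + \<alpha> * s" and "0 \<le> u"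
  shows "w u < b + \<alpha> * u"
proof (rule ccontr)
  assume "\<not> ?thesis"
  then have "0 \<le> w u - (b + \<alpha> * u)" by simp
  moreover have "continuous_on {0..u} (\<lambda>s. w s - (b + \<alpha> * s))"
    by (intro continuous_intros continuous_on_subset[OF cont]) auto
  ultimately obtain s where "0 \<le> s" "s \<le> u" "w s - (b + \<alpha> * s) = 0"
    using IVT'[of "\<lambda>s. w s - (b + \<alpha> * s)" 0 0 u] assms by auto
  with no[of s] show False by simp
qed

text \<open>The hitting set is closed, hence its infimum is attained; before it the intermediate value theorem applies.\<close>

lemma hit_time_cases:
  fixes w :: "real \<Rightarrow> real"
  assumes cont: "continuous_on {0..} w" and "w 0 = 0" "0 < b"
  obtains (finite) \<tau> where "hit_time b \<alpha> w = ereal \<tau>" "0 < \<tau>" "w \<tau> = b + \<alpha> * \<tau>"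
      "\<And>s. 0 \<le> s \<Longrightarrow> s < \<tau> \<Longrightarrow> w s < b + \<alpha> * s"
    | (infinite) "hit_time b \<alpha> w = \<infinity>" "\<And>s. 0 \<le> s \<Longrightarrow> w s < b + \<alpha> * s"
proof (cases "{t. 0 \<le> t \<and> w t = b + \<alpha> * t} = {}")
  case True
  then have "hit_time b \<alpha> w = \<infinity>"
    unfolding hit_time_def by (simp only: image_empty Inf_empty top_ereal_def)
  with True show ?thesis
    using below_line_if_no_hit[OF assms, of _ \<alpha>] by (intro infinite) auto
next
  case False
  let ?A = "{t. 0 \<le> t \<and> w t = b + \<alpha> * t}"
  define \<tau> where "\<tau> = Inf ?A"
  have bdd: "bdd_below ?A" by (auto intro: bdd_belowI[of _ 0])
  have "closed {t \<in> {0..}. w t - (b + \<alpha> * t) = 0}"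
    by (intro continuous_closed_preimage_constant continuous_intros cont)
  also have "{t \<in> {0..}. w t - (b + \<alpha> * t) = 0} = ?A" by auto
  finally have mem: "\<tau> \<in> ?A"
    unfolding \<tau>_def using False bdd by (intro closed_contains_Inf) auto
  have lower: "\<tau> \<le> s" if "s \<in> ?A" for s
    unfolding \<tau>_def using that bdd by (intro cInf_lower)
  have "hit_time b \<alpha> w = ereal \<tau>"
    unfolding hit_time_def
  proof (rule antisym)
    show "Inf (ereal ` ?A) \<le> ereal \<tau>" using mem by (intro Inf_lower) auto
    show "ereal \<tau> \<le> Inf (ereal ` ?A)" using lower by (intro Inf_greatest) auto
  qed
  moreover have "0 < \<tau>" using mem assms by (cases "\<tau> = 0") auto
  moreover have "w s < b + \<alpha> * s" if "0 \<le> s" "s < \<tau>" for s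
    using that lower by (intro below_line_if_no_hit[OF assms]) force+
  ultimately show ?thesis using mem by (intro finite) auto
qed

text \<open>
  A path that stays strictly inside the wedge on a compact time interval keeps a positive distance to its sides there, and so
  it also stays inside every sufficiently close smaller wedge.
\<close>

lemma eventually_exit_time_ge:
  assumes cont: "continuous_on {0..} w" and "0 \<le> u"
    and strict: "\<And>s. 0 \<le> s \<Longrightarrow> s \<le> u \<Longrightarrow> w s < x0 + \<alpha> * s \<and> - w s < y0 + \<beta> * s"
    and x: "x \<longlonglongrightarrow> x0" and y: "y \<longlonglongrightarrow> y0" and t: "filterlim t at_top sequentially"
  shows "\<forall>\<^sub>F m in sequentially. u \<le> exit_time (wedge (x m) (y m) \<alpha> \<beta>) w (t m)"
proof -
  let ?f = "\<lambda>s. min (x0 + \<alpha> * s - w s) (y0 + \<beta> * s + w s)"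
  have "continuous_on {0..u} ?f" by (intro continuous_intros continuous_on_subset[OF cont]) auto
  then obtain r where r: "r \<in> {0..u}" "\<And>s. s \<in> {0..u} \<Longrightarrow> ?f r \<le> ?f s"
    using continuous_attains_inf[of "{0..u}" ?f] assms by auto
  have pos: "0 < ?f r" using strict[of r] r(1) by auto
  have "\<forall>\<^sub>F m in sequentially. x0 - ?f r < x m" "\<forall>\<^sub>F m in sequentially. y0 - ?f r < y m"
    using order_tendstoD(1)[OF x, of "x0 - ?f r"] order_tendstoD(1)[OF y, of "y0 - ?f r"] pos by auto
  moreover have "\<forall>\<^sub>F m in sequentially. u \<le> t m"
    using t by (simp add: filterlim_at_top)
  ultimately show ?thesis
  proof eventually_elim
    case (elim m)
    have "wedge (x m) (y m) \<alpha> \<beta> s (w s)" if "0 \<le> s" "s \<le> u" for s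
      using r(2)[of s] that elim unfolding wedge_def by (simp add: min_def split: if_splits)
    then show ?case using elim(3) by (intro exit_time_greatest) (auto intro: le_cases)
  qed
qed

section \<open>Optional stopping at the exit from a wedge\<close>

text \<open>
  The value of the martingale at the exit: on the upper side the path has the value \<open>x0 + \<alpha> T\<close>, on the lower side
  \<open>- y0 - \<beta> T\<close>, and paths that never leave contribute \<open>0\<close>, the limit of the martingale along them.
\<close>

definition exit_functional :: "real \<Rightarrow> real \<Rightarrow> real \<Rightarrow> real \<Rightarrow> real \<Rightarrow> (real \<Rightarrow> real) \<Rightarrow> real" where
  "exit_functional \<theta> x0 y0 \<alpha> \<beta> w =
    (if hit_time x0 \<alpha> w < hit_time y0 \<beta> (\<lambda>s. - w s)
     then exp (\<theta> * x0 - (\<theta>\<^sup>2 / 2 - \<alpha> * \<theta>) * real_of_ereal (hit_time x0 \<alpha> w)) else 0) +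
    (if hit_time y0 \<beta> (\<lambda>s. - w s) < hit_time x0 \<alpha> w
     then exp (- \<theta> * y0 - (\<theta>\<^sup>2 / 2 + \<beta> * \<theta>) * real_of_ereal (hit_time y0 \<beta> (\<lambda>s. - w s))) else 0)"

text \<open>
  The admissible \<open>\<theta>\<close> are those for which the drift term \<open>- \<theta>\<^sup>2 s / 2\<close> wins over the growth of \<open>\<theta> x\<close> along the
  side of the wedge that lies in the direction of \<open>\<theta>\<close>.
\<close>

lemma exp_martingale_decay_in_wedge:
  assumes "\<theta> > 2 * \<alpha> \<or> \<theta> < - 2 * \<beta>" "0 \<le> \<alpha>" "0 \<le> \<beta>" "0 \<le> x0" "0 \<le> y0"
  obtains \<kappa> where "0 < \<kappa>"
    "\<And>s x. 0 \<le> s \<Longrightarrow> wedge x0 y0 \<alpha> \<beta> s x \<Longrightarrow> exp_martingale \<theta> s x \<le> exp (\<bar>\<theta>\<bar> * (x0 + y0)) * exp (- \<kappa> * s)"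
proof -
  have "\<exists>\<kappa>>0. \<forall>s x. 0 \<le> s \<longrightarrow> wedge x0 y0 \<alpha> \<beta> s x \<longrightarrow> \<theta> * x - \<theta>\<^sup>2 * s / 2 \<le> \<bar>\<theta>\<bar> * (x0 + y0) - \<kappa> * s"
    using assms(1)
  proof
    assume "\<theta> > 2 * \<alpha>"
    then have "0 < \<theta>" using assms by simp
    show ?thesis
    proof (intro exI[of _ "\<theta> * (\<theta> / 2 - \<alpha>)"] conjI allI impI)
      show "0 < \<theta> * (\<theta> / 2 - \<alpha>)" using \<open>\<theta> > 2 * \<alpha>\<close> \<open>0 < \<theta>\<close> by simp
      fix s x assume "0 \<le> s" "wedge x0 y0 \<alpha> \<beta> s x"
      then have "\<theta> * x \<le> \<theta> * (x0 + \<alpha> * s)" using \<open>0 < \<theta>\<close> by (simp add: wedge_def)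
      moreover have "0 \<le> \<theta> * y0" using \<open>0 < \<theta>\<close> assms by simp
      ultimately show "\<theta> * x - \<theta>\<^sup>2 * s / 2 \<le> \<bar>\<theta>\<bar> * (x0 + y0) - \<theta> * (\<theta> / 2 - \<alpha>) * s"
        using \<open>0 < \<theta>\<close> by (simp add: algebra_simps power2_eq_square)
    qed
  next
    assume "\<theta> < - 2 * \<beta>"
    then have "0 < - \<theta>" using assms by simp
    show ?thesis
    proof (intro exI[of _ "(- \<theta>) * (- \<theta> / 2 - \<beta>)"] conjI allI impI)
      show "0 < (- \<theta>) * (- \<theta> / 2 - \<beta>)" using \<open>\<theta> < - 2 * \<beta>\<close> \<open>0 < - \<theta>\<close> by (intro mult_pos_pos) auto
      fix s x assume "0 \<le> s" "wedge x0 y0 \<alpha> \<beta> s x"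
      then have "(- \<theta>) * (- x) \<le> (- \<theta>) * (y0 + \<beta> * s)"
        using \<open>0 < - \<theta>\<close> by (intro mult_left_mono) (auto simp: wedge_def)
      moreover have "0 \<le> (- \<theta>) * x0" using \<open>0 < - \<theta>\<close> assms by (intro mult_nonneg_nonneg) auto
      ultimately show "\<theta> * x - \<theta>\<^sup>2 * s / 2 \<le> \<bar>\<theta>\<bar> * (x0 + y0) - (- \<theta>) * (- \<theta> / 2 - \<beta>) * s"
        using \<open>0 < - \<theta>\<close> by (simp add: algebra_simps power2_eq_square)
    qed
  qed
  then obtain \<kappa> where "\<kappa> > 0" and
    \<kappa>: "\<And>s x. 0 \<le> s \<Longrightarrow> wedge x0 y0 \<alpha> \<beta> s x \<Longrightarrow> \<theta> * x - \<theta>\<^sup>2 * s / 2 \<le> \<bar>\<theta>\<bar> * (x0 + y0) - \<kappa> * s"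
    by blast
  show thesis
    by (rule that[OF \<open>\<kappa> > 0\<close>]) (simp add: exp_martingale_def \<kappa> flip: exp_add)
qed

lemma wedge_mono: "wedge b c \<alpha> \<beta> s x \<Longrightarrow> b \<le> b' \<Longrightarrow> c \<le> c' \<Longrightarrow> wedge b' c' \<alpha> \<beta> s x"
  unfolding wedge_def by linarith

text \<open>
  At the exit time \<open>\<tau>\<close> from the limit wedge the path is strictly outside every smaller wedge, and before \<open>\<tau>\<close> it
  is eventually inside.
\<close>

lemma exit_time_tendsto:
  assumes cont: "continuous_on {0..} w" and "0 < \<tau>"
    and strict: "\<And>s. 0 \<le> s \<Longrightarrow> s < \<tau> \<Longrightarrow> w s < x0 + \<alpha> * s \<and> - w s < y0 + \<beta> * s"
    and bdry: "w \<tau> = x0 + \<alpha> * \<tau> \<or> - w \<tau> = y0 + \<beta> * \<tau>"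
    and x: "x \<longlonglongrightarrow> x0" "\<And>m. x m < x0" and y: "y \<longlonglongrightarrow> y0" "\<And>m. y m < y0"
    and t: "filterlim t at_top sequentially"
  shows "(\<lambda>m. exit_time (wedge (x m) (y m) \<alpha> \<beta>) w (t m)) \<longlonglongrightarrow> \<tau>"
proof -
  have tm: "\<forall>\<^sub>F m in sequentially. \<tau> \<le> t m"
    using t by (simp add: filterlim_at_top)
  have le: "\<forall>\<^sub>F m in sequentially. exit_time (wedge (x m) (y m) \<alpha> \<beta>) w (t m) \<le> \<tau>"
    using tm
  proof eventually_elim
    case (elim m)
    have "\<not> wedge (x m) (y m) \<alpha> \<beta> \<tau> (w \<tau>)"
      using bdry x(2)[of m] y(2)[of m] by (auto simp: wedge_def)
    then show ?case
      using \<open>0 < \<tau>\<close> elim by (intro exit_time_lower) auto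
  qed
  show ?thesis
  proof (rule order_tendstoI)
    show "\<forall>\<^sub>F m in sequentially. exit_time (wedge (x m) (y m) \<alpha> \<beta>) w (t m) < u" if "\<tau> < u" for u
      using le by eventually_elim (use that in simp)
    fix u assume "u < \<tau>"
    define v where "v = max 0 ((u + \<tau>) / 2)"
    have v: "0 \<le> v" "u < v" "v < \<tau>" using \<open>u < \<tau>\<close> \<open>0 < \<tau>\<close> by (auto simp: v_def max_def field_simps)
    have "\<forall>\<^sub>F m in sequentially. v \<le> exit_time (wedge (x m) (y m) \<alpha> \<beta>) w (t m)"
      using v strict by (intro eventually_exit_time_ge[OF cont _ _ x(1) y(1) t]) auto
    then show "\<forall>\<^sub>F m in sequentially. u < exit_time (wedge (x m) (y m) \<alpha> \<beta>) w (t m)"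
      by eventually_elim (use v in simp)
  qed
qed

lemma exp_martingale_tendsto:
  assumes cont: "continuous_on {0..} w" and "\<sigma> \<longlonglongrightarrow> s" "0 \<le> s" "\<And>m::nat. 0 \<le> \<sigma> m"
  shows "(\<lambda>m. exp_martingale \<theta> (\<sigma> m) (w (\<sigma> m))) \<longlonglongrightarrow> exp_martingale \<theta> s (w s)"
proof -
  have "(\<lambda>m. w (\<sigma> m)) \<longlonglongrightarrow> w s"
    using assms by (intro continuous_on_tendsto_compose[OF cont]) auto
  then show ?thesis
    unfolding exp_martingale_def using assms by (intro tendsto_intros) auto
qed

lemma exp_martingale_tendsto_exit_functional:
  assumes cont: "continuous_on {0..} w" and w0: "w 0 = 0" and "0 < x0" "0 < y0" "0 \<le> \<alpha>" "0 \<le> \<beta>"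
    and \<theta>: "\<theta> > 2 * \<alpha> \<or> \<theta> < - 2 * \<beta>"
    and x: "x \<longlonglongrightarrow> x0" "\<And>m. 0 < x m" "\<And>m. x m < x0" and y: "y \<longlonglongrightarrow> y0" "\<And>m. 0 < y m" "\<And>m. y m < y0"
    and t: "filterlim t at_top sequentially" "\<And>m. 0 < t m"
  defines "\<sigma> \<equiv> (\<lambda>m. exit_time (wedge (x m) (y m) \<alpha> \<beta>) w (t m))"
  shows "(\<lambda>m. exp_martingale \<theta> (\<sigma> m) (w (\<sigma> m))) \<longlonglongrightarrow> exit_functional \<theta> x0 y0 \<alpha> \<beta> w"
proof -
  have cont': "continuous_on {0..} (\<lambda>s. - w s)" using cont by (intro continuous_intros)
  have w0': "- w 0 = 0" using w0 by simp
  have \<sigma>_nonneg: "0 \<le> \<sigma> m" for m unfolding \<sigma>_def using t(2)[of m] by (intro exit_time_nonneg) auto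
  have in_wedge: "wedge x0 y0 \<alpha> \<beta> (\<sigma> m) (w (\<sigma> m))" for m
    using wedge_at_exit_time[OF cont w0, of "x m" "y m" "t m" \<alpha> \<beta>] x(2)[of m] y(2)[of m] t(2)[of m] x(3)[of m] y(3)[of m]
    unfolding \<sigma>_def by (intro wedge_mono[of "x m" "y m" _ _ _ _ x0 y0]) auto
  have limit: "\<sigma> \<longlonglongrightarrow> \<tau>" if "0 < \<tau>" "\<And>s. 0 \<le> s \<Longrightarrow> s < \<tau> \<Longrightarrow> w s < x0 + \<alpha> * s \<and> - w s < y0 + \<beta> * s"
    "w \<tau> = x0 + \<alpha> * \<tau> \<or> - w \<tau> = y0 + \<beta> * \<tau>" for \<tau>
    unfolding \<sigma>_def using that by (intro exit_time_tendsto[OF cont _ _ _ x(1,3) y(1,3) t(1)])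
  have no_exit: ?thesis
    if inf: "hit_time x0 \<alpha> w = \<infinity>" "hit_time y0 \<beta> (\<lambda>s. - w s) = \<infinity>"
      and strict: "\<And>s. 0 \<le> s \<Longrightarrow> w s < x0 + \<alpha> * s" "\<And>s. 0 \<le> s \<Longrightarrow> - w s < y0 + \<beta> * s"
  proof -
    obtain \<kappa> where "0 < \<kappa>" and \<kappa>: "\<And>s x. 0 \<le> s \<Longrightarrow> wedge x0 y0 \<alpha> \<beta> s x \<Longrightarrow>
        exp_martingale \<theta> s x \<le> exp (\<bar>\<theta>\<bar> * (x0 + y0)) * exp (- \<kappa> * s)"
      using exp_martingale_decay_in_wedge[OF \<theta> \<open>0 \<le> \<alpha>\<close> \<open>0 \<le> \<beta>\<close>, of x0 y0] \<open>0 < x0\<close> \<open>0 < y0\<close> by auto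
    have "filterlim \<sigma> at_top sequentially"
      unfolding filterlim_at_top_ge[where c = 0]
    proof safe
      fix u :: real assume "0 \<le> u"
      then show "\<forall>\<^sub>F m in sequentially. u \<le> \<sigma> m"
        unfolding \<sigma>_def using strict by (intro eventually_exit_time_ge[OF cont _ _ x(1) y(1) t(1)]) auto
    qed
    then have "filterlim (\<lambda>m. \<kappa> * \<sigma> m) at_top sequentially"
      using \<open>0 < \<kappa>\<close> by (intro filterlim_tendsto_pos_mult_at_top[OF tendsto_const])
    then have "(\<lambda>m. exp (- (\<kappa> * \<sigma> m))) \<longlonglongrightarrow> 0"
      by (intro filterlim_compose[OF exp_at_bot] filterlim_compose[OF filterlim_uminus_at_bot_at_top])
    then have lim0: "(\<lambda>m. exp (\<bar>\<theta>\<bar> * (x0 + y0)) * exp (- \<kappa> * \<sigma> m)) \<longlonglongrightarrow> 0"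
      by (intro tendsto_mult_right_zero) simp
    have "(\<lambda>m. exp_martingale \<theta> (\<sigma> m) (w (\<sigma> m))) \<longlonglongrightarrow> 0"
      by (rule tendsto_sandwich[OF _ _ tendsto_const lim0])
         (use \<kappa>[OF \<sigma>_nonneg in_wedge] in \<open>auto intro!: always_eventually less_imp_le exp_martingale_pos\<close>)
    then show ?thesis
      using inf by (simp add: exit_functional_def)
  qed
  have up: ?thesis if \<tau>: "hit_time x0 \<alpha> w = ereal \<tau>" "0 < \<tau>" "w \<tau> = x0 + \<alpha> * \<tau>" "\<And>s. 0 \<le> s \<Longrightarrow> s < \<tau> \<Longrightarrow> w s < x0 + \<alpha> * s"
    and lt: "ereal \<tau> < hit_time y0 \<beta> (\<lambda>s. - w s)" "\<And>s. 0 \<le> s \<Longrightarrow> s < \<tau> \<Longrightarrow> - w s < y0 + \<beta> * s" for \<tau>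
  proof -
    have "\<sigma> \<longlonglongrightarrow> \<tau>" using that by (intro limit) auto
    then have "(\<lambda>m. exp_martingale \<theta> (\<sigma> m) (w (\<sigma> m))) \<longlonglongrightarrow> exp_martingale \<theta> \<tau> (w \<tau>)"
      using \<tau> \<sigma>_nonneg by (intro exp_martingale_tendsto[OF cont]) auto
    also have "exp_martingale \<theta> \<tau> (w \<tau>) = exit_functional \<theta> x0 y0 \<alpha> \<beta> w"
      using \<tau> lt by (auto simp: exit_functional_def exp_martingale_def algebra_simps)
    finally show ?thesis .
  qed
  have down: ?thesis if \<tau>: "hit_time y0 \<beta> (\<lambda>s. - w s) = ereal \<tau>" "0 < \<tau>" "- w \<tau> = y0 + \<beta> * \<tau>" "\<And>s. 0 \<le> s \<Longrightarrow> s < \<tau> \<Longrightarrow> - w s < y0 + \<beta> * s"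
    and lt: "ereal \<tau> < hit_time x0 \<alpha> w" "\<And>s. 0 \<le> s \<Longrightarrow> s < \<tau> \<Longrightarrow> w s < x0 + \<alpha> * s" for \<tau>
  proof -
    have "\<sigma> \<longlonglongrightarrow> \<tau>" using that by (intro limit) auto
    then have "(\<lambda>m. exp_martingale \<theta> (\<sigma> m) (w (\<sigma> m))) \<longlonglongrightarrow> exp_martingale \<theta> \<tau> (w \<tau>)"
      using \<tau> \<sigma>_nonneg by (intro exp_martingale_tendsto[OF cont]) auto
    also have "w \<tau> = - y0 - \<beta> * \<tau>" using \<tau> by simp
    also have "exp_martingale \<theta> \<tau> (- y0 - \<beta> * \<tau>) = exit_functional \<theta> x0 y0 \<alpha> \<beta> w"
      using \<tau> lt by (auto simp: exit_functional_def exp_martingale_def algebra_simps)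
    finally show ?thesis .
  qed
  show ?thesis
    using cont w0 \<open>0 < x0\<close>
  proof (cases rule: hit_time_cases[where \<alpha> = \<alpha>])
    case (finite \<tau>1)
    note up_case = this
    show ?thesis
      using cont' w0' \<open>0 < y0\<close>
    proof (cases rule: hit_time_cases[where \<alpha> = \<beta>])
      case (finite \<tau>2)
      consider "\<tau>1 < \<tau>2" | "\<tau>2 < \<tau>1" | "\<tau>1 = \<tau>2" by linarith
      then show ?thesis
      proof cases
        case 3
        have "0 \<le> \<alpha> * \<tau>1" "0 \<le> \<beta> * \<tau>1" using up_case assms by auto
        then have False using up_case(3) finite(3) \<open>0 < x0\<close> \<open>0 < y0\<close> unfolding 3 by linarith
        then show ?thesis ..
      next
        case 1
        then show ?thesis using up_case finite by (intro up[of \<tau>1]) auto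
      next
        case 2
        then show ?thesis using up_case finite by (intro down[of \<tau>2]) auto
      qed
    next
      case infinite
      then show ?thesis using up_case by (intro up[of \<tau>1]) auto
    qed
  next
    case infinite
    note up_case = this
    show ?thesis
      using cont' w0' \<open>0 < y0\<close>
    proof (cases rule: hit_time_cases[where \<alpha> = \<beta>])
      case (finite \<tau>2)
      then show ?thesis using up_case by (intro down[of \<tau>2]) auto
    next
      case infinite
      then show ?thesis using up_case no_exit by auto
    qed
  qed
qed

context continuous_brownian_motion
begin

text \<open>
  Let the mesh tend to zero. The stopped values \<open>X n\<close> on the grids converge but may overshoot the wedge, so they are truncated at a
  level \<open>K\<close> above the bound for the limit. By \<open>x - min x K \<le> x\<^sup>2 / K\<close> the truncation
  costs at most \<open>exp (\<theta>\<^sup>2 t) / K\<close>, uniformly in the mesh.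
\<close>

lemma optional_stopping_wedge:
  assumes "0 \<le> b" "0 \<le> c" "0 < t"
    and bound: "\<And>s x. 0 \<le> s \<Longrightarrow> wedge b c \<alpha> \<beta> s x \<Longrightarrow> exp_martingale \<theta> s x \<le> C"
  defines "\<sigma> \<equiv> (\<lambda>\<omega>. exit_time (wedge b c \<alpha> \<beta>) (\<lambda>s. W s \<omega>) t)"
  shows "(\<lambda>\<omega>. exp_martingale \<theta> (\<sigma> \<omega>) (W (\<sigma> \<omega>) \<omega>)) \<in> borel_measurable M" (is "?X \<in> _")
    and "expectation (\<lambda>\<omega>. exp_martingale \<theta> (\<sigma> \<omega>) (W (\<sigma> \<omega>) \<omega>)) = 1"
proof -
  define \<tau> where "\<tau> n \<omega> = real (stop_index (wedge b c \<alpha> \<beta>) (t / real (Suc n)) (\<lambda>s. W s \<omega>) (Suc n)) * (t / real (Suc n))" for n \<omega>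
  define X where "X \<theta> n \<omega> = exp_martingale \<theta> (\<tau> n \<omega>) (W (\<tau> n \<omega>) \<omega>)" for \<theta> n \<omega>
  have step: "0 < t / real (Suc n)" for n using \<open>0 < t\<close> by simp
  have X: "integrable M (X \<theta> n)" "expectation (X \<theta> n) = 1" for \<theta> n
  proof -
    note stopped = optional_stopping_grid[of "wedge b c \<alpha> \<beta>", OF pred_wedge step[of n], of \<theta> "Suc n"]
    show "integrable M (X \<theta> n)" unfolding X_def \<tau>_def by (rule stopped[THEN conjunct1])
    show "expectation (X \<theta> n) = 1" unfolding X_def \<tau>_def by (rule stopped[THEN conjunct2])
  qed
  have X_measurable [measurable]: "X \<theta> n \<in> borel_measurable M" for \<theta> n using X by auto
  have \<tau>_range: "0 \<le> \<tau> n \<omega>" "\<tau> n \<omega> \<le> t" for n \<omega>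
  proof -
    have "real (stop_index (wedge b c \<alpha> \<beta>) (t / real (Suc n)) (\<lambda>s. W s \<omega>) (Suc n)) \<le> real (Suc n)"
      by (simp only: of_nat_le_iff stop_index_le)
    then have "\<tau> n \<omega> \<le> real (Suc n) * (t / real (Suc n))"
      unfolding \<tau>_def by (rule mult_right_mono) (use \<open>0 < t\<close> in simp)
    then show "\<tau> n \<omega> \<le> t" by simp
    show "0 \<le> \<tau> n \<omega>" unfolding \<tau>_def using \<open>0 < t\<close> by (intro mult_nonneg_nonneg) auto
  qed
  have lim: "(\<lambda>n. X \<theta> n \<omega>) \<longlonglongrightarrow> ?X \<omega>" if \<omega>: "\<omega> \<in> space M" for \<omega>
    unfolding X_def
  proof (rule exp_martingale_tendsto[OF continuous_path[OF \<omega>]])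
    show "(\<lambda>n. \<tau> n \<omega>) \<longlonglongrightarrow> \<sigma> \<omega>"
      unfolding \<tau>_def \<sigma>_def by (rule grid_stop_tendsto_exit_time[OF continuous_path[OF \<omega>] \<open>0 < t\<close>])
  qed (use \<tau>_range \<open>0 < t\<close> in \<open>auto simp: \<sigma>_def intro!: exit_time_nonneg\<close>)
  show measurable: "?X \<in> borel_measurable M"
    by (rule borel_measurable_LIMSEQ_real[OF lim]) auto
  have X_le: "?X \<omega> \<le> C" if \<omega>: "\<omega> \<in> space M" for \<omega>
    unfolding \<sigma>_def
    by (intro bound wedge_at_exit_time[OF continuous_path[OF \<omega>]] exit_time_nonneg) (use assms \<omega> start_zero in auto)
  have est: "1 - exp (\<theta>\<^sup>2 * t) / K \<le> expectation ?X \<and> expectation ?X \<le> 1" if K: "C \<le> K" "0 < K" for K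
  proof -
    have conv: "(\<lambda>n. expectation (\<lambda>\<omega>. min (X \<theta> n \<omega>) K)) \<longlonglongrightarrow> expectation (\<lambda>\<omega>. min (?X \<omega>) K)"
    proof (rule integral_dominated_convergence[where w = "\<lambda>_. K"])
      show "AE \<omega> in M. (\<lambda>n. min (X \<theta> n \<omega>) K) \<longlonglongrightarrow> min (?X \<omega>) K"
        by (intro AE_I2 tendsto_min lim tendsto_const)
      show "AE \<omega> in M. norm (min (X \<theta> n \<omega>) K) \<le> K" for n
        using K by (intro AE_I2) (simp add: X_def min_def less_imp_le[OF exp_martingale_pos])
      show "(\<lambda>\<omega>. min (X \<theta> n \<omega>) K) \<in> borel_measurable M" for n
        by (intro borel_measurable_min X_measurable borel_measurable_const)
      show "(\<lambda>\<omega>. min (?X \<omega>) K) \<in> borel_measurable M"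
        by (intro borel_measurable_min measurable borel_measurable_const)
    qed simp
    also have "expectation (\<lambda>\<omega>. min (?X \<omega>) K) = expectation ?X"
      using X_le K by (intro Bochner_Integration.integral_cong) force+
    finally have conv: "(\<lambda>n. expectation (\<lambda>\<omega>. min (X \<theta> n \<omega>) K)) \<longlonglongrightarrow> expectation ?X" .
    have int_min: "integrable M (\<lambda>\<omega>. min (X \<theta> n \<omega>) K)" for n
    proof (rule Bochner_Integration.integrable_bound[OF X(1)[of \<theta> n]])
      show "(\<lambda>\<omega>. min (X \<theta> n \<omega>) K) \<in> borel_measurable M"
        by (intro borel_measurable_min X_measurable borel_measurable_const)
      show "AE \<omega> in M. norm (min (X \<theta> n \<omega>) K) \<le> norm (X \<theta> n \<omega>)"
        using K by (intro AE_I2) (simp add: X_def min_def less_imp_le[OF exp_martingale_pos])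
    qed
    have upper: "expectation (\<lambda>\<omega>. min (X \<theta> n \<omega>) K) \<le> 1" for n
      using integral_mono[OF int_min X(1)[of \<theta> n]] X(2) by simp
    have lower: "1 - exp (\<theta>\<^sup>2 * t) / K \<le> expectation (\<lambda>\<omega>. min (X \<theta> n \<omega>) K)" for n
    proof -
      have "X \<theta> n \<omega> - exp (\<theta>\<^sup>2 * t) / K * X (2 * \<theta>) n \<omega> \<le> min (X \<theta> n \<omega>) K" for \<omega>
      proof (cases "X \<theta> n \<omega> \<le> K")
        case True
        then show ?thesis using K by (simp add: X_def less_imp_le[OF exp_martingale_pos])
      next
        case False
        have "(X \<theta> n \<omega>)\<^sup>2 \<le> exp (\<theta>\<^sup>2 * t) * X (2 * \<theta>) n \<omega>"
          unfolding X_def exp_martingale_square using \<tau>_range[of n \<omega>]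
          by (intro mult_right_mono) (auto simp: mult_left_mono less_imp_le[OF exp_martingale_pos])
        moreover have "X \<theta> n \<omega> * K \<le> (X \<theta> n \<omega>)\<^sup>2"
          unfolding power2_eq_square using False K by (intro mult_left_mono) auto
        ultimately have "X \<theta> n \<omega> \<le> exp (\<theta>\<^sup>2 * t) * X (2 * \<theta>) n \<omega> / K"
          using K by (simp add: pos_le_divide_eq)
        then show ?thesis using False K by simp
      qed
      then have "expectation (\<lambda>\<omega>. X \<theta> n \<omega> - exp (\<theta>\<^sup>2 * t) / K * X (2 * \<theta>) n \<omega>) \<le> expectation (\<lambda>\<omega>. min (X \<theta> n \<omega>) K)"
        by (intro integral_mono int_min Bochner_Integration.integrable_diff integrable_mult_right X)
      then show ?thesis
        using X by simp
    qed
    show ?thesis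
      by (intro conjI LIMSEQ_le_const[OF conv] LIMSEQ_le_const2[OF conv] exI[of _ 0] allI impI lower upper)
  qed
  have "(\<lambda>n. 1 - exp (\<theta>\<^sup>2 * t) * inverse (real (Suc n))) \<longlonglongrightarrow> 1 - exp (\<theta>\<^sup>2 * t) * 0"
    by (intro tendsto_intros LIMSEQ_inverse_real_of_nat)
  moreover have "\<forall>\<^sub>F n in sequentially. 1 - exp (\<theta>\<^sup>2 * t) * inverse (real (Suc n)) \<le> expectation ?X"
    using eventually_ge_at_top[of "nat \<lceil>C\<rceil>"]
  proof eventually_elim
    case (elim n)
    then have "C \<le> real (Suc n)" by linarith
    with est[of "real (Suc n)"] show ?case by (simp add: divide_inverse)
  qed
  ultimately have "1 - exp (\<theta>\<^sup>2 * t) * 0 \<le> expectation ?X"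
    by (rule tendsto_upperbound) simp
  moreover have "expectation ?X \<le> 1" using est[of "max 1 C"] by auto
  ultimately show "expectation ?X = 1" by simp
qed

text \<open>
  The wedge is shrunk by a factor \<open>r m\<close> tending to one and the time horizon tends to infinity; everything is bounded by
  the same constant, so that dominated convergence applies.
\<close>

theorem expectation_exit_functional:
  assumes "0 < x0" "0 < y0" "0 \<le> \<alpha>" "0 \<le> \<beta>" and \<theta>: "\<theta> > 2 * \<alpha> \<or> \<theta> < - 2 * \<beta>"
  shows "expectation (\<lambda>\<omega>. exit_functional \<theta> x0 y0 \<alpha> \<beta> (\<lambda>s. W s \<omega>)) = 1"
proof -
  define r where "r m = 1 - inverse (real (Suc (Suc m)))" for m
  have r_pos: "0 < r m" and r_less: "r m < 1" for m
    by (auto simp: r_def field_simps)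
  have "r \<longlonglongrightarrow> 1 - 0"
    unfolding r_def by (intro tendsto_intros LIMSEQ_Suc[OF LIMSEQ_inverse_real_of_nat])
  then have lim: "(\<lambda>m. r m * x) \<longlonglongrightarrow> x" for x
    using tendsto_mult_right[of r 1 sequentially x] by simp
  have t: "filterlim (\<lambda>m. real (Suc m)) at_top sequentially"
    by (rule filterlim_compose[OF filterlim_real_sequentially filterlim_Suc])
  define \<sigma> where "\<sigma> m \<omega> = exit_time (wedge (r m * x0) (r m * y0) \<alpha> \<beta>) (\<lambda>s. W s \<omega>) (real (Suc m))" for m \<omega>
  let ?X = "\<lambda>m \<omega>. exp_martingale \<theta> (\<sigma> m \<omega>) (W (\<sigma> m \<omega>) \<omega>)"
  have pos: "0 < r m * x0" "0 < r m * y0" and less: "r m * x0 < x0" "r m * y0 < y0" for m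
    using r_pos[of m] r_less[of m] assms by auto
  obtain \<kappa> where "0 < \<kappa>" and \<kappa>: "\<And>s x. 0 \<le> s \<Longrightarrow> wedge x0 y0 \<alpha> \<beta> s x \<Longrightarrow>
      exp_martingale \<theta> s x \<le> exp (\<bar>\<theta>\<bar> * (x0 + y0)) * exp (- \<kappa> * s)"
    using exp_martingale_decay_in_wedge[OF \<theta> \<open>0 \<le> \<alpha>\<close> \<open>0 \<le> \<beta>\<close>, of x0 y0] \<open>0 < x0\<close> \<open>0 < y0\<close> by auto
  define C where "C = exp (\<bar>\<theta>\<bar> * (x0 + y0))"
  have bound: "exp_martingale \<theta> s x \<le> C" if "0 \<le> s" "wedge x0 y0 \<alpha> \<beta> s x" for s x
  proof -
    have "C * exp (- \<kappa> * s) \<le> C * 1"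
      using that \<open>0 < \<kappa>\<close> unfolding C_def by (intro mult_left_mono) auto
    with \<kappa>[OF that] show ?thesis unfolding C_def by linarith
  qed
  have bound': "exp_martingale \<theta> s x \<le> C" if "0 \<le> s" "wedge (r m * x0) (r m * y0) \<alpha> \<beta> s x" for m s x
    using that less[of m] by (intro bound) (auto intro: wedge_mono)
  have X_measurable: "?X m \<in> borel_measurable M" and EX: "expectation (?X m) = 1" for m
  proof -
    have nn: "0 \<le> r m * x0" "0 \<le> r m * y0" "0 < real (Suc m)" using pos[of m] by auto
    show "?X m \<in> borel_measurable M" "expectation (?X m) = 1"
      unfolding \<sigma>_def by (rule optional_stopping_wedge[OF nn bound']; assumption)+
  qed
  have X_le: "?X m \<omega> \<le> C" if \<omega>: "\<omega> \<in> space M" for m \<omega>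
  proof (rule bound)
    show "wedge x0 y0 \<alpha> \<beta> (\<sigma> m \<omega>) (W (\<sigma> m \<omega>) \<omega>)"
      unfolding \<sigma>_def
      by (rule wedge_mono[OF wedge_at_exit_time[OF continuous_path[OF \<omega>]]])
         (use pos[of m] less[of m] r_less[of m] start_zero[OF \<omega>] in auto)
  qed (auto simp: \<sigma>_def intro!: exit_time_nonneg)
  have lim_X: "(\<lambda>m. ?X m \<omega>) \<longlonglongrightarrow> exit_functional \<theta> x0 y0 \<alpha> \<beta> (\<lambda>s. W s \<omega>)" if \<omega>: "\<omega> \<in> space M" for \<omega>
    unfolding \<sigma>_def
    by (rule exp_martingale_tendsto_exit_functional[OF continuous_path[OF \<omega>]])
       (use assms pos less start_zero[OF \<omega>] lim t in auto)
  have "(\<lambda>m. expectation (?X m)) \<longlonglongrightarrow> expectation (\<lambda>\<omega>. exit_functional \<theta> x0 y0 \<alpha> \<beta> (\<lambda>s. W s \<omega>))"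
  proof (rule integral_dominated_convergence[where w = "\<lambda>_. C"])
    show "(\<lambda>\<omega>. exit_functional \<theta> x0 y0 \<alpha> \<beta> (\<lambda>s. W s \<omega>)) \<in> borel_measurable M"
      by (rule borel_measurable_LIMSEQ_real[OF lim_X X_measurable])
    show "AE \<omega> in M. norm (?X m \<omega>) \<le> C" for m
      using X_le by (auto simp: less_imp_le[OF exp_martingale_pos])
  qed (use X_measurable lim_X in auto)
  then show ?thesis
    unfolding EX by (simp add: LIMSEQ_const_iff)
qed

end

section \<open>The Laplace transform of a hitting time density\<close>

definition normal_cdf :: "real \<Rightarrow> real" where
  "normal_cdf = cdf std_normal_distribution"

text \<open>
  Any antiderivative of the density near \<open>x\<close> differs from the distribution function by a constant there.
\<close>

lemma normal_cdf_has_derivative: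
  "(normal_cdf has_real_derivative std_normal_density x) (at x)"
proof -
  interpret N: real_distribution std_normal_distribution by (rule real_dist_normal_dist)
  have cont: "continuous_on S std_normal_density" for S
    unfolding std_normal_density_def by (intro continuous_intros) auto
  obtain g where g: "\<And>y. y \<in> {x - 1..x + 1} \<Longrightarrow>
      (g has_vector_derivative std_normal_density y) (at y within {x - 1..x + 1})"
    using antiderivative_continuous[of "x - 1" "x + 1" std_normal_density] cont by auto
  have cdf_eq: "normal_cdf y = g y + (normal_cdf (x - 1) - g (x - 1))" if "y \<in> {x - 1<..<x + 1}" for y
  proof -
    have "has_bochner_integral lborel (\<lambda>z. indicator {x - 1..y} z *\<^sub>R std_normal_density z) (g y - g (x - 1))"
      by (rule has_bochner_integral_FTC_Icc)
         (use that in \<open>auto intro!: cont has_vector_derivative_within_subset[OF g]\<close>)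
    then have "(\<integral>z. indicator {x - 1..y} z *\<^sub>R std_normal_density z \<partial>lborel) = g y - g (x - 1)"
      by (rule has_bochner_integral_integral_eq)
    also have "(\<integral>z. indicator {x - 1..y} z *\<^sub>R std_normal_density z \<partial>lborel)
        = (\<integral>z. indicator {x - 1<..y} z \<partial>std_normal_distribution)"
    proof -
      have "(\<integral>z. indicator {x - 1..y} z *\<^sub>R std_normal_density z \<partial>lborel)
          = (\<integral>z. std_normal_density z *\<^sub>R indicator {x - 1<..y} z \<partial>lborel)"
      proof (rule integral_cong_AE)
        show "AE z in lborel. indicator {x - 1..y} z *\<^sub>R std_normal_density z
            = std_normal_density z *\<^sub>R indicator {x - 1<..y} z"
          using AE_lborel_singleton[of "x - 1"] by eventually_elim (auto simp: indicator_def)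
      qed auto
      also have "\<dots> = (\<integral>z. indicator {x - 1<..y} z \<partial>std_normal_distribution)"
        by (rule integral_density[symmetric]) auto
      finally show ?thesis .
    qed
    also have "\<dots> = measure std_normal_distribution {x - 1<..y}" by simp
    also have "\<dots> = normal_cdf y - normal_cdf (x - 1)"
      unfolding normal_cdf_def using that by (intro N.cdf_diff_eq[symmetric]) auto
    finally show ?thesis by simp
  qed
  have "(g has_real_derivative std_normal_density x) (at x within {x - 1..x + 1})"
    using g[of x] by (simp add: has_real_derivative_iff_has_vector_derivative)
  then have "(g has_real_derivative std_normal_density x) (at x)"
    by (simp add: at_within_Icc_at)
  then have "((\<lambda>y. g y + (normal_cdf (x - 1) - g (x - 1))) has_real_derivative std_normal_density x) (at x)"
    by (auto intro!: derivative_eq_intros)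
  then show ?thesis
    by (rule DERIV_cong_ev[THEN iffD2, OF refl _ refl, rotated])
       (use cdf_eq in \<open>auto intro!: eventually_nhds_in_open[of "{x - 1<..<x + 1}", THEN eventually_mono]\<close>)
qed

lemma normal_cdf_at_top: "(normal_cdf \<longlongrightarrow> 1) at_top"
  and normal_cdf_at_bot: "(normal_cdf \<longlongrightarrow> 0) at_bot"
proof -
  interpret N: real_distribution std_normal_distribution by (rule real_dist_normal_dist)
  show "(normal_cdf \<longlongrightarrow> 1) at_top" "(normal_cdf \<longlongrightarrow> 0) at_bot"
    unfolding normal_cdf_def by (rule N.cdf_lim_at_top_prob N.cdf_lim_at_bot)+
qed

text \<open>
  The density of the time at which a standard Brownian motion reaches the level \<open>c\<close>, killed at
  rate \<open>\<kappa>\<^sup>2 / 2\<close>.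
\<close>

definition killed_hitting_density :: "real \<Rightarrow> real \<Rightarrow> real \<Rightarrow> real" where
  "killed_hitting_density c \<kappa> s = c / (sqrt (2 * pi) * sqrt (s ^ 3)) * exp (- c\<^sup>2 / (2 * s) - \<kappa>\<^sup>2 * s / 2)"

text \<open>
  Up to the factor \<open>exp (- c \<kappa>)\<close>, this antiderivative is the distribution function of the hitting time of \<open>c\<close>
  for a Brownian motion with drift \<open>\<kappa>\<close>. Both Gaussian terms have the same exponential factor, since
  the squares of \<open>\<kappa> r - c / r\<close> and \<open>\<kappa> r + c / r\<close> differ by the constant \<open>4 c \<kappa>\<close>.
\<close>

lemma killed_hitting_density_antiderivative:
  assumes "0 < s"
  shows "((\<lambda>s. exp (- (c * \<kappa>)) * normal_cdf (\<kappa> * sqrt s - c / sqrt s)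
            + exp (c * \<kappa>) * normal_cdf (- (\<kappa> * sqrt s) - c / sqrt s))
          has_real_derivative killed_hitting_density c \<kappa> s) (at s)"
proof -
  define r where "r = sqrt s"
  have r: "0 < r" "s = r\<^sup>2" "sqrt (s ^ 3) = r ^ 3" using assms by (auto simp: r_def real_sqrt_power)
  have u: "((\<lambda>s. \<kappa> * sqrt s - c / sqrt s) has_real_derivative \<kappa> / (2 * r) + c / (2 * r ^ 3)) (at s)" for \<kappa>
    using assms r(1) unfolding r_def
    by (auto intro!: derivative_eq_intros simp: field_simps power3_eq_cube)
  have "((\<lambda>s. exp (- (c * \<kappa>)) * normal_cdf (\<kappa> * sqrt s - c / sqrt s)
            + exp (c * \<kappa>) * normal_cdf ((- \<kappa>) * sqrt s - c / sqrt s))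
          has_real_derivative
      exp (- (c * \<kappa>)) * (std_normal_density (\<kappa> * sqrt s - c / sqrt s) * (\<kappa> / (2 * r) + c / (2 * r ^ 3)))
      + exp (c * \<kappa>) * (std_normal_density ((- \<kappa>) * sqrt s - c / sqrt s) * ((- \<kappa>) / (2 * r) + c / (2 * r ^ 3)))) (at s)"
    by (intro DERIV_add DERIV_cmult DERIV_chain2[OF normal_cdf_has_derivative] u)
  also have "exp (- (c * \<kappa>)) * (std_normal_density (\<kappa> * sqrt s - c / sqrt s) * (\<kappa> / (2 * r) + c / (2 * r ^ 3)))
      + exp (c * \<kappa>) * (std_normal_density ((- \<kappa>) * sqrt s - c / sqrt s) * ((- \<kappa>) / (2 * r) + c / (2 * r ^ 3)))
      = killed_hitting_density c \<kappa> s"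
  proof -
    have density_exp: "exp (e) * std_normal_density x = 1 / sqrt (2 * pi) * exp (- c\<^sup>2 / (2 * s) - \<kappa>\<^sup>2 * s / 2)"
      if "e - x\<^sup>2 / 2 = - c\<^sup>2 / (2 * s) - \<kappa>\<^sup>2 * s / 2" for e x :: real
      unfolding std_normal_density_def that[symmetric] exp_diff by (simp add: exp_minus field_simps)
    have 1: "exp (- (c * \<kappa>)) * std_normal_density (\<kappa> * sqrt s - c / sqrt s)
        = 1 / sqrt (2 * pi) * exp (- c\<^sup>2 / (2 * s) - \<kappa>\<^sup>2 * s / 2)"
      by (rule density_exp) (use r(1) in \<open>simp add: r(2) field_simps power2_eq_square\<close>)
    have 2: "exp (c * \<kappa>) * std_normal_density ((- \<kappa>) * sqrt s - c / sqrt s)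
        = 1 / sqrt (2 * pi) * exp (- c\<^sup>2 / (2 * s) - \<kappa>\<^sup>2 * s / 2)"
      by (rule density_exp) (use r(1) in \<open>simp add: r(2) field_simps power2_eq_square\<close>)
    have 3: "\<kappa> / (2 * r) + c / (2 * r ^ 3) + ((- \<kappa>) / (2 * r) + c / (2 * r ^ 3)) = c / r ^ 3"
      by simp
    show ?thesis
      unfolding mult.assoc[symmetric] 1 2 distrib_left[symmetric] 3 killed_hitting_density_def r(3)
      by simp
  qed
  finally show ?thesis by simp
qed

lemma killed_hitting_density_nonneg: "0 \<le> c \<Longrightarrow> 0 \<le> s \<Longrightarrow> 0 \<le> killed_hitting_density c \<kappa> s"
  unfolding killed_hitting_density_def by simp

lemma measurable_killed_hitting_density [measurable]: "killed_hitting_density c \<kappa> \<in> borel_measurable borel"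
  unfolding killed_hitting_density_def by measurable

theorem nn_integral_killed_hitting_density:
  assumes "0 < c" "0 < \<kappa>"
  shows "(\<integral>\<^sup>+s\<in>{0<..}. ennreal (killed_hitting_density c \<kappa> s) \<partial>lborel) = ennreal (exp (- (c * \<kappa>)))"
proof -
  define F where "F s = exp (- (c * \<kappa>)) * normal_cdf (\<kappa> * sqrt s - c / sqrt s)
      + exp (c * \<kappa>) * normal_cdf (- (\<kappa> * sqrt s) - c / sqrt s)" for s
  have lim: "filterlim (\<lambda>s. \<kappa> * sqrt s - c / sqrt s) at_bot (at_right 0)"
    "filterlim (\<lambda>s. - (\<kappa> * sqrt s) - c / sqrt s) at_bot (at_right 0)"
    "filterlim (\<lambda>s. \<kappa> * sqrt s - c / sqrt s) at_top at_top"
    "filterlim (\<lambda>s. - (\<kappa> * sqrt s) - c / sqrt s) at_bot at_top"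
    using assms by real_asymp+
  have A: "(F \<longlongrightarrow> exp (- (c * \<kappa>)) * 0 + exp (c * \<kappa>) * 0) (at_right 0)"
    unfolding F_def
    by (intro tendsto_intros filterlim_compose[OF normal_cdf_at_bot] lim)
  have B: "(F \<longlongrightarrow> exp (- (c * \<kappa>)) * 1 + exp (c * \<kappa>) * 0) at_top"
    unfolding F_def
    by (intro tendsto_intros filterlim_compose[OF normal_cdf_at_bot] filterlim_compose[OF normal_cdf_at_top] lim)
  have D: "DERIV F s :> killed_hitting_density c \<kappa> s" if "0 < s" for s
    unfolding F_def using killed_hitting_density_antiderivative[OF that] .
  have C: "isCont (killed_hitting_density c \<kappa>) s" if "0 < s" for s
    unfolding killed_hitting_density_def using that by (intro continuous_intros) auto
  note FTC = interval_integral_FTC_nonneg[of 0 \<infinity> F "killed_hitting_density c \<kappa>"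
      "exp (- (c * \<kappa>)) * 0 + exp (c * \<kappa>) * 0" "exp (- (c * \<kappa>)) * 1 + exp (c * \<kappa>) * 0"]
  have int: "set_integrable lborel (einterval 0 \<infinity>) (killed_hitting_density c \<kappa>)"
    and eq: "(LBINT s=0..\<infinity>. killed_hitting_density c \<kappa> s) = exp (- (c * \<kappa>))"
    using FTC A B D C killed_hitting_density_nonneg[of c] assms
    by (auto simp: ereal_tendsto_simps zero_ereal_def)
  have ei: "einterval 0 \<infinity> = {0<..}" by (auto simp: einterval_def)
  have "(\<integral>\<^sup>+s\<in>{0<..}. ennreal (killed_hitting_density c \<kappa> s) \<partial>lborel)
      = (\<integral>\<^sup>+s. ennreal (indicator {0<..} s *\<^sub>R killed_hitting_density c \<kappa> s) \<partial>lborel)"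
    by (intro nn_integral_cong) (auto simp: indicator_def)
  also have "\<dots> = ennreal (LBINT s:{0<..}. killed_hitting_density c \<kappa> s)"
    unfolding set_lebesgue_integral_def
    by (rule nn_integral_eq_integral)
       (use int assms in \<open>auto simp: ei set_integrable_def indicator_def killed_hitting_density_nonneg\<close>)
  also have "(LBINT s:{0<..}. killed_hitting_density c \<kappa> s) = exp (- (c * \<kappa>))"
    using eq by (simp add: interval_integral_to_infinity_eq zero_ereal_def)
  finally show ?thesis .
qed

section \<open>Uniqueness of Laplace transforms\<close>

text \<open>
  The comparison of \<open>\<mu> + \<nu>\<close> with \<open>\<rho>\<close>: having \<open>\<nu>\<close> explicit replaces a signed measure \<open>\<rho> - \<nu>\<close>.
\<close>

locale three_finite_measures =
  \<mu>: finite_measure \<mu> + \<nu>: finite_measure \<nu> + \<rho>: finite_measure \<rho> for \<mu> \<nu> \<rho> :: "real measure" +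
  assumes borel [measurable_cong]: "sets \<mu> = sets borel" "sets \<nu> = sets borel" "sets \<rho> = sets borel"
    and nonneg: "AE x in \<mu>. 0 \<le> x" "AE x in \<nu>. 0 \<le> x" "AE x in \<rho>. 0 \<le> x"
begin

text \<open>
  The substitution \<open>u = exp (- x)\<close> turns Laplace transforms at integers into moments on the compact
  interval \<open>{0..1}\<close>.
\<close>

definition balance :: "(real \<Rightarrow> real) \<Rightarrow> real" where
  "balance f = integral\<^sup>L \<mu> (\<lambda>x. f (exp (- x))) + integral\<^sup>L \<nu> (\<lambda>x. f (exp (- x))) - integral\<^sup>L \<rho> (\<lambda>x. f (exp (- x)))"

definition total :: real where
  "total = measure \<mu> (space \<mu>) + measure \<nu> (space \<nu>) + measure \<rho> (space \<rho>)"

lemma AE_bounded: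
  assumes "\<And>u. u \<in> {0..1} \<Longrightarrow> \<bar>f u\<bar> \<le> (B::real)"
  shows "AE x in \<mu>. norm (f (exp (- x))) \<le> B" "AE x in \<nu>. norm (f (exp (- x))) \<le> B"
    "AE x in \<rho>. norm (f (exp (- x))) \<le> B"
proof -
  have *: "norm (f (exp (- x))) \<le> B" if "0 \<le> x" for x using assms[of "exp (- x)"] that by simp
  show "AE x in \<mu>. norm (f (exp (- x))) \<le> B" "AE x in \<nu>. norm (f (exp (- x))) \<le> B"
    "AE x in \<rho>. norm (f (exp (- x))) \<le> B"
    by (rule eventually_mono[OF nonneg(1) *] eventually_mono[OF nonneg(2) *] eventually_mono[OF nonneg(3) *]; assumption)+
qed

lemma integrable_bounded:
  assumes [measurable]: "f \<in> borel_measurable borel" and "\<And>u. u \<in> {0..1} \<Longrightarrow> \<bar>f u\<bar> \<le> (B::real)"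
  shows "integrable \<mu> (\<lambda>x. f (exp (- x)))" "integrable \<nu> (\<lambda>x. f (exp (- x)))" "integrable \<rho> (\<lambda>x. f (exp (- x)))"
  using AE_bounded[of f B, OF assms(2)]
  by (auto intro!: \<mu>.integrable_const_bound[of _ B] \<nu>.integrable_const_bound[of _ B] \<rho>.integrable_const_bound[of _ B])

lemma integral_abs_le:
  assumes "finite_measure M" "AE x in M. norm (g x) \<le> (B::real)" "0 \<le> B"
  shows "\<bar>integral\<^sup>L M g\<bar> \<le> B * measure M (space M)"
proof (cases "integrable M g")
  case True
  interpret finite_measure M by fact
  have "\<bar>integral\<^sup>L M g\<bar> \<le> (\<integral>x. \<bar>g x\<bar> \<partial>M)" using integral_abs_bound .
  also have "\<dots> \<le> (\<integral>x. B \<partial>M)"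
    using True assms(2) by (intro integral_mono_AE) auto
  finally show ?thesis by (simp add: mult.commute)
qed (use assms in \<open>simp add: not_integrable_integral_eq\<close>)

lemma abs_balance_le:
  assumes "\<And>u. u \<in> {0..1} \<Longrightarrow> \<bar>f u\<bar> \<le> B" "0 \<le> B"
  shows "\<bar>balance f\<bar> \<le> B * total"
  using integral_abs_le[OF \<mu>.finite_measure_axioms AE_bounded(1)[of f B, OF assms(1)] assms(2)]
    integral_abs_le[OF \<nu>.finite_measure_axioms AE_bounded(2)[of f B, OF assms(1)] assms(2)]
    integral_abs_le[OF \<rho>.finite_measure_axioms AE_bounded(3)[of f B, OF assms(1)] assms(2)]
  unfolding balance_def total_def distrib_left by linarith

lemma balance_add:
  assumes "f \<in> borel_measurable borel" "\<And>u. u \<in> {0..1} \<Longrightarrow> \<bar>f u\<bar> \<le> B"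
    and "g \<in> borel_measurable borel" "\<And>u. u \<in> {0..1} \<Longrightarrow> \<bar>g u\<bar> \<le> C"
  shows "balance (\<lambda>u. f u + g u) = balance f + balance g"
  unfolding balance_def using integrable_bounded[OF assms(1,2)] integrable_bounded[OF assms(3,4)] by simp

lemma balance_cmult: "balance (\<lambda>u. c * f u) = c * balance f"
  unfolding balance_def by (simp add: algebra_simps)

lemma balance_tendsto:
  assumes meas: "\<And>n. f n \<in> borel_measurable borel"
    and bound: "\<And>n u. u \<in> {0..1} \<Longrightarrow> \<bar>f n u\<bar> \<le> B"
    and lim: "\<And>u. 0 < u \<Longrightarrow> u \<le> 1 \<Longrightarrow> (\<lambda>n. f n u) \<longlonglongrightarrow> g u" and g: "g \<in> borel_measurable borel"
  shows "(\<lambda>n. balance (f n)) \<longlonglongrightarrow> balance g"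
proof -
  have "(\<lambda>n. integral\<^sup>L M (\<lambda>x. f n (exp (- x)))) \<longlonglongrightarrow> integral\<^sup>L M (\<lambda>x. g (exp (- x)))"
    if fin: "finite_measure M" and s [measurable_cong]: "sets M = sets borel" and nn: "AE x in M. 0 \<le> x"
      and b: "\<And>n. AE x in M. norm (f n (exp (- x))) \<le> B" for M :: "real measure"
  proof (rule integral_dominated_convergence[where w = "\<lambda>_. B"])
    show "integrable M (\<lambda>_. B)" using fin by (rule finite_measure.integrable_const)
    show "AE x in M. (\<lambda>n. f n (exp (- x))) \<longlonglongrightarrow> g (exp (- x))"
      using nn by eventually_elim (rule lim, auto)
  qed (use meas g b in measurable)
  note L = this
  show ?thesis
    unfolding balance_def
    by (intro tendsto_add tendsto_diff L \<mu>.finite_measure_axioms \<nu>.finite_measure_axioms \<rho>.finite_measure_axioms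
        borel nonneg AE_bounded bound)
qed

context
  assumes laplace: "\<And>p. 0 < p \<Longrightarrow> integral\<^sup>L \<mu> (\<lambda>x. exp (- p * x)) + integral\<^sup>L \<nu> (\<lambda>x. exp (- p * x))
      = integral\<^sup>L \<rho> (\<lambda>x. exp (- p * x))"
begin

text \<open>
  The total masses, the case \<open>n = 0\<close>, are the limits of the Laplace transforms at \<open>p = 1 / (k + 1)\<close>.
\<close>

lemma balance_power: "balance (\<lambda>u. u ^ n) = 0"
proof (cases "n = 0")
  case False
  have "(exp (- x)) ^ n = exp (- real n * x)" for x :: real
    by (simp flip: exp_of_nat_mult)
  then show ?thesis unfolding balance_def using laplace[of "real n"] False by simp
next
  case True
  have zero: "balance (\<lambda>u. u powr inverse (real (Suc k))) = 0" for k
  proof -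
    have "exp (- x) powr inverse (real (Suc k)) = exp (- inverse (real (Suc k)) * x)" for x :: real
      by (simp add: powr_def)
    then show ?thesis unfolding balance_def using laplace[of "inverse (real (Suc k))"] by simp
  qed
  have "(\<lambda>k. balance (\<lambda>u. u powr inverse (real (Suc k)))) \<longlonglongrightarrow> balance (\<lambda>u. 1)"
  proof (rule balance_tendsto[where B = 1])
    fix u :: real assume u: "0 < u" "u \<le> 1"
    have "(\<lambda>k. u powr inverse (real (Suc k))) \<longlonglongrightarrow> u powr 0"
      using u by (intro tendsto_powr tendsto_const LIMSEQ_inverse_real_of_nat) auto
    then show "(\<lambda>k. u powr inverse (real (Suc k))) \<longlonglongrightarrow> 1" using u by simp
  qed (auto intro: powr_le1)
  then show ?thesis using True zero by (simp add: LIMSEQ_const_iff)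
qed

text \<open>Weierstrass approximation on \<open>{0..1}\<close>, with the finiteness of the measures controlling the error.\<close>

lemma balance_continuous:
  assumes cont: "continuous_on UNIV f"
  shows "balance f = 0"
proof -
  have small: "\<bar>balance f\<bar> \<le> e * total" if e_pos: "0 < e" for e
  proof -
    obtain g where "real_polynomial_function g" and fg: "\<And>u. u \<in> {0..1} \<Longrightarrow> \<bar>f u - g u\<bar> < e"
      using Stone_Weierstrass_real_polynomial_function[OF compact_Icc continuous_on_subset[OF cont subset_UNIV] e_pos] by metis
    then obtain a n where g: "g = (\<lambda>u. \<Sum>i\<le>n. a i * u ^ i)"
      using real_polynomial_function_iff_sum by blast
    have contg: "continuous_on S (\<lambda>u. \<Sum>i\<le>k. a i * u ^ i)" for S k
      by (intro continuous_intros)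
    have bounded: "\<exists>B. \<forall>u\<in>{0..1}. \<bar>h u\<bar> \<le> B" if "continuous_on UNIV h" for h :: "real \<Rightarrow> real"
      using compact_imp_bounded[OF compact_continuous_image[OF continuous_on_subset[OF that], of "{0..1}"]]
      by (auto simp: bounded_iff)
    have meas: "h \<in> borel_measurable borel" if "continuous_on UNIV h" for h :: "real \<Rightarrow> real"
      using that by (rule borel_measurable_continuous_onI)
    have poly: "balance (\<lambda>u. \<Sum>i\<le>k. a i * u ^ i) = 0" for k
    proof (induction k)
      case 0
      then show ?case using balance_cmult[of "a 0" "\<lambda>u. u ^ 0"] balance_power[of 0] by simp
    next
      case (Suc k)
      have cp: "continuous_on UNIV (\<lambda>u. a (Suc k) * u ^ Suc k)" by (intro continuous_intros)
      obtain B C where "\<forall>u\<in>{0..1}. \<bar>\<Sum>i\<le>k. a i * u ^ i\<bar> \<le> B" "\<forall>u\<in>{0..1}. \<bar>a (Suc k) * u ^ Suc k\<bar> \<le> C"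
        using bounded[OF contg] bounded[OF cp] by blast
      then have "balance (\<lambda>u. (\<Sum>i\<le>k. a i * u ^ i) + a (Suc k) * u ^ Suc k)
          = balance (\<lambda>u. \<Sum>i\<le>k. a i * u ^ i) + balance (\<lambda>u. a (Suc k) * u ^ Suc k)"
        by (intro balance_add[where B = B and C = C] meas[OF contg] meas[OF cp]) blast+
      then show ?case unfolding sum.atMost_Suc Suc.IH balance_cmult balance_power by simp
    qed
    have cd: "continuous_on UNIV (\<lambda>u. f u - g u)" unfolding g by (intro continuous_intros cont)
    obtain B where B: "\<forall>u\<in>{0..1}. \<bar>g u\<bar> \<le> B" using bounded[OF contg] g by blast
    have "balance (\<lambda>u. (f u - g u) + g u) = balance (\<lambda>u. f u - g u) + balance g"
      by (rule balance_add[where B = e and C = B])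
         (use meas[OF cd] meas[OF contg] fg B g in \<open>auto intro: less_imp_le\<close>)
    then have "balance f = balance (\<lambda>u. f u - g u)" using poly[of n] g by simp
    then show ?thesis using abs_balance_le[of "\<lambda>u. f u - g u" e] fg that by (auto intro: less_imp_le)
  qed
  moreover have "0 \<le> total" unfolding total_def by (intro add_nonneg_nonneg measure_nonneg)
  ultimately have "\<bar>balance f\<bar> \<le> 0 + e" if "0 < e" for e
    using that by (intro order_trans[OF small[of "e / (total + 1)"]])
       (auto simp: field_simps)
  then show ?thesis using field_le_epsilon[of "\<bar>balance f\<bar>" 0] by simp
qed

text \<open>The indicator of \<open>exp (- x) \<ge> exp (- c)\<close> is a bounded pointwise limit of piecewise linear functions.\<close>

lemma measure_atMost: "measure \<mu> {..c} + measure \<nu> {..c} = measure \<rho> {..c}"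
proof -
  define d where "d = exp (- c)"
  define h where "h n u = min 1 (max 0 (1 + real n * (u - d)))" for n u
  have "balance (h n) = 0" for n
    unfolding h_def by (intro balance_continuous continuous_intros)
  moreover have "(\<lambda>n. balance (h n)) \<longlonglongrightarrow> balance (indicator {d..})"
  proof (rule balance_tendsto[where B = 1])
    show "(\<lambda>n. h n u) \<longlonglongrightarrow> indicator {d..} u" for u
    proof (cases "d \<le> u")
      case True
      then have "h n u = 1" for n unfolding h_def by simp
      with True show ?thesis by simp
    next
      case False
      have "\<forall>\<^sub>F n in sequentially. h n u = 0"
        using eventually_ge_at_top[of "nat \<lceil>1 / (d - u)\<rceil>"]
      proof eventually_elim
        case (elim n)
        then have "1 / (d - u) \<le> real n" by linarith
        then have "1 \<le> real n * (d - u)" using False by (simp add: field_simps)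
        then show ?case unfolding h_def by (simp add: algebra_simps)
      qed
      with False show ?thesis by (simp add: tendsto_eventually)
    qed
    show "h n \<in> borel_measurable borel" for n
      unfolding h_def by measurable
  qed (auto simp: h_def)
  ultimately have "balance (indicator {d..}) = 0" by (simp add: LIMSEQ_const_iff)
  moreover have "indicator {d..} (exp (- x)) = (indicator {..c} x :: real)" for x
    by (auto simp: d_def indicator_def)
  ultimately show ?thesis unfolding balance_def by simp
qed

theorem measure_add_eq_of_laplace:
  assumes "S \<in> sets borel"
  shows "measure \<mu> S + measure \<nu> S = measure \<rho> S"
proof -
  have gen: "sigma_sets UNIV (range (\<lambda>a::real. {..a})) = sets borel"
    unfolding borel_eq_atMost by simp
  have "Int_stable (range (\<lambda>a::real. {..a}))" by (auto simp: Int_stable_def)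
  moreover have "range (\<lambda>a::real. {..a}) \<subseteq> Pow UNIV" by simp
  moreover have "S \<in> sigma_sets UNIV (range (\<lambda>a::real. {..a}))" using assms gen by simp
  ultimately show ?thesis
  proof (induction rule: sigma_sets_induct_disjoint)
    case (basic A)
    then show ?case using measure_atMost by auto
  next
    case (compl A)
    have UN: "measure \<mu> UNIV + measure \<nu> UNIV = measure \<rho> UNIV"
      using balance_power[of 0] by (simp add: balance_def borel[THEN sets_eq_imp_space_eq])
    have [measurable]: "A \<in> sets borel" using compl gen by simp
    show ?case
      using \<mu>.finite_measure_compl[of A] \<nu>.finite_measure_compl[of A] \<rho>.finite_measure_compl[of A] UN compl
      by (simp add: borel borel[THEN sets_eq_imp_space_eq])
  next
    case (union A)
    then have rng: "range A \<subseteq> sets borel" using gen by simp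
    have "(\<lambda>i. measure \<mu> (A i) + measure \<nu> (A i)) sums (measure \<mu> (\<Union>i. A i) + measure \<nu> (\<Union>i. A i))"
      using rng union(1) by (intro sums_add \<mu>.finite_measure_UNION \<nu>.finite_measure_UNION) (auto simp: borel)
    moreover have "(\<lambda>i. measure \<rho> (A i)) sums measure \<rho> (\<Union>i. A i)"
      using rng union(1) by (intro \<rho>.finite_measure_UNION) (auto simp: borel)
    ultimately show ?case using union(3) by (simp add: sums_unique2)
  qed auto
qed

end

end

text \<open>A continuous function that is negative somewhere has a negative integral over some interval.\<close>

lemma continuous_nonneg_of_interval_integrals:
  fixes f :: "real \<Rightarrow> real"
  assumes cont: "continuous_on {0<..} f"
    and int: "\<And>a b. 0 < a \<Longrightarrow> a < b \<Longrightarrow> 0 \<le> (LBINT x:{a..b}. f x)" and "0 < x"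
  shows "0 \<le> f x"
proof (rule ccontr)
  assume "\<not> 0 \<le> f x"
  then have "f x < f x / 2" by simp
  have "(f \<longlongrightarrow> f x) (at x)"
    using cont \<open>0 < x\<close> by (metis at_within_open continuous_on greaterThan_iff open_greaterThan)
  then have "\<forall>\<^sub>F y in at x. f y < f x / 2" using \<open>f x < f x / 2\<close> by (rule order_tendstoD)
  then obtain e where "0 < e" and e: "\<And>y. y \<noteq> x \<Longrightarrow> dist y x < e \<Longrightarrow> f y < f x / 2"
    unfolding eventually_at by auto
  define a b where "a = max (x / 2) (x - e / 2)" and "b = x + e / 2"
  have ab: "0 < a" "a < b" using \<open>0 < x\<close> \<open>0 < e\<close> by (auto simp: a_def b_def max_def)
  have less: "f y \<le> f x / 2" if "y \<in> {a..b}" for y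
  proof (cases "y = x")
    case False
    have "\<bar>y - x\<bar> < e" using that \<open>0 < e\<close> by (auto simp: a_def b_def)
    with e[OF False] show ?thesis by (simp add: dist_real_def)
  qed (use \<open>f x < f x / 2\<close> in simp)
  have "{a..b} \<subseteq> {0<..}" using ab by auto
  then have "set_integrable lborel {a..b} f" "set_integrable lborel {a..b} (\<lambda>_. f x / 2)"
    using borel_integrable_compact[OF compact_Icc continuous_on_subset[OF cont], of a b]
      borel_integrable_compact[OF compact_Icc continuous_on_const, of a b "f x / 2"]
    unfolding set_integrable_def by auto
  then have "(LBINT y:{a..b}. f y) \<le> (LBINT y:{a..b}. f x / 2)"
    using less by (intro set_integral_mono)
  also have "\<dots> = (b - a) * (f x / 2)"
    using ab by (simp add: set_lebesgue_integral_def)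
  also have "\<dots> < 0" using ab \<open>f x < f x / 2\<close> by (intro mult_pos_neg) auto
  finally show False using int[OF ab] by simp
qed

section \<open>The series of images\<close>

text \<open>
  By this reflection the terms with negative index are again terms with nonnegative index, for \<open>- a\<close> and with the
  opposite sign. Hence only the half series have to be studied, for \<open>\<bar>a\<bar> < t0\<close>; their terms are nonnegative.
\<close>

lemma exit_series_term_reflect:
  "exit_series_term t0 a s (- n - 1) = - exit_series_term t0 (- a) s n"
proof -
  have "(2 * real_of_int (- n - 1) + 1) * t0 - a = - ((2 * real_of_int n + 1) * t0 - - a)"
    "(2 * real_of_int (- n - 1) + 1) * a = (2 * real_of_int n + 1) * (- a)"
    "2 * real_of_int (- n - 1) * (real_of_int (- n - 1) + 1) = 2 * real_of_int n * (real_of_int n + 1)"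
    by (simp_all add: algebra_simps)
  then show ?thesis
    unfolding exit_series_term_def by (simp only: power2_minus mult_minus_left)
qed

lemma exit_series_term_nonneg:
  assumes "\<bar>a\<bar> < t0"
  shows "0 \<le> exit_series_term t0 a s (int k)"
proof -
  have "t0 \<le> (2 * real k + 1) * t0" using assms by (simp add: algebra_simps)
  then show ?thesis unfolding exit_series_term_def using assms by (intro mult_nonneg_nonneg) auto
qed

lemma image_exponent_le:
  assumes "\<bar>a\<bar> < t0"
  shows "(2 * real k + 1) * a - 2 * real k * (real k + 1) * t0 \<le> t0 - 2 * t0 * real k"
proof -
  have "(2 * real k + 1) * a \<le> (2 * real k + 1) * t0" using assms by (intro mult_left_mono) auto
  moreover have "real k * t0 \<le> (real k)\<^sup>2 * t0"
    using assms by (intro mult_right_mono) (auto simp: power2_eq_square simp flip: of_nat_mult)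
  ultimately show ?thesis by (simp add: algebra_simps power2_eq_square)
qed

lemma exp_neg_power: "exp (t0 - 2 * t0 * real k) = exp t0 * exp (- 2 * t0) ^ k"
  by (simp add: exp_diff exp_minus power_inverse field_simps flip: exp_of_nat_mult)

text \<open>
  The bound does not depend on \<open>s\<close>, which gives uniform convergence on the whole half line.
\<close>

lemma exit_series_term_le:
  assumes "\<bar>a\<bar> < t0" "0 < s"
  shows "exit_series_term t0 a s (int k) \<le> 2 * t0 * exp t0 * (real (Suc k) * exp (- 2 * t0) ^ k)"
proof -
  have "exit_series_term t0 a s (int k) \<le> ((2 * real k + 2) * t0) * exp (t0 - 2 * t0 * real k)"
    unfolding exit_series_term_def
  proof (intro mult_mono)
    have "- (1/2) * (((2 * real_of_int (int k) + 1) * t0 - a)\<^sup>2 / s) \<le> 0" using assms by simp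
    then show "exp (- (1/2) * (((2 * real_of_int (int k) + 1) * t0 - a)\<^sup>2 / s) + (2 * real_of_int (int k) + 1) * a
          - 2 * real_of_int (int k) * (real_of_int (int k) + 1) * t0) \<le> exp (t0 - 2 * t0 * real k)"
      using image_exponent_le[OF assms(1), of k] by simp
  qed (use assms in \<open>auto simp: algebra_simps\<close>)
  then show ?thesis unfolding exp_neg_power by (simp add: algebra_simps)
qed

lemma summable_image_bound:
  assumes "0 < (t0::real)"
  shows "summable (\<lambda>k. 2 * t0 * exp t0 * (real (Suc k) * exp (- 2 * t0) ^ k))"
  using geometric_deriv_sums[of "exp (- 2 * t0)"] assms
  by (intro summable_mult) (auto simp: sums_iff)

lemma summable_exit_series_term:
  assumes "\<bar>a\<bar> < t0" "0 < s"
  shows "summable (\<lambda>k. exit_series_term t0 a s (int k))"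
  by (rule summable_comparison_test'[OF summable_image_bound[of t0]])
     (use assms exit_series_term_le exit_series_term_nonneg in auto)

definition image_sum :: "real \<Rightarrow> real \<Rightarrow> real \<Rightarrow> real" where
  "image_sum t0 a s = (\<Sum>k. exit_series_term t0 a s (int k))"

lemma image_sum_nonneg: "\<bar>a\<bar> < t0 \<Longrightarrow> 0 < s \<Longrightarrow> 0 \<le> image_sum t0 a s"
  unfolding image_sum_def by (intro suminf_nonneg summable_exit_series_term exit_series_term_nonneg)

lemma measurable_image_sum [measurable]: "image_sum t0 a \<in> borel_measurable borel"
  unfolding image_sum_def exit_series_term_def by measurable

lemma continuous_on_image_sum:
  assumes "\<bar>a\<bar> < t0"
  shows "continuous_on {0<..} (image_sum t0 a)"
proof (rule uniform_limit_theorem[where F = sequentially])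
  show "uniform_limit {0<..} (\<lambda>n s. \<Sum>k<n. exit_series_term t0 a s (int k)) (image_sum t0 a) sequentially"
    unfolding image_sum_def
    by (rule Weierstrass_m_test[OF _ summable_image_bound[of t0]])
       (use assms exit_series_term_le exit_series_term_nonneg in auto)
  show "\<forall>\<^sub>F n in sequentially. continuous_on {0<..} (\<lambda>s. \<Sum>k<n. exit_series_term t0 a s (int k))"
    unfolding exit_series_term_def by (intro always_eventually allI continuous_intros) auto
qed auto

lemma has_sum_exit_series:
  assumes "\<bar>a\<bar> < t0" "0 < s"
  shows "(exit_series_term t0 a s has_sum (image_sum t0 a s - image_sum t0 (- a) s)) UNIV"
proof -
  have upper: "(exit_series_term t0 a s has_sum image_sum t0 a s) (range int)"
    unfolding has_sum_reindex[OF inj_on_of_nat] o_def image_sum_def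
    by (intro sums_nonneg_imp_has_sum summable_sums summable_exit_series_term exit_series_term_nonneg assms)
  have "((\<lambda>k. exit_series_term t0 (- a) s (int k)) has_sum image_sum t0 (- a) s) UNIV"
    unfolding image_sum_def using assms
    by (intro sums_nonneg_imp_has_sum summable_sums summable_exit_series_term exit_series_term_nonneg) auto
  then have "((\<lambda>k. - exit_series_term t0 (- a) s (int k)) has_sum - image_sum t0 (- a) s) UNIV"
    by (simp add: has_sum_uminus)
  then have lower: "(exit_series_term t0 a s has_sum - image_sum t0 (- a) s) (range (\<lambda>k. - int k - 1))"
    by (subst has_sum_reindex) (auto simp: inj_on_def o_def exit_series_term_reflect)
  have split: "UNIV = range int \<union> range (\<lambda>k. - int k - 1)"
  proof (intro equalityI subsetI)
    fix n :: int
    show "n \<in> range int \<union> range (\<lambda>k. - int k - 1)"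
    proof (cases "0 \<le> n")
      case True
      then have "n = int (nat n)" by simp
      then show ?thesis by blast
    next
      case False
      then have "n = - int (nat (- n - 1)) - 1" by simp
      then show ?thesis by blast
    qed
  qed simp
  have "range int \<inter> range (\<lambda>k. - int k - 1) = {}" by auto
  from has_sum_Un_disjoint[OF upper lower this] show ?thesis unfolding split by simp
qed

text \<open>The factor in front of the series in the exit density; \<open>s\<close> is the time elapsed until the exit.\<close>

definition exit_prefactor :: "real \<Rightarrow> real \<Rightarrow> real \<Rightarrow> real \<Rightarrow> real" where
  "exit_prefactor t0 a \<gamma> s = exp (- t0 * (1 - \<gamma>) - a * \<gamma>) / sqrt (2 * pi) * (exp (- (1/2) * (1 - \<gamma>)\<^sup>2 * s) / sqrt (s ^ 3))"

text \<open>The Laplace transform of the \<open>k\<close>-th term with its prefactor, in the parametrisation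
  \<open>p = \<theta>\<^sup>2 / 2 - (1 - \<gamma>) \<theta>\<close>.\<close>

definition image_laplace :: "real \<Rightarrow> real \<Rightarrow> real \<Rightarrow> real \<Rightarrow> real \<Rightarrow> nat \<Rightarrow> real" where
  "image_laplace t0 y0 \<gamma> \<theta> a k = exp (- t0 * (1 - \<gamma>) - y0 * \<gamma> + (2 * real k + 1) * a - 2 * real k * (real k + 1) * t0
      - ((2 * real k + 1) * t0 - a) * (\<theta> - (1 - \<gamma>)))"

lemma exit_prefactor_nonneg: "0 \<le> s \<Longrightarrow> 0 \<le> exit_prefactor t0 y0 \<gamma> s"
  unfolding exit_prefactor_def by simp

lemma measurable_exit_prefactor [measurable]: "exit_prefactor t0 y0 \<gamma> \<in> borel_measurable borel"
  unfolding exit_prefactor_def by measurable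

lemma continuous_on_exit_prefactor: "continuous_on {0<..} (exit_prefactor t0 y0 \<gamma>)"
  unfolding exit_prefactor_def by (intro continuous_intros) auto

text \<open>
  The factor \<open>exp (- p s)\<close> and the one from the drift combine to the killing rate
  \<open>(\<theta> - (1 - \<gamma>))\<^sup>2 / 2 = p + (1 - \<gamma>)\<^sup>2 / 2\<close>. This perfect square makes the Laplace transforms
  exponentials that are linear in \<open>\<theta>\<close>.
\<close>

lemma weighted_exit_series_term:
  assumes "0 < s"
  shows "exp (- (\<theta>\<^sup>2 / 2 - (1 - \<gamma>) * \<theta>) * s) * (exit_prefactor t0 y0 \<gamma> s * exit_series_term t0 a s (int k))
    = exp (- t0 * (1 - \<gamma>) - y0 * \<gamma> + (2 * real k + 1) * a - 2 * real k * (real k + 1) * t0)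
      * killed_hitting_density ((2 * real k + 1) * t0 - a) (\<theta> - (1 - \<gamma>)) s"
proof -
  define b where "b = (2 * real k + 1) * t0 - a"
  define E where "E = (2 * real k + 1) * a - 2 * real k * (real k + 1) * t0"
  have lhs: "exp (- (\<theta>\<^sup>2 / 2 - (1 - \<gamma>) * \<theta>) * s) * (exit_prefactor t0 y0 \<gamma> s * exit_series_term t0 a s (int k))
    = b / (sqrt (2 * pi) * sqrt (s ^ 3)) * (exp (- (\<theta>\<^sup>2 / 2 - (1 - \<gamma>) * \<theta>) * s) * exp (- t0 * (1 - \<gamma>) - y0 * \<gamma>)
        * exp (- (1/2) * (1 - \<gamma>)\<^sup>2 * s) * exp (- (1/2) * (b\<^sup>2 / s) + E))"
    unfolding exit_prefactor_def exit_series_term_def b_def E_def by (simp add: diff_add_eq add_diff_eq)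
  have rhs: "exp (- t0 * (1 - \<gamma>) - y0 * \<gamma> + E) * killed_hitting_density b (\<theta> - (1 - \<gamma>)) s
    = b / (sqrt (2 * pi) * sqrt (s ^ 3)) * (exp (- t0 * (1 - \<gamma>) - y0 * \<gamma> + E) * exp (- b\<^sup>2 / (2 * s) - (\<theta> - (1 - \<gamma>))\<^sup>2 * s / 2))"
    unfolding killed_hitting_density_def by simp
  have "- (\<theta>\<^sup>2 / 2 - (1 - \<gamma>) * \<theta>) * s + (- t0 * (1 - \<gamma>) - y0 * \<gamma>) + - (1/2) * (1 - \<gamma>)\<^sup>2 * s + (- (1/2) * (b\<^sup>2 / s) + E)
    = - t0 * (1 - \<gamma>) - y0 * \<gamma> + E + (- b\<^sup>2 / (2 * s) - (\<theta> - (1 - \<gamma>))\<^sup>2 * s / 2)"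
    by (simp add: power2_eq_square algebra_simps add_divide_distrib diff_divide_distrib)
  then have "exp (- (\<theta>\<^sup>2 / 2 - (1 - \<gamma>) * \<theta>) * s) * exp (- t0 * (1 - \<gamma>) - y0 * \<gamma>)
        * exp (- (1/2) * (1 - \<gamma>)\<^sup>2 * s) * exp (- (1/2) * (b\<^sup>2 / s) + E)
    = exp (- t0 * (1 - \<gamma>) - y0 * \<gamma> + E) * exp (- b\<^sup>2 / (2 * s) - (\<theta> - (1 - \<gamma>))\<^sup>2 * s / 2)"
    by (simp only: exp_add[symmetric])
  then show ?thesis
    using lhs rhs unfolding b_def[symmetric] by (simp add: E_def add_diff_eq)
qed

lemma nn_integral_weighted_exit_series_term:
  assumes "\<bar>a\<bar> < t0" "1 - \<gamma> < \<theta>"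
  shows "(\<integral>\<^sup>+s\<in>{0<..}. ennreal (exp (- (\<theta>\<^sup>2 / 2 - (1 - \<gamma>) * \<theta>) * s) * (exit_prefactor t0 y0 \<gamma> s * exit_series_term t0 a s (int k))) \<partial>lborel)
    = ennreal (image_laplace t0 y0 \<gamma> \<theta> a k)"
proof -
  define b where "b = (2 * real k + 1) * t0 - a"
  define E where "E = - t0 * (1 - \<gamma>) - y0 * \<gamma> + (2 * real k + 1) * a - 2 * real k * (real k + 1) * t0"
  have "t0 \<le> (2 * real k + 1) * t0" using assms by (simp add: algebra_simps)
  then have "0 < b" unfolding b_def using assms by auto
  have "(\<integral>\<^sup>+s\<in>{0<..}. ennreal (exp (- (\<theta>\<^sup>2 / 2 - (1 - \<gamma>) * \<theta>) * s) * (exit_prefactor t0 y0 \<gamma> s * exit_series_term t0 a s (int k))) \<partial>lborel)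
      = (\<integral>\<^sup>+s. ennreal (exp E) * (ennreal (killed_hitting_density b (\<theta> - (1 - \<gamma>)) s) * indicator {0<..} s) \<partial>lborel)"
  proof (intro nn_integral_cong)
    fix s
    show "ennreal (exp (- (\<theta>\<^sup>2 / 2 - (1 - \<gamma>) * \<theta>) * s) * (exit_prefactor t0 y0 \<gamma> s * exit_series_term t0 a s (int k))) * indicator {0<..} s
      = ennreal (exp E) * (ennreal (killed_hitting_density b (\<theta> - (1 - \<gamma>)) s) * indicator {0<..} s)"
    proof (cases "0 < s")
      case True
      show ?thesis
        unfolding weighted_exit_series_term[OF True] E_def[symmetric] b_def[symmetric]
        by (simp add: ennreal_mult' mult.assoc)
    qed simp
  qed
  also have "\<dots> = ennreal (exp E) * ennreal (exp (- (b * (\<theta> - (1 - \<gamma>)))))"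
    using nn_integral_killed_hitting_density[of b "\<theta> - (1 - \<gamma>)"] \<open>0 < b\<close> assms by (subst nn_integral_cmult) auto
  also have "\<dots> = ennreal (image_laplace t0 y0 \<gamma> \<theta> a k)"
    unfolding image_laplace_def b_def[symmetric] E_def[symmetric] by (simp flip: ennreal_mult' exp_add)
  finally show ?thesis .
qed

lemma summable_image_laplace:
  assumes "\<bar>a\<bar> < t0" "1 - \<gamma> \<le> \<theta>"
  shows "summable (image_laplace t0 y0 \<gamma> \<theta> a)"
proof (rule summable_comparison_test')
  let ?K = "exp (- t0 * (1 - \<gamma>) - y0 * \<gamma>) * exp t0"
  show "summable (\<lambda>k. ?K * exp (- 2 * t0) ^ k)"
    using assms by (intro summable_mult summable_geometric) auto
  show "norm (image_laplace t0 y0 \<gamma> \<theta> a k) \<le> ?K * exp (- 2 * t0) ^ k" if "0 \<le> k" for k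
  proof -
    have "t0 \<le> (2 * real k + 1) * t0" using assms by (simp add: algebra_simps)
    then have "0 \<le> ((2 * real k + 1) * t0 - a) * (\<theta> - (1 - \<gamma>))"
      using assms by (intro mult_nonneg_nonneg) auto
    then have "image_laplace t0 y0 \<gamma> \<theta> a k \<le> exp (- t0 * (1 - \<gamma>) - y0 * \<gamma> + (t0 - 2 * t0 * real k))"
      using image_exponent_le[OF assms(1), of k] unfolding image_laplace_def by simp
    also have "\<dots> = ?K * exp (- 2 * t0) ^ k" unfolding exp_add[of _ "t0 - _"] exp_neg_power by simp
    finally show ?thesis by (simp add: image_laplace_def)
  qed
qed

lemma nn_integral_weighted_image_sum:
  assumes "\<bar>a\<bar> < t0" "1 - \<gamma> < \<theta>"
  shows "(\<integral>\<^sup>+s\<in>{0<..}. ennreal (exp (- (\<theta>\<^sup>2 / 2 - (1 - \<gamma>) * \<theta>) * s) * (exit_prefactor t0 y0 \<gamma> s * image_sum t0 a s)) \<partial>lborel)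
    = ennreal (\<Sum>k. image_laplace t0 y0 \<gamma> \<theta> a k)"
proof -
  let ?w = "\<lambda>s. exp (- (\<theta>\<^sup>2 / 2 - (1 - \<gamma>) * \<theta>) * s)"
  have [measurable]: "(\<lambda>s. exit_series_term t0 a s (int k)) \<in> borel_measurable borel" for k
    unfolding exit_series_term_def by measurable
  have "ennreal (?w s * (exit_prefactor t0 y0 \<gamma> s * image_sum t0 a s)) * indicator {0<..} s
      = (\<Sum>k. ennreal (?w s * (exit_prefactor t0 y0 \<gamma> s * exit_series_term t0 a s (int k))) * indicator {0<..} s)" for s
  proof (cases "0 < s")
    case True
    have sm: "summable (\<lambda>k. exit_series_term t0 a s (int k))" by (rule summable_exit_series_term[OF assms(1) True])
    have "?w s * (exit_prefactor t0 y0 \<gamma> s * image_sum t0 a s)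
        = (\<Sum>k. ?w s * (exit_prefactor t0 y0 \<gamma> s * exit_series_term t0 a s (int k)))"
      unfolding image_sum_def by (simp only: suminf_mult[OF sm] suminf_mult[OF summable_mult[OF sm]])
    moreover have "0 \<le> ?w s * (exit_prefactor t0 y0 \<gamma> s * exit_series_term t0 a s (int k))" for k
      using exit_series_term_nonneg[OF assms(1)] exit_prefactor_nonneg[of s] True by simp
    ultimately have "ennreal (?w s * (exit_prefactor t0 y0 \<gamma> s * image_sum t0 a s))
        = (\<Sum>k. ennreal (?w s * (exit_prefactor t0 y0 \<gamma> s * exit_series_term t0 a s (int k))))"
      by (simp only: suminf_ennreal2 summable_mult[OF summable_mult[OF sm]])
    with True show ?thesis by simp
  qed simp
  then have "(\<integral>\<^sup>+s\<in>{0<..}. ennreal (?w s * (exit_prefactor t0 y0 \<gamma> s * image_sum t0 a s)) \<partial>lborel)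
      = (\<Sum>k. \<integral>\<^sup>+s\<in>{0<..}. ennreal (?w s * (exit_prefactor t0 y0 \<gamma> s * exit_series_term t0 a s (int k))) \<partial>lborel)"
    by (simp only:) (intro nn_integral_suminf, measurable)
  also have "\<dots> = (\<Sum>k. ennreal (image_laplace t0 y0 \<gamma> \<theta> a k))"
    by (simp only: nn_integral_weighted_exit_series_term[OF assms])
  also have "\<dots> = ennreal (\<Sum>k. image_laplace t0 y0 \<gamma> \<theta> a k)"
  proof (rule suminf_ennreal2)
    show "summable (image_laplace t0 y0 \<gamma> \<theta> a)"
      by (rule summable_image_laplace[OF assms(1) less_imp_le[OF assms(2)]])
  qed (simp add: image_laplace_def)
  finally show ?thesis .
qed

text \<open>
  After \<open>n\<close> iterations the remainder is \<open>L (\<theta> + 2 n)\<close> times the product \<open>D n\<close> of the factors met so far, which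
  decays at least geometrically because \<open>\<theta> > 2 (1 - \<gamma>)\<close>. The two exponentials added in step \<open>k\<close>, multiplied by \<open>D k\<close>, are
  the transforms of the images at distance \<open>(2k + 1) t0 - y0\<close> and \<open>(2k + 1) t0 + y0\<close>.
\<close>

lemma laplace_recursion_solution:
  fixes L :: "real \<Rightarrow> real"
  assumes "0 < x0" "0 < y0" "0 < \<gamma>" "\<gamma> < 1" "t0 = x0 + y0"
    and bounded: "\<And>\<theta>. 2 * (1 - \<gamma>) < \<theta> \<Longrightarrow> \<bar>L \<theta>\<bar> \<le> 1"
    and rec: "\<And>\<theta>. 2 * (1 - \<gamma>) < \<theta> \<Longrightarrow>
      L \<theta> = exp (- \<theta> * x0) - exp (- \<theta> * t0 - (2 * \<gamma> + \<theta>) * y0) + exp (- 2 * (\<theta> + \<gamma>) * t0) * L (\<theta> + 2)"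
    and \<theta>: "2 * (1 - \<gamma>) < \<theta>"
  shows "L \<theta> = (\<Sum>k. image_laplace t0 y0 \<gamma> \<theta> y0 k) - (\<Sum>k. image_laplace t0 y0 \<gamma> \<theta> (- y0) k)"
proof -
  have t0: "0 < t0" "\<bar>y0\<bar> < t0" "\<bar>- y0\<bar> < t0" using assms(1,2,5) by auto
  define D where "D k = exp (- 2 * t0 * real k * (\<theta> + \<gamma> + real k - 1))" for k
  have D_Suc: "D (Suc k) = D k * exp (- 2 * ((\<theta> + 2 * real k) + \<gamma>) * t0)" for k
    unfolding D_def exp_add[symmetric] by (simp add: algebra_simps)
  have term_eq: "image_laplace t0 y0 \<gamma> \<theta> y0 k - image_laplace t0 y0 \<gamma> \<theta> (- y0) k
      = D k * (exp (- (\<theta> + 2 * real k) * x0) - exp (- (\<theta> + 2 * real k) * t0 - (2 * \<gamma> + (\<theta> + 2 * real k)) * y0))" for k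
    unfolding image_laplace_def D_def right_diff_distrib exp_add[symmetric] \<open>t0 = x0 + y0\<close>
    by (simp add: algebra_simps)
  have partial: "L \<theta> = (\<Sum>k<n. image_laplace t0 y0 \<gamma> \<theta> y0 k - image_laplace t0 y0 \<gamma> \<theta> (- y0) k) + D n * L (\<theta> + 2 * real n)" for n
  proof (induction n)
    case 0
    then show ?case by (simp add: D_def)
  next
    case (Suc n)
    have "2 * (1 - \<gamma>) < \<theta> + 2 * real n" using \<theta> by simp
    note L_eq = rec[OF this]
    have shift: "\<theta> + 2 * real n + 2 = \<theta> + 2 * real (Suc n)" by simp
    have "D n * L (\<theta> + 2 * real n) = image_laplace t0 y0 \<gamma> \<theta> y0 n - image_laplace t0 y0 \<gamma> \<theta> (- y0) n
        + D (Suc n) * L (\<theta> + 2 * real (Suc n))"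
      unfolding term_eq D_Suc L_eq shift by (simp only: distrib_left mult.assoc)
    then show ?case unfolding Suc.IH sum.lessThan_Suc by (simp only: add.assoc)
  qed
  have D_le: "D n \<le> exp (- 2 * t0 * (1 - \<gamma>)) ^ n" for n
  proof -
    have "1 - \<gamma> \<le> \<theta> + \<gamma> + real n - 1" using \<theta> \<open>\<gamma> < 1\<close> by simp
    then have "2 * t0 * real n * (1 - \<gamma>) \<le> 2 * t0 * real n * (\<theta> + \<gamma> + real n - 1)"
      using t0 by (intro mult_left_mono) auto
    then have "D n \<le> exp (real n * (- 2 * t0 * (1 - \<gamma>)))" unfolding D_def by (simp add: algebra_simps)
    then show ?thesis by (simp only: exp_of_nat_mult)
  qed
  have "norm (D n * L (\<theta> + 2 * real n)) \<le> exp (- 2 * t0 * (1 - \<gamma>)) ^ n" for n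
  proof -
    have "norm (D n * L (\<theta> + 2 * real n)) = D n * \<bar>L (\<theta> + 2 * real n)\<bar>"
      by (simp add: abs_mult D_def)
    also have "\<dots> \<le> D n * 1"
      using bounded[of "\<theta> + 2 * real n"] \<theta> by (intro mult_left_mono) (auto simp: D_def)
    finally show ?thesis using D_le[of n] by linarith
  qed
  then have "\<forall>\<^sub>F n in sequentially. norm (D n * L (\<theta> + 2 * real n)) \<le> exp (- 2 * t0 * (1 - \<gamma>)) ^ n"
    by (rule always_eventually[OF allI])
  moreover have "(\<lambda>n. exp (- 2 * t0 * (1 - \<gamma>)) ^ n) \<longlonglongrightarrow> 0"
    using t0 \<open>\<gamma> < 1\<close> by (intro LIMSEQ_power_zero) auto
  ultimately have "(\<lambda>n. D n * L (\<theta> + 2 * real n)) \<longlonglongrightarrow> 0"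
    by (rule Lim_null_comparison)
  then have "(\<lambda>n. L \<theta> - D n * L (\<theta> + 2 * real n)) \<longlonglongrightarrow> L \<theta> - 0"
    by (intro tendsto_intros)
  moreover have "L \<theta> - D n * L (\<theta> + 2 * real n) = (\<Sum>k<n. image_laplace t0 y0 \<gamma> \<theta> y0 k - image_laplace t0 y0 \<gamma> \<theta> (- y0) k)" for n
    using partial[of n] by simp
  ultimately have "(\<lambda>k. image_laplace t0 y0 \<gamma> \<theta> y0 k - image_laplace t0 y0 \<gamma> \<theta> (- y0) k) sums L \<theta>"
    by (simp add: sums_def)
  moreover have "(\<lambda>k. image_laplace t0 y0 \<gamma> \<theta> y0 k - image_laplace t0 y0 \<gamma> \<theta> (- y0) k) sums
      ((\<Sum>k. image_laplace t0 y0 \<gamma> \<theta> y0 k) - (\<Sum>k. image_laplace t0 y0 \<gamma> \<theta> (- y0) k))"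
    using \<theta> \<open>\<gamma> < 1\<close> by (intro sums_diff summable_sums summable_image_laplace t0) auto
  ultimately show ?thesis by (rule sums_unique2)
qed

section \<open>From the Laplace transform to the density\<close>

text \<open>
  The two half series, with prefactor, are densities of finite measures \<open>N y0\<close> and \<open>N (- y0)\<close>, and the hypothesis
  says that \<open>\<mu> + N (- y0)\<close> and \<open>N y0\<close> have the same Laplace transform. Hence \<open>g\<close> has nonnegative integrals over all
  intervals, and as it is continuous it is nonnegative.
\<close>

lemma
  fixes \<mu> :: "real measure"
  assumes fin: "finite_measure \<mu>" and sets_\<mu>: "sets \<mu> = sets borel" and \<mu>_nonneg: "AE s in \<mu>. 0 \<le> s"
    and y0: "0 < y0" "y0 < t0" and \<gamma>: "0 < \<gamma>" "\<gamma> < 1"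
    and laplace: "\<And>\<theta>. 2 * (1 - \<gamma>) < \<theta> \<Longrightarrow> integral\<^sup>L \<mu> (\<lambda>s. exp (- (\<theta>\<^sup>2 / 2 - (1 - \<gamma>) * \<theta>) * s))
      = (\<Sum>k. image_laplace t0 y0 \<gamma> \<theta> y0 k) - (\<Sum>k. image_laplace t0 y0 \<gamma> \<theta> (- y0) k)"
  defines "g \<equiv> (\<lambda>s. exit_prefactor t0 y0 \<gamma> s * (image_sum t0 y0 s - image_sum t0 (- y0) s))"
  shows exit_density_nonneg: "0 < s \<Longrightarrow> 0 \<le> g s"
    and exit_density_emeasure: "S \<in> sets borel \<Longrightarrow> S \<subseteq> {0<..} \<Longrightarrow> emeasure \<mu> S = (\<integral>\<^sup>+s\<in>S. ennreal (g s) \<partial>lborel)"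
proof -
  define h where "h a s = indicator {0<..} s * (exit_prefactor t0 y0 \<gamma> s * image_sum t0 a s)" for a s
  have h_measurable [measurable]: "h a \<in> borel_measurable borel" for a
    unfolding h_def by measurable
  define N where "N a = density lborel (\<lambda>s. ennreal (h a s))" for a
  have a: "\<bar>y0\<bar> < t0" "\<bar>- y0\<bar> < t0" using y0 by auto
  have h_nonneg: "0 \<le> h a s" if "\<bar>a\<bar> < t0" for a s
  proof (cases "0 < s")
    case True
    then have "0 \<le> exit_prefactor t0 y0 \<gamma> s * image_sum t0 a s"
      by (intro mult_nonneg_nonneg exit_prefactor_nonneg image_sum_nonneg that) auto
    also have "\<dots> = h a s" using True by (simp add: h_def)
    finally show ?thesis .
  qed (simp add: h_def)
  have sets_N: "sets (N a) = sets borel" for a by (simp add: N_def)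
  have N_nonneg: "AE s in N a. 0 \<le> s" for a
    unfolding N_def by (subst AE_density) (auto simp: h_def indicator_def)
  have nn: "(\<integral>\<^sup>+s. ennreal (exp (- (\<theta>\<^sup>2 / 2 - (1 - \<gamma>) * \<theta>) * s)) \<partial>N a) = ennreal (\<Sum>k. image_laplace t0 y0 \<gamma> \<theta> a k)"
    if "\<bar>a\<bar> < t0" "1 - \<gamma> < \<theta>" for a \<theta>
  proof -
    have "(\<integral>\<^sup>+s. ennreal (exp (- (\<theta>\<^sup>2 / 2 - (1 - \<gamma>) * \<theta>) * s)) \<partial>N a)
        = (\<integral>\<^sup>+s. ennreal (h a s) * ennreal (exp (- (\<theta>\<^sup>2 / 2 - (1 - \<gamma>) * \<theta>) * s)) \<partial>lborel)"
      unfolding N_def by (rule nn_integral_density) auto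
    also have "\<dots> = (\<integral>\<^sup>+s\<in>{0<..}. ennreal (exp (- (\<theta>\<^sup>2 / 2 - (1 - \<gamma>) * \<theta>) * s) * (exit_prefactor t0 y0 \<gamma> s * image_sum t0 a s)) \<partial>lborel)"
    proof (intro nn_integral_cong)
      fix s
      show "ennreal (h a s) * ennreal (exp (- (\<theta>\<^sup>2 / 2 - (1 - \<gamma>) * \<theta>) * s))
        = ennreal (exp (- (\<theta>\<^sup>2 / 2 - (1 - \<gamma>) * \<theta>) * s) * (exit_prefactor t0 y0 \<gamma> s * image_sum t0 a s)) * indicator {0<..} s"
      proof (cases "0 < s")
        case True
        then show ?thesis unfolding h_def by (subst ennreal_mult''[symmetric]) (simp_all add: mult.commute)
      qed (simp add: h_def)
    qed
    also have "\<dots> = ennreal (\<Sum>k. image_laplace t0 y0 \<gamma> \<theta> a k)"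
      by (rule nn_integral_weighted_image_sum[OF that])
    finally show ?thesis .
  qed
  have fin_N: "finite_measure (N a)" if "\<bar>a\<bar> < t0" for a
  proof
    have zero: "(2 * (1 - \<gamma>))\<^sup>2 / 2 - (1 - \<gamma>) * (2 * (1 - \<gamma>)) = 0"
      by (simp add: power2_eq_square field_simps)
    have "emeasure (N a) (space (N a)) = (\<integral>\<^sup>+s. ennreal (exp (- ((2 * (1 - \<gamma>))\<^sup>2 / 2 - (1 - \<gamma>) * (2 * (1 - \<gamma>))) * s)) \<partial>N a)"
      unfolding zero by simp
    then show "emeasure (N a) (space (N a)) \<noteq> \<infinity>"
      using nn[OF that, of "2 * (1 - \<gamma>)"] \<gamma> by simp
  qed
  have int_N: "integral\<^sup>L (N a) (\<lambda>s. exp (- (\<theta>\<^sup>2 / 2 - (1 - \<gamma>) * \<theta>) * s)) = (\<Sum>k. image_laplace t0 y0 \<gamma> \<theta> a k)"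
    if "\<bar>a\<bar> < t0" "1 - \<gamma> < \<theta>" for a \<theta>
  proof -
    have "0 \<le> (\<Sum>k. image_laplace t0 y0 \<gamma> \<theta> a k)"
      using that by (intro suminf_nonneg summable_image_laplace) (auto simp: image_laplace_def)
    moreover have "integral\<^sup>L (N a) (\<lambda>s. exp (- (\<theta>\<^sup>2 / 2 - (1 - \<gamma>) * \<theta>) * s))
        = enn2real (\<integral>\<^sup>+s. ennreal (exp (- (\<theta>\<^sup>2 / 2 - (1 - \<gamma>) * \<theta>) * s)) \<partial>N a)"
      by (rule integral_eq_nn_integral) (auto simp: N_def)
    ultimately show ?thesis unfolding nn[OF that] by simp
  qed
  interpret three_finite_measures \<mu> "N (- y0)" "N y0"
    using fin fin_N[OF a(1)] fin_N[OF a(2)] sets_\<mu> sets_N \<mu>_nonneg N_nonneg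
    by (intro three_finite_measures.intro three_finite_measures_axioms.intro) auto
  have eq: "measure \<mu> S + measure (N (- y0)) S = measure (N y0) S" if "S \<in> sets borel" for S
  proof (rule measure_add_eq_of_laplace[OF _ that])
    fix p :: real assume "0 < p"
    \<comment> \<open>the larger root of \<open>\<theta>\<^sup>2 / 2 - (1 - \<gamma>) \<theta> = p\<close>\<close>
    define \<theta> where "\<theta> = (1 - \<gamma>) + sqrt ((1 - \<gamma>)\<^sup>2 + 2 * p)"
    have "(1 - \<gamma>)\<^sup>2 < (1 - \<gamma>)\<^sup>2 + 2 * p" using \<open>0 < p\<close> by simp
    then have "sqrt ((1 - \<gamma>)\<^sup>2) < sqrt ((1 - \<gamma>)\<^sup>2 + 2 * p)" by (rule real_sqrt_less_mono)
    then have "2 * (1 - \<gamma>) < \<theta>" using \<gamma> by (simp add: \<theta>_def)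
    have "(\<theta> - (1 - \<gamma>))\<^sup>2 = (1 - \<gamma>)\<^sup>2 + 2 * p" unfolding \<theta>_def using \<open>0 < p\<close> by simp
    then have p: "\<theta>\<^sup>2 / 2 - (1 - \<gamma>) * \<theta> = p" by (simp add: power2_eq_square algebra_simps)
    have "1 - \<gamma> < \<theta>" using \<open>2 * (1 - \<gamma>) < \<theta>\<close> \<gamma> by simp
    then show "integral\<^sup>L \<mu> (\<lambda>x. exp (- p * x)) + integral\<^sup>L (N (- y0)) (\<lambda>x. exp (- p * x)) = integral\<^sup>L (N y0) (\<lambda>x. exp (- p * x))"
      using laplace[OF \<open>2 * (1 - \<gamma>) < \<theta>\<close>] int_N[OF a(1), of \<theta>] int_N[OF a(2), of \<theta>] unfolding p by simp
  qed
  have int_h: "integrable lborel (h a)" if "\<bar>a\<bar> < t0" for a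
  proof -
    have "(\<integral>\<^sup>+s. ennreal (h a s) \<partial>lborel) = emeasure (N a) (space (N a))"
      unfolding N_def by (subst emeasure_density) auto
    also have "\<dots> < \<infinity>" using finite_measure.emeasure_finite[OF fin_N[OF that], of "space (N a)"] by (simp add: less_top)
    finally show ?thesis using h_nonneg[OF that] by (intro integrableI_nonneg) auto
  qed
  have measure_N: "measure (N a) S = (LBINT s:S. h a s)" if "\<bar>a\<bar> < t0" and [measurable]: "S \<in> sets borel" for a S
  proof -
    have "emeasure (N a) S = (\<integral>\<^sup>+s. ennreal (indicator S s *\<^sub>R h a s) \<partial>lborel)"
      unfolding N_def by (subst emeasure_density) (auto intro!: nn_integral_cong simp: indicator_def)
    also have "\<dots> = ennreal (LBINT s:S. h a s)"
      unfolding set_lebesgue_integral_def using h_nonneg[OF that(1)] int_h[OF that(1)]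
      by (intro nn_integral_eq_integral integrable_mult_indicator) auto
    finally have "enn2real (emeasure (N a) S) = enn2real (ennreal (LBINT s:S. h a s))" by simp
    moreover have "0 \<le> (LBINT s:S. h a s)"
      unfolding set_lebesgue_integral_def using h_nonneg[OF that(1)] by (intro integral_nonneg_AE) auto
    ultimately show ?thesis by (simp add: measure_def)
  qed
  have set_int_h: "set_integrable lborel S (h a)" if "S \<in> sets borel" "\<bar>a\<bar> < t0" for S a
    unfolding set_integrable_def using that int_h[OF that(2)] by (intro integrable_mult_indicator) auto
  have g_eq: "g s = h y0 s - h (- y0) s" if "0 < s" for s
    using that by (simp add: g_def h_def algebra_simps)
  have measure_\<mu>: "measure \<mu> S = (LBINT s:S. h y0 s - h (- y0) s)" if "S \<in> sets borel" for S
    using eq[OF that] measure_N[OF a(1) that] measure_N[OF a(2) that]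
      set_integral_diff(2)[OF set_int_h[OF that a(1)] set_int_h[OF that a(2)]] by simp
  have g_nonneg: "0 \<le> g s" if "0 < s" for s
  proof (rule continuous_nonneg_of_interval_integrals[OF _ _ that])
    show "continuous_on {0<..} g"
      unfolding g_def by (intro continuous_intros continuous_on_exit_prefactor continuous_on_image_sum a)
    fix c d :: real assume "0 < c" "c < d"
    then have "(LBINT s:{c..d}. g s) = (LBINT s:{c..d}. h y0 s - h (- y0) s)"
      by (intro set_lebesgue_integral_cong) (auto simp: g_eq)
    then show "0 \<le> (LBINT s:{c..d}. g s)" using measure_\<mu>[of "{c..d}"] by (metis measure_nonneg atLeastAtMost_borel)
  qed
  then show "0 < s \<Longrightarrow> 0 \<le> g s" for s .
  assume S [measurable]: "S \<in> sets borel" and pos: "S \<subseteq> {0<..}"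
  have "emeasure \<mu> S = ennreal (measure \<mu> S)"
    using finite_measure.emeasure_eq_measure[OF fin] .
  also have "measure \<mu> S = (\<integral>s. indicator S s *\<^sub>R (h y0 s - h (- y0) s) \<partial>lborel)"
    unfolding measure_\<mu>[OF S] set_lebesgue_integral_def ..
  also have "ennreal \<dots> = (\<integral>\<^sup>+s. ennreal (indicator S s *\<^sub>R (h y0 s - h (- y0) s)) \<partial>lborel)"
  proof (rule nn_integral_eq_integral[symmetric])
    show "integrable lborel (\<lambda>s. indicator S s *\<^sub>R (h y0 s - h (- y0) s))"
      using int_h[OF a(1)] int_h[OF a(2)] by (intro integrable_mult_indicator Bochner_Integration.integrable_diff) auto
    show "AE s in lborel. 0 \<le> indicator S s *\<^sub>R (h y0 s - h (- y0) s)"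
      using g_nonneg g_eq pos by (intro AE_I2) (auto simp: indicator_def)
  qed
  also have "\<dots> = (\<integral>\<^sup>+s\<in>S. ennreal (g s) \<partial>lborel)"
    using pos g_eq by (intro nn_integral_cong) (auto simp: indicator_def)
  finally show "emeasure \<mu> S = (\<integral>\<^sup>+s\<in>S. ennreal (g s) \<partial>lborel)" .
qed

section \<open>The exit law of a continuous Brownian motion\<close>

text \<open>
  A condition on countably many times: on \<open>[0, r]\<close> a continuous path that avoids the line keeps a positive distance
  to it, and conversely such a distance at rational times persists in the limit.
\<close>

lemma less_hit_time_iff:
  fixes w :: "real \<Rightarrow> real"
  assumes cont: "continuous_on {0..} w" and w0: "w 0 = 0" and "0 < b" "0 \<le> r"
  shows "ereal r < hit_time b \<alpha> w \<longleftrightarrow>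
    (\<exists>m::nat. \<forall>i n::nat. real i / real (Suc n) \<le> r \<longrightarrow>
      w (real i / real (Suc n)) \<le> b + \<alpha> * (real i / real (Suc n)) - inverse (real (Suc m)))"
proof
  assume less: "ereal r < hit_time b \<alpha> w"
  have below: "w s < b + \<alpha> * s" if "0 \<le> s" "s \<le> r" for s
    using cont w0 \<open>0 < b\<close>
  proof (cases rule: hit_time_cases[where \<alpha> = \<alpha>])
    case (finite \<tau>)
    then show ?thesis using less that by simp
  qed (use that in blast)
  have "continuous_on {0..r} (\<lambda>s. b + \<alpha> * s - w s)"
    by (intro continuous_intros continuous_on_subset[OF cont]) auto
  then obtain c where c: "c \<in> {0..r}" "\<And>s. s \<in> {0..r} \<Longrightarrow> b + \<alpha> * c - w c \<le> b + \<alpha> * s - w s"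
    using continuous_attains_inf[of "{0..r}" "\<lambda>s. b + \<alpha> * s - w s"] \<open>0 \<le> r\<close> by auto
  have "0 < b + \<alpha> * c - w c" using below[of c] c(1) by simp
  then obtain m where m: "inverse (real (Suc m)) < b + \<alpha> * c - w c"
    using reals_Archimedean by blast
  have "w (real i / real (Suc n)) \<le> b + \<alpha> * (real i / real (Suc n)) - inverse (real (Suc m))"
    if "real i / real (Suc n) \<le> r" for i n
    using c(2)[of "real i / real (Suc n)"] m that by auto
  then show "\<exists>m::nat. \<forall>i n::nat. real i / real (Suc n) \<le> r \<longrightarrow>
      w (real i / real (Suc n)) \<le> b + \<alpha> * (real i / real (Suc n)) - inverse (real (Suc m))" by blast
next
  assume "\<exists>m::nat. \<forall>i n::nat. real i / real (Suc n) \<le> r \<longrightarrow>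
      w (real i / real (Suc n)) \<le> b + \<alpha> * (real i / real (Suc n)) - inverse (real (Suc m))"
  then obtain m :: nat where m: "\<And>i n. real i / real (Suc n) \<le> r \<Longrightarrow>
      w (real i / real (Suc n)) \<le> b + \<alpha> * (real i / real (Suc n)) - inverse (real (Suc m))" by blast
  have below: "w s < b + \<alpha> * s" if s: "0 \<le> s" "s \<le> r" for s
  proof -
    \<comment> \<open>rational times approaching \<open>s\<close> from below\<close>
    define q where "q n = real (nat \<lfloor>s * real (Suc n)\<rfloor>) / real (Suc n)" for n
    have q_bounds: "s - inverse (real (Suc n)) \<le> q n" "q n \<le> s" for n
    proof -
      define d where "d = real (Suc n)"
      have d: "0 < d" "q n = real (nat \<lfloor>s * d\<rfloor>) / d" by (auto simp: d_def q_def)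
      have "0 \<le> s * d" using s d by simp
      then have "s * d - 1 \<le> real (nat \<lfloor>s * d\<rfloor>)" "real (nat \<lfloor>s * d\<rfloor>) \<le> s * d"
        by linarith+
      moreover have "(s - inverse d) * d = s * d - 1"
        using d(1) by (simp add: left_diff_distrib)
      ultimately show "s - inverse (real (Suc n)) \<le> q n" "q n \<le> s"
        unfolding d(2) d_def[symmetric] pos_le_divide_eq[OF d(1)] pos_divide_le_eq[OF d(1)] by auto
    qed
    have "(\<lambda>n. s - inverse (real (Suc n))) \<longlonglongrightarrow> s - 0"
      by (intro tendsto_intros LIMSEQ_inverse_real_of_nat)
    then have q: "q \<longlonglongrightarrow> s"
      using q_bounds by (intro tendsto_sandwich[where g = q and h = "\<lambda>_. s"] always_eventually allI tendsto_const) simp_all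
    have q0: "0 \<le> q n" for n unfolding q_def by simp
    have "(\<lambda>n. w (q n)) \<longlonglongrightarrow> w s"
      using s q0 by (intro continuous_on_tendsto_compose[OF cont q]) auto
    moreover have "(\<lambda>n. b + \<alpha> * q n - inverse (real (Suc m))) \<longlonglongrightarrow> b + \<alpha> * s - inverse (real (Suc m))"
      by (intro tendsto_intros q)
    moreover have "w (q n) \<le> b + \<alpha> * q n - inverse (real (Suc m))" for n
    proof -
      have "q n \<le> r" using q_bounds(2)[of n] s by simp
      then show ?thesis unfolding q_def by (rule m)
    qed
    ultimately have "w s \<le> b + \<alpha> * s - inverse (real (Suc m))"
      by (intro LIMSEQ_le[of "\<lambda>n. w (q n)"]) blast+
    moreover have "0 < inverse (real (Suc m))" by simp
    ultimately show ?thesis by linarith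
  qed
  show "ereal r < hit_time b \<alpha> w"
    using cont w0 \<open>0 < b\<close>
  proof (cases rule: hit_time_cases[where \<alpha> = \<alpha>])
    case (finite \<tau>)
    then show ?thesis using below[of \<tau>] by (cases "\<tau> \<le> r") auto
  qed simp
qed

lemma measurable_hit_time:
  fixes X :: "real \<Rightarrow> 'a \<Rightarrow> real"
  assumes meas: "\<And>t. 0 \<le> t \<Longrightarrow> X t \<in> borel_measurable M"
    and cont: "\<And>\<omega>. \<omega> \<in> space M \<Longrightarrow> continuous_on {0..} (\<lambda>t. X t \<omega>)"
    and X0: "\<And>\<omega>. \<omega> \<in> space M \<Longrightarrow> X 0 \<omega> = 0" and "0 < b"
  shows "(\<lambda>\<omega>. hit_time b \<alpha> (\<lambda>t. X t \<omega>)) \<in> borel_measurable M"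
proof (rule borel_measurableI_greater)
  fix y :: ereal
  have [measurable]: "X (real i / real (Suc n)) \<in> borel_measurable M" for i n by (rule meas) simp
  have pos: "0 < hit_time b \<alpha> (\<lambda>t. X t \<omega>)" if "\<omega> \<in> space M" for \<omega>
    using cont[OF that] X0[OF that] \<open>0 < b\<close> by (cases rule: hit_time_cases[where \<alpha> = \<alpha>]) auto
  show "{\<omega> \<in> space M. y < hit_time b \<alpha> (\<lambda>t. X t \<omega>)} \<in> sets M"
  proof (cases "0 \<le> y")
    case False
    then have "{\<omega> \<in> space M. y < hit_time b \<alpha> (\<lambda>t. X t \<omega>)} = space M"
      using pos by (auto intro: less_trans simp: not_le)
    then show ?thesis by simp
  next
    case True
    show ?thesis
    proof (cases y)
      case (real r)
      then have "0 \<le> r" using True by simp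
      have "{\<omega> \<in> space M. y < hit_time b \<alpha> (\<lambda>t. X t \<omega>)} = {\<omega> \<in> space M. \<exists>m::nat. \<forall>i n::nat. real i / real (Suc n) \<le> r \<longrightarrow>
        X (real i / real (Suc n)) \<omega> \<le> b + \<alpha> * (real i / real (Suc n)) - inverse (real (Suc m))}"
        unfolding real using less_hit_time_iff[OF cont X0 \<open>0 < b\<close> \<open>0 \<le> r\<close>] by blast
      also have "\<dots> \<in> sets M" by measurable
      finally show ?thesis .
    qed (use True in auto)
  qed
qed

lemma
  fixes w :: "real \<Rightarrow> real"
  assumes "continuous_on {0..} w" "w 0 = 0" "0 < b"
  shows hit_time_pos: "0 < hit_time b \<alpha> w"
    and value_at_hit_time: "hit_time b \<alpha> w < \<infinity> \<Longrightarrow> w (real_of_ereal (hit_time b \<alpha> w)) = b + \<alpha> * real_of_ereal (hit_time b \<alpha> w)"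
  using assms by (cases rule: hit_time_cases[where \<alpha> = \<alpha>]; simp)+

context continuous_brownian_motion
begin

lemma measurable_hit_times:
  assumes "0 < b"
  shows "(\<lambda>\<omega>. hit_time b \<alpha> (\<lambda>t. W t \<omega>)) \<in> borel_measurable M"
    and "(\<lambda>\<omega>. hit_time b \<alpha> (\<lambda>t. - W t \<omega>)) \<in> borel_measurable M"
proof -
  show "(\<lambda>\<omega>. hit_time b \<alpha> (\<lambda>t. W t \<omega>)) \<in> borel_measurable M"
    by (rule measurable_hit_time[OF random_variable continuous_path start_zero assms])
  show "(\<lambda>\<omega>. hit_time b \<alpha> (\<lambda>t. - W t \<omega>)) \<in> borel_measurable M"
    by (rule measurable_hit_time[where X = "\<lambda>t \<omega>. - W t \<omega>", OF _ _ _ assms])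
       (auto intro!: continuous_on_minus continuous_path random_variable simp: start_zero)
qed

context
  fixes x0 y0 \<gamma> :: real
begin

definition upper_time :: "'a \<Rightarrow> ereal" where
  "upper_time \<omega> = hit_time x0 (1 - \<gamma>) (\<lambda>t. W t \<omega>)"

definition lower_time :: "'a \<Rightarrow> ereal" where
  "lower_time \<omega> = hit_time y0 \<gamma> (\<lambda>t. - W t \<omega>)"

definition upper_laplace :: "real \<Rightarrow> real" where
  "upper_laplace p = expectation (\<lambda>\<omega>. if upper_time \<omega> < lower_time \<omega> then exp (- p * real_of_ereal (upper_time \<omega>)) else 0)"

definition lower_laplace :: "real \<Rightarrow> real" where
  "lower_laplace q = expectation (\<lambda>\<omega>. if lower_time \<omega> < upper_time \<omega> then exp (- q * real_of_ereal (lower_time \<omega>)) else 0)"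

definition upper_exit_law :: "real measure" where
  "upper_exit_law = distr (density M (\<lambda>\<omega>. indicator {\<omega>. upper_time \<omega> < lower_time \<omega>} \<omega>)) borel (\<lambda>\<omega>. real_of_ereal (upper_time \<omega>))"

context
  assumes pos: "0 < x0" "0 < y0" and \<gamma>: "0 < \<gamma>" "\<gamma> < 1"
begin

lemma measurable_times [measurable]:
  "upper_time \<in> borel_measurable M" "lower_time \<in> borel_measurable M"
  unfolding upper_time_def lower_time_def by (rule measurable_hit_times pos)+

lemma times_pos: "\<omega> \<in> space M \<Longrightarrow> 0 < upper_time \<omega>" "\<omega> \<in> space M \<Longrightarrow> 0 < lower_time \<omega>"
  unfolding upper_time_def lower_time_def
  by (auto intro!: hit_time_pos continuous_path continuous_on_minus pos simp: start_zero)

lemma exp_time_le: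
  assumes "0 \<le> p" "\<omega> \<in> space M"
  shows "exp (- p * real_of_ereal (upper_time \<omega>)) \<le> 1" "exp (- p * real_of_ereal (lower_time \<omega>)) \<le> 1"
  using assms times_pos[OF assms(2)] by (auto intro!: mult_nonneg_nonneg real_of_ereal_pos)

lemma integrable_laplace:
  assumes "0 \<le> p"
  shows "integrable M (\<lambda>\<omega>. if upper_time \<omega> < lower_time \<omega> then exp (- p * real_of_ereal (upper_time \<omega>)) else 0)"
    and "integrable M (\<lambda>\<omega>. if lower_time \<omega> < upper_time \<omega> then exp (- p * real_of_ereal (lower_time \<omega>)) else 0)"
  using exp_time_le[OF assms] by (auto intro!: integrable_const_bound[of _ 1] AE_I2)

lemma laplace_relation:
  assumes \<theta>: "\<theta> > 2 * (1 - \<gamma>) \<or> \<theta> < - 2 * \<gamma>"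
  shows "exp (\<theta> * x0) * upper_laplace (\<theta>\<^sup>2 / 2 - (1 - \<gamma>) * \<theta>) + exp (- \<theta> * y0) * lower_laplace (\<theta>\<^sup>2 / 2 + \<gamma> * \<theta>) = 1"
proof -
  let ?p = "\<theta>\<^sup>2 / 2 - (1 - \<gamma>) * \<theta>" and ?q = "\<theta>\<^sup>2 / 2 + \<gamma> * \<theta>"
  have pq: "?p = \<theta> * (\<theta> - 2 * (1 - \<gamma>)) / 2" "?q = \<theta> * (\<theta> + 2 * \<gamma>) / 2"
    by (simp_all add: power2_eq_square field_simps)
  have "0 \<le> ?p" "0 \<le> ?q"
    unfolding pq using \<theta> \<gamma> by (auto simp: zero_le_mult_iff)
  note int = integrable_laplace(1)[OF \<open>0 \<le> ?p\<close>] integrable_laplace(2)[OF \<open>0 \<le> ?q\<close>]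
  have "1 = expectation (\<lambda>\<omega>. exit_functional \<theta> x0 y0 (1 - \<gamma>) \<gamma> (\<lambda>s. W s \<omega>))"
    using expectation_exit_functional[of x0 y0 "1 - \<gamma>" \<gamma> \<theta>] pos \<gamma> \<theta> by simp
  also have "(\<lambda>\<omega>. exit_functional \<theta> x0 y0 (1 - \<gamma>) \<gamma> (\<lambda>s. W s \<omega>)) = (\<lambda>\<omega>.
      exp (\<theta> * x0) * (if upper_time \<omega> < lower_time \<omega> then exp (- ?p * real_of_ereal (upper_time \<omega>)) else 0)
      + exp (- \<theta> * y0) * (if lower_time \<omega> < upper_time \<omega> then exp (- ?q * real_of_ereal (lower_time \<omega>)) else 0))"
    unfolding exit_functional_def upper_time_def lower_time_def by (auto simp: fun_eq_iff algebra_simps simp flip: exp_add)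
  also have "expectation \<dots> = exp (\<theta> * x0) * upper_laplace ?p + exp (- \<theta> * y0) * lower_laplace ?q"
    unfolding upper_laplace_def lower_laplace_def using int by simp
  finally show ?thesis by simp
qed

text \<open>
  With \<open>\<theta>' = - 2 \<gamma> - \<theta>\<close> the relation contains the same value of the lower transform, and its upper
  transform has the parameter \<open>2 (1 - \<gamma>) - \<theta>' = \<theta> + 2\<close>.
\<close>

lemma upper_laplace_recursion:
  assumes \<theta>: "2 * (1 - \<gamma>) < \<theta>"
  shows "upper_laplace (\<theta>\<^sup>2 / 2 - (1 - \<gamma>) * \<theta>)
    = exp (- \<theta> * x0) - exp (- \<theta> * (x0 + y0) - (2 * \<gamma> + \<theta>) * y0)
      + exp (- 2 * (\<theta> + \<gamma>) * (x0 + y0)) * upper_laplace ((\<theta> + 2)\<^sup>2 / 2 - (1 - \<gamma>) * (\<theta> + 2))"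
proof -
  define \<theta>' where "\<theta>' = - 2 * \<gamma> - \<theta>"
  define U where "U = upper_laplace (\<theta>\<^sup>2 / 2 - (1 - \<gamma>) * \<theta>)"
  define U' where "U' = upper_laplace ((\<theta> + 2)\<^sup>2 / 2 - (1 - \<gamma>) * (\<theta> + 2))"
  define V where "V = lower_laplace (\<theta>\<^sup>2 / 2 + \<gamma> * \<theta>)"
  have \<theta>': "\<theta>' < - 2 * \<gamma>" unfolding \<theta>'_def using \<theta> \<gamma> by simp
  have "\<theta>'\<^sup>2 / 2 - (1 - \<gamma>) * \<theta>' = (\<theta> + 2)\<^sup>2 / 2 - (1 - \<gamma>) * (\<theta> + 2)" "\<theta>'\<^sup>2 / 2 + \<gamma> * \<theta>' = \<theta>\<^sup>2 / 2 + \<gamma> * \<theta>"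
    unfolding \<theta>'_def by (simp_all add: power2_eq_square field_simps)
  then have V: "exp (\<theta>' * x0) * U' + exp (- \<theta>' * y0) * V = 1"
    using laplace_relation[of \<theta>'] \<theta>' by (simp add: U'_def V_def)
  have U: "exp (\<theta> * x0) * U + exp (- \<theta> * y0) * V = 1"
    using laplace_relation[of \<theta>] \<theta> by (simp add: U_def V_def)
  have "V = exp (\<theta>' * y0) * (exp (- \<theta>' * y0) * V)" by (simp flip: exp_add mult.assoc)
  also have "\<dots> = exp (\<theta>' * y0) * (1 - exp (\<theta>' * x0) * U')" using V by simp
  finally have V_eq: "V = exp (\<theta>' * y0) * (1 - exp (\<theta>' * x0) * U')" .
  have "U = exp (- \<theta> * x0) * (exp (\<theta> * x0) * U)" by (simp flip: exp_add mult.assoc)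
  also have "\<dots> = exp (- \<theta> * x0) * (1 - exp (- \<theta> * y0) * (exp (\<theta>' * y0) * (1 - exp (\<theta>' * x0) * U')))"
    using U unfolding V_eq by simp
  also have "\<dots> = exp (- \<theta> * x0) - exp (- \<theta> * x0) * exp (- \<theta> * y0) * exp (\<theta>' * y0)
      + exp (- \<theta> * x0) * exp (- \<theta> * y0) * exp (\<theta>' * y0) * exp (\<theta>' * x0) * U'"
    by (simp add: algebra_simps)
  also have "exp (- \<theta> * x0) * exp (- \<theta> * y0) * exp (\<theta>' * y0) * exp (\<theta>' * x0) = exp (- 2 * (\<theta> + \<gamma>) * (x0 + y0))"
    unfolding exp_add[symmetric] \<theta>'_def by (simp add: algebra_simps)
  also have "exp (- \<theta> * x0) * exp (- \<theta> * y0) * exp (\<theta>' * y0) = exp (- \<theta> * (x0 + y0) - (2 * \<gamma> + \<theta>) * y0)"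
    unfolding exp_add[symmetric] \<theta>'_def by (simp add: algebra_simps)
  finally show ?thesis unfolding U_def U'_def .
qed

lemma emeasure_upper_exit_law:
  assumes [measurable]: "S \<in> sets borel"
  shows "emeasure upper_exit_law S = emeasure M {\<omega> \<in> space M. real_of_ereal (upper_time \<omega>) \<in> S \<and> upper_time \<omega> < lower_time \<omega>}"
proof -
  have ind: "(\<lambda>\<omega>. indicator {\<omega>. upper_time \<omega> < lower_time \<omega>} \<omega> :: ennreal) \<in> borel_measurable M"
    by (intro borel_measurable_indicator') measurable
  have "emeasure upper_exit_law S = emeasure (density M (\<lambda>\<omega>. indicator {\<omega>. upper_time \<omega> < lower_time \<omega>} \<omega>))
      {\<omega> \<in> space M. real_of_ereal (upper_time \<omega>) \<in> S}"
    unfolding upper_exit_law_def by (subst emeasure_distr) (auto simp: vimage_def Int_def conj_commute)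
  also have "\<dots> = (\<integral>\<^sup>+\<omega>. indicator {\<omega>. upper_time \<omega> < lower_time \<omega>} \<omega>
      * indicator {\<omega> \<in> space M. real_of_ereal (upper_time \<omega>) \<in> S} \<omega> \<partial>M)"
    by (rule emeasure_density[OF ind]) measurable
  also have "\<dots> = (\<integral>\<^sup>+\<omega>. indicator {\<omega> \<in> space M. real_of_ereal (upper_time \<omega>) \<in> S \<and> upper_time \<omega> < lower_time \<omega>} \<omega> \<partial>M)"
    by (intro nn_integral_cong) (simp split: split_indicator)
  also have "\<dots> = emeasure M {\<omega> \<in> space M. real_of_ereal (upper_time \<omega>) \<in> S \<and> upper_time \<omega> < lower_time \<omega>}"
    by (rule nn_integral_indicator) measurable
  finally show ?thesis .
qed

lemma integral_upper_exit_law: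
  "integral\<^sup>L upper_exit_law (\<lambda>s. exp (- p * s)) = upper_laplace p"
proof -
  have ind: "(\<lambda>\<omega>. indicator {\<omega>. upper_time \<omega> < lower_time \<omega>} \<omega> :: real) \<in> borel_measurable M"
    by (intro borel_measurable_indicator') measurable
  have "integral\<^sup>L upper_exit_law (\<lambda>s. exp (- p * s))
      = integral\<^sup>L (density M (\<lambda>\<omega>. ennreal (indicator {\<omega>. upper_time \<omega> < lower_time \<omega>} \<omega>))) (\<lambda>\<omega>. exp (- p * real_of_ereal (upper_time \<omega>)))"
    unfolding upper_exit_law_def ennreal_indicator by (rule integral_distr) measurable
  also have "\<dots> = expectation (\<lambda>\<omega>. indicator {\<omega>. upper_time \<omega> < lower_time \<omega>} \<omega> *\<^sub>R exp (- p * real_of_ereal (upper_time \<omega>)))"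
    using ind by (intro integral_density) auto
  also have "\<dots> = upper_laplace p"
    unfolding upper_laplace_def by (intro Bochner_Integration.integral_cong) (auto simp: indicator_def)
  finally show ?thesis .
qed

lemma upper_exit_density:
  defines "t0 \<equiv> x0 + y0"
  defines "g \<equiv> (\<lambda>s. exit_prefactor t0 y0 \<gamma> s * (image_sum t0 y0 s - image_sum t0 (- y0) s))"
  shows "0 < s \<Longrightarrow> 0 \<le> g s"
    and "S \<in> sets borel \<Longrightarrow> S \<subseteq> {0<..} \<Longrightarrow>
      emeasure M {\<omega> \<in> space M. real_of_ereal (upper_time \<omega>) \<in> S \<and> upper_time \<omega> < lower_time \<omega>} = (\<integral>\<^sup>+s\<in>S. ennreal (g s) \<partial>lborel)"
proof -
  have sets_law: "sets upper_exit_law = sets borel" by (simp add: upper_exit_law_def)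
  have fin: "finite_measure upper_exit_law"
  proof
    show "emeasure upper_exit_law (space upper_exit_law) \<noteq> \<infinity>"
      using emeasure_upper_exit_law[of UNIV] sets_eq_imp_space_eq[OF sets_law] by simp
  qed
  have nonneg: "AE s in upper_exit_law. 0 \<le> s"
  proof (rule AE_I)
    have empty: "{\<omega> \<in> space M. real_of_ereal (upper_time \<omega>) \<in> {..<0} \<and> upper_time \<omega> < lower_time \<omega>} = {}"
      using times_pos(1) real_of_ereal_pos by (force simp: not_less[symmetric] less_imp_le)
    show "emeasure upper_exit_law {..<0} = 0"
      using emeasure_upper_exit_law[of "{..<0}"] unfolding empty by simp
  qed (auto simp: sets_law)
  have bounded: "\<bar>upper_laplace (\<theta>\<^sup>2 / 2 - (1 - \<gamma>) * \<theta>)\<bar> \<le> 1" if "2 * (1 - \<gamma>) < \<theta>" for \<theta>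
  proof -
    have "\<theta>\<^sup>2 / 2 - (1 - \<gamma>) * \<theta> = \<theta> * (\<theta> - 2 * (1 - \<gamma>)) / 2" by (simp add: power2_eq_square field_simps)
    also have "0 \<le> \<dots>" using that \<gamma> by (auto simp: zero_le_mult_iff)
    finally have p: "0 \<le> \<theta>\<^sup>2 / 2 - (1 - \<gamma>) * \<theta>" .
    have "upper_laplace (\<theta>\<^sup>2 / 2 - (1 - \<gamma>) * \<theta>) \<le> expectation (\<lambda>\<omega>. 1)"
      unfolding upper_laplace_def using exp_time_le[OF p] by (intro integral_mono integrable_laplace p) auto
    moreover have "0 \<le> upper_laplace (\<theta>\<^sup>2 / 2 - (1 - \<gamma>) * \<theta>)"
      unfolding upper_laplace_def by (intro integral_nonneg_AE) auto
    ultimately show ?thesis by (simp add: prob_space)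
  qed
  have laplace: "integral\<^sup>L upper_exit_law (\<lambda>s. exp (- (\<theta>\<^sup>2 / 2 - (1 - \<gamma>) * \<theta>) * s))
      = (\<Sum>k. image_laplace t0 y0 \<gamma> \<theta> y0 k) - (\<Sum>k. image_laplace t0 y0 \<gamma> \<theta> (- y0) k)" if "2 * (1 - \<gamma>) < \<theta>" for \<theta>
    unfolding integral_upper_exit_law
    by (rule laplace_recursion_solution[where L = "\<lambda>\<theta>. upper_laplace (\<theta>\<^sup>2 / 2 - (1 - \<gamma>) * \<theta>)" and ?x0.0 = x0])
       (rule pos \<gamma> t0_def[THEN meta_eq_to_obj_eq] bounded upper_laplace_recursion[folded t0_def] that; assumption?)+
  have "y0 < t0" using pos by (simp add: t0_def)
  show "0 < s \<Longrightarrow> 0 \<le> g s" for s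
    unfolding g_def by (rule exit_density_nonneg[OF fin sets_law nonneg pos(2) \<open>y0 < t0\<close> \<gamma> laplace])
  assume S: "S \<in> sets borel" "S \<subseteq> {0<..}"
  show "emeasure M {\<omega> \<in> space M. real_of_ereal (upper_time \<omega>) \<in> S \<and> upper_time \<omega> < lower_time \<omega>} = (\<integral>\<^sup>+s\<in>S. ennreal (g s) \<partial>lborel)"
    unfolding emeasure_upper_exit_law[OF S(1), symmetric] g_def
    by (rule exit_density_emeasure[OF fin sets_law nonneg pos(2) \<open>y0 < t0\<close> \<gamma> laplace S])
qed

end

end

end

section \<open>Exit densities of a Brownian motion with almost surely continuous paths\<close>

lemma (in prob_space) indep_vars_cong_AE:
  assumes X: "indep_vars M' X I" and "finite I"
    and Y: "\<And>i. i \<in> I \<Longrightarrow> random_variable (M' i) (Y i)"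
    and eq: "\<And>i. i \<in> I \<Longrightarrow> AE \<omega> in M. X i \<omega> = Y i \<omega>"
  shows "indep_vars M' Y I"
proof (cases "I = {}")
  case True
  with X show ?thesis by (simp add: indep_vars_def indep_sets_def)
next
  case False
  have rv: "random_variable (M' i) (X i)" if "i \<in> I" for i
    using X that by (simp add: indep_vars_def)
  have all: "AE \<omega> in M. \<forall>i\<in>I. X i \<omega> = Y i \<omega>"
    using eq \<open>finite I\<close> by (intro AE_finite_allI)
  have "distr M (PiM I M') (\<lambda>x. \<lambda>i\<in>I. Y i x) = distr M (PiM I M') (\<lambda>x. \<lambda>i\<in>I. X i x)"
    by (rule distr_cong_AE) (use all rv Y in \<open>auto elim!: eventually_mono\<close>)
  also have "\<dots> = PiM I (\<lambda>i. distr M (M' i) (X i))"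
    using indep_vars_iff_distr_eq_PiM'[OF False rv] X by simp
  also have "\<dots> = PiM I (\<lambda>i. distr M (M' i) (Y i))"
    by (intro PiM_cong distr_cong_AE refl) (use eq rv Y in auto)
  finally show ?thesis
    using indep_vars_iff_distr_eq_PiM'[OF False Y] by simp
qed

text \<open>On the null set of exceptional sample points the path is replaced by the zero path.\<close>

lemma continuous_version:
  assumes "standard_brownian_motion M W"
  obtains W' where "continuous_brownian_motion M W'" "AE \<omega> in M. \<forall>t. W' t \<omega> = W t \<omega>"
proof -
  from assms have "prob_space M" by (simp add: standard_brownian_motion_def)
  then interpret prob_space M .
  have W_measurable: "W t \<in> borel_measurable M" if "0 \<le> t" for t
    using assms that by (auto simp: standard_brownian_motion_def)
  have W_increment: "distributed M lborel (\<lambda>\<omega>. W t \<omega> - W s \<omega>) (\<lambda>x. ennreal (normal_density 0 (sqrt (t - s)) x))"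
    if "0 \<le> s" "s < t" for s t
    using assms that by (auto simp: standard_brownian_motion_def)
  have W_indep: "indep_vars (\<lambda>_. borel) (\<lambda>i \<omega>. W (\<tau> (Suc i)) \<omega> - W (\<tau> i) \<omega>) {..<n}"
    if "0 \<le> \<tau> 0" "\<And>i. i < n \<Longrightarrow> \<tau> i < \<tau> (Suc i)" for \<tau> :: "nat \<Rightarrow> real" and n
    using assms that by (auto simp: standard_brownian_motion_def)
  have "AE \<omega> in M. W 0 \<omega> = 0 \<and> continuous_on {0..} (\<lambda>t. W t \<omega>)"
    using assms by (auto simp: standard_brownian_motion_def)
  then obtain N where N: "{\<omega> \<in> space M. \<not> (W 0 \<omega> = 0 \<and> continuous_on {0..} (\<lambda>t. W t \<omega>))} \<subseteq> N"
      "emeasure M N = 0" "N \<in> sets M"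
    by (rule AE_E)
  define W' where "W' t \<omega> = (if \<omega> \<in> N then 0 else W t \<omega>)" for t \<omega>
  have "N \<in> null_sets M" using N by auto
  then have "AE \<omega> in M. \<omega> \<notin> N" by (rule AE_not_in)
  then have eq: "AE \<omega> in M. \<forall>t. W' t \<omega> = W t \<omega>"
    by eventually_elim (simp add: W'_def)
  have W'_measurable: "W' t \<in> borel_measurable M" if "0 \<le> t" for t
    unfolding W'_def using W_measurable[OF that] N(3) by measurable
  have good: "W 0 \<omega> = 0" "continuous_on {0..} (\<lambda>t. W t \<omega>)" if "\<omega> \<in> space M" "\<omega> \<notin> N" for \<omega>
    using N(1) that by blast+
  have "continuous_brownian_motion M W'"
  proof
    show "W' t \<in> borel_measurable M" if "0 \<le> t" for t by (rule W'_measurable[OF that])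
    show "W' 0 \<omega> = 0" if "\<omega> \<in> space M" for \<omega> using good(1)[OF that] by (simp add: W'_def)
    show "continuous_on {0..} (\<lambda>t. W' t \<omega>)" if "\<omega> \<in> space M" for \<omega>
      using good(2)[OF that] by (cases "\<omega> \<in> N") (simp_all add: W'_def)
    show "distributed M lborel (\<lambda>\<omega>. W' t \<omega> - W' s \<omega>) (\<lambda>x. ennreal (normal_density 0 (sqrt (t - s)) x))"
      if st: "0 \<le> s" "s < t" for s t
    proof -
      have [measurable]: "W' s \<in> borel_measurable M" "W' t \<in> borel_measurable M" "W s \<in> borel_measurable M" "W t \<in> borel_measurable M"
        using st W_measurable W'_measurable by auto
      have "distr M lborel (\<lambda>\<omega>. W' t \<omega> - W' s \<omega>) = distr M lborel (\<lambda>\<omega>. W t \<omega> - W s \<omega>)"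
        using eq by (intro distr_cong_AE) (auto elim!: eventually_mono)
      then show ?thesis
        using W_increment[OF st] by (simp add: distributed_def)
    qed
    show "indep_vars (\<lambda>_. borel) (\<lambda>i \<omega>. W' (\<tau> (Suc i)) \<omega> - W' (\<tau> i) \<omega>) {..<n}"
      if \<tau>: "0 \<le> \<tau> 0" "\<And>i. i < n \<Longrightarrow> \<tau> i < \<tau> (Suc i)" for \<tau> :: "nat \<Rightarrow> real" and n
    proof (rule indep_vars_cong_AE[OF W_indep[OF \<tau>]])
      have \<tau>_nonneg: "0 \<le> \<tau> i" if "i \<le> n" for i
        using that by (induction i) (use \<tau> in \<open>auto intro: order_trans less_imp_le simp: Suc_le_eq\<close>)
      show "(\<lambda>\<omega>. W' (\<tau> (Suc i)) \<omega> - W' (\<tau> i) \<omega>) \<in> borel_measurable M" if "i \<in> {..<n}" for i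
        using that by (intro borel_measurable_diff W'_measurable \<tau>_nonneg) auto
      show "AE \<omega> in M. W (\<tau> (Suc i)) \<omega> - W (\<tau> i) \<omega> = W' (\<tau> (Suc i)) \<omega> - W' (\<tau> i) \<omega>" for i
        using eq by eventually_elim simp
    qed auto
  qed
  with eq show thesis using that by blast
qed

lemma standard_brownian_motion_uminus:
  assumes "standard_brownian_motion M W"
  shows "standard_brownian_motion M (\<lambda>t \<omega>. - W t \<omega>)"
proof -
  from assms have "prob_space M" by (simp add: standard_brownian_motion_def)
  then interpret prob_space M .
  have "distributed M lborel (\<lambda>\<omega>. - W t \<omega> - - W s \<omega>) (\<lambda>x. ennreal (normal_density 0 (sqrt (t - s)) x))"
    if "0 \<le> s" "s < t" for s t
  proof -
    have "distributed M lborel (\<lambda>\<omega>. W t \<omega> - W s \<omega>) (\<lambda>x. ennreal (normal_density 0 (sqrt (t - s)) x))"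
      using assms that by (auto simp: standard_brownian_motion_def)
    from normal_density_affine[OF this, of "-1" 0] that show ?thesis by simp
  qed
  moreover have "indep_vars (\<lambda>_. borel) (\<lambda>i \<omega>. - W (\<tau> (Suc i)) \<omega> - - W (\<tau> i) \<omega>) {..<n}"
    if "0 \<le> \<tau> 0 \<and> (\<forall>i<n. \<tau> i < \<tau> (Suc i))" for \<tau> :: "nat \<Rightarrow> real" and n
  proof -
    have "indep_vars (\<lambda>_. borel) (\<lambda>i \<omega>. W (\<tau> (Suc i)) \<omega> - W (\<tau> i) \<omega>) {..<n}"
      using assms that by (auto simp: standard_brownian_motion_def)
    then have "indep_vars (\<lambda>_. borel) (\<lambda>i \<omega>. - (W (\<tau> (Suc i)) \<omega> - W (\<tau> i) \<omega>)) {..<n}"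
      by (rule indep_vars_compose2[where Y = "\<lambda>_ x. - x"]) auto
    then show ?thesis by simp
  qed
  moreover have "AE \<omega> in M. continuous_on {0..} (\<lambda>t. - W t \<omega>)"
  proof -
    have "AE \<omega> in M. continuous_on {0..} (\<lambda>t. W t \<omega>)"
      using assms by (simp add: standard_brownian_motion_def)
    then show ?thesis by eventually_elim (rule continuous_on_minus)
  qed
  ultimately show ?thesis
    using assms unfolding standard_brownian_motion_def by auto
qed

text \<open>
  The sum of the two coordinates is \<open>x0 + y0 + t\<close>, so when one coordinate vanishes the other one is automatically
  nonnegative.
\<close>

lemma T1_Z_process:
  assumes "0 < x0" "0 < y0"
  shows "T1 (Z_process W \<gamma> x0 y0) \<omega> = hit_time x0 (1 - \<gamma>) (\<lambda>t. W t \<omega>)"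
proof -
  have "{t. 0 \<le> t \<and> Z_process W \<gamma> x0 y0 t \<omega> \<in> {0} \<times> {0..}} = {t. 0 \<le> t \<and> W t \<omega> = x0 + (1 - \<gamma>) * t}"
    using assms by (auto simp: Z_process_def algebra_simps)
  then show ?thesis unfolding T1_def hitting_time_def hit_time_def by (simp only:)
qed

lemma T2_Z_process:
  assumes "0 < x0" "0 < y0"
  shows "T2 (Z_process W \<gamma> x0 y0) \<omega> = hit_time y0 \<gamma> (\<lambda>t. - W t \<omega>)"
proof -
  have "{t. 0 \<le> t \<and> Z_process W \<gamma> x0 y0 t \<omega> \<in> {0..} \<times> {0}} = {t. 0 \<le> t \<and> - W t \<omega> = y0 + \<gamma> * t}"
  proof (intro Collect_cong conj_cong refl)
    fix t :: real assume "0 \<le> t"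
    have "y0 + W t \<omega> + \<gamma> * t = 0 \<longleftrightarrow> - W t \<omega> = y0 + \<gamma> * t" by auto
    moreover have "0 \<le> x0 - W t \<omega> + (1 - \<gamma>) * t" if "- W t \<omega> = y0 + \<gamma> * t"
    proof -
      have "x0 - W t \<omega> + (1 - \<gamma>) * t = x0 + y0 + t" using that by (simp add: algebra_simps)
      then show ?thesis using assms \<open>0 \<le> t\<close> by simp
    qed
    ultimately show "Z_process W \<gamma> x0 y0 t \<omega> \<in> {0..} \<times> {0} \<longleftrightarrow> - W t \<omega> = y0 + \<gamma> * t"
      unfolding Z_process_def by auto
  qed
  then show ?thesis unfolding T2_def hitting_time_def hit_time_def by (simp only:)
qed

text \<open>
  The event and its version for the continuous modification differ by a null set, which is where the completion of the measure
  enters. On the event, the exit position is \<open>t0\<close> plus the exit time; this shifts the density by \<open>t0\<close>.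
\<close>

lemma is_exit_density1_series:
  fixes W :: "real \<Rightarrow> 'a \<Rightarrow> real"
  assumes bm: "standard_brownian_motion M W" and \<gamma>: "0 < \<gamma>" "\<gamma> < 1" and pos: "0 < x0" "0 < y0" and t0: "t0 = x0 + y0"
  shows "is_exit_density1 M (Z_process W \<gamma> x0 y0)
       (\<lambda>y. if y > t0 then
          exp (- t0 * (1 - \<gamma>) - y0 * \<gamma>) / sqrt (2 * pi)
          * (exp (- (1/2) * (1 - \<gamma>)\<^sup>2 * (y - t0)) / sqrt ((y - t0) ^ 3))
          * (\<Sum>\<^sub>\<infinity>n\<in>UNIV. exit_series_term t0 y0 (y - t0) n)
        else 0)"
proof -
  obtain B where B: "continuous_brownian_motion M B" and eq: "AE \<omega> in M. \<forall>t. B t \<omega> = W t \<omega>"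
    using continuous_version[OF bm] by blast
  interpret continuous_brownian_motion M B by fact
  define up where "up = upper_time x0 \<gamma>"
  define low where "low = lower_time y0 \<gamma>"
  have [measurable]: "up \<in> borel_measurable M" "low \<in> borel_measurable M"
    unfolding up_def low_def using measurable_times[OF pos \<gamma>] by auto
  define g where "g s = exit_prefactor t0 y0 \<gamma> s * (image_sum t0 y0 s - image_sum t0 (- y0) s)" for s
  have g_measurable [measurable]: "g \<in> borel_measurable borel" unfolding g_def by measurable
  have g_nonneg: "0 \<le> g s" if "0 < s" for s
    unfolding g_def t0 by (rule upper_exit_density(1)[OF pos \<gamma> that])
  have emeasure_up: "emeasure M {\<omega> \<in> space M. real_of_ereal (up \<omega>) \<in> S \<and> up \<omega> < low \<omega>} = (\<integral>\<^sup>+s\<in>S. ennreal (g s) \<partial>lborel)"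
    if "S \<in> sets borel" "S \<subseteq> {0<..}" for S
    unfolding g_def t0 up_def low_def by (rule upper_exit_density(2)[OF pos \<gamma> that])
  have "\<bar>y0\<bar> < t0" using pos t0 by simp
  define f where "f y = (if y > t0 then g (y - t0) else 0)" for y
  have f_eq: "(\<lambda>y. if y > t0 then
          exp (- t0 * (1 - \<gamma>) - y0 * \<gamma>) / sqrt (2 * pi)
          * (exp (- (1/2) * (1 - \<gamma>)\<^sup>2 * (y - t0)) / sqrt ((y - t0) ^ 3))
          * (\<Sum>\<^sub>\<infinity>n\<in>UNIV. exit_series_term t0 y0 (y - t0) n)
        else 0) = f"
  proof
    fix y
    have "(\<Sum>\<^sub>\<infinity>n\<in>UNIV. exit_series_term t0 y0 (y - t0) n) = image_sum t0 y0 (y - t0) - image_sum t0 (- y0) (y - t0)" if "t0 < y"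
      using that by (intro infsumI has_sum_exit_series \<open>\<bar>y0\<bar> < t0\<close>) simp
    then show "(if y > t0 then
          exp (- t0 * (1 - \<gamma>) - y0 * \<gamma>) / sqrt (2 * pi)
          * (exp (- (1/2) * (1 - \<gamma>)\<^sup>2 * (y - t0)) / sqrt ((y - t0) ^ 3))
          * (\<Sum>\<^sub>\<infinity>n\<in>UNIV. exit_series_term t0 y0 (y - t0) n)
        else 0) = f y"
      unfolding f_def g_def exit_prefactor_def by (simp only: split: if_split) simp
  qed
  have f_measurable [measurable]: "f \<in> borel_measurable borel" unfolding f_def by measurable
  let ?Z = "Z_process W \<gamma> x0 y0"
  have "density_of_law_on_event M (\<lambda>\<omega>. snd (?Z (real_of_ereal (T1 ?Z \<omega>)) \<omega>)) (\<lambda>\<omega>. T1 ?Z \<omega> < T2 ?Z \<omega>) f"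
    unfolding density_of_law_on_event_def
  proof (intro conjI ballI allI impI)
    show "f \<in> borel_measurable borel" by (rule f_measurable)
    show "0 \<le> f y" for y unfolding f_def using g_nonneg by simp
  next
    fix S :: "real set" assume S [measurable]: "S \<in> sets borel" and "S \<subseteq> {0<..}"
    define S' where "S' = {s. 0 < s \<and> t0 + s \<in> S}"
    have "S' = (\<lambda>s. t0 + s) -` S \<inter> {0<..}" by (auto simp: S'_def)
    then have S'_sets [measurable]: "S' \<in> sets borel" by simp
    define A where "A = {\<omega> \<in> space M. snd (?Z (real_of_ereal (T1 ?Z \<omega>)) \<omega>) \<in> S \<and> T1 ?Z \<omega> < T2 ?Z \<omega>}"
    define A' where "A' = {\<omega> \<in> space M. real_of_ereal (up \<omega>) \<in> S' \<and> up \<omega> < low \<omega>}"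
    have A'_sets: "A' \<in> sets M" unfolding A'_def by measurable
    have "AE \<omega> in M. \<omega> \<in> A' \<longleftrightarrow> \<omega> \<in> A"
      using eq AE_space
    proof eventually_elim
      case (elim \<omega>)
      have T1_eq: "T1 ?Z \<omega> = up \<omega>" and T2_eq: "T2 ?Z \<omega> = low \<omega>"
        unfolding T1_Z_process[OF pos] T2_Z_process[OF pos] up_def low_def
          upper_time_def lower_time_def using elim(1) by simp_all
      have "snd (?Z (real_of_ereal (up \<omega>)) \<omega>) = t0 + real_of_ereal (up \<omega>) \<and> 0 < real_of_ereal (up \<omega>)" if "up \<omega> < low \<omega>"
      proof -
        have path: "continuous_on {0..} (\<lambda>t. B t \<omega>)" "B 0 \<omega> = 0"
          using elim(2) continuous_path start_zero by auto
        have "up \<omega> < \<infinity>" using that by (cases "low \<omega>") auto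
        then have "B (real_of_ereal (up \<omega>)) \<omega> = x0 + (1 - \<gamma>) * real_of_ereal (up \<omega>)"
          using value_at_hit_time[OF path pos(1), of "1 - \<gamma>"] unfolding up_def upper_time_def by simp
        then have "snd (?Z (real_of_ereal (up \<omega>)) \<omega>) = t0 + real_of_ereal (up \<omega>)"
          using elim(1) by (simp add: Z_process_def t0 algebra_simps)
        moreover have "0 < up \<omega>" unfolding up_def by (rule times_pos(1)[OF pos \<gamma> elim(2)])
        then have "0 < real_of_ereal (up \<omega>)" using \<open>up \<omega> < \<infinity>\<close> by (cases "up \<omega>") auto
        ultimately show ?thesis by simp
      qed
      then show ?case
        using elim(2) by (auto simp: A_def A'_def T1_eq T2_eq S'_def)
    qed
    then have AE_eq: "AE \<omega> in completion M. \<omega> \<in> A' \<longleftrightarrow> \<omega> \<in> A" by (rule AE_completion)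
    have A'_completion: "A' \<in> sets (completion M)" using A'_sets by (rule sets_completionI_sets)
    have A_sets: "A \<in> sets (completion M)"
      by (rule completion.in_sets_AE[OF AE_eq A'_completion]) (auto simp: A_def)
    have "emeasure (completion M) A = emeasure (completion M) A'"
      using AE_eq by (intro emeasure_eq_AE A_sets A'_completion) auto
    also have "\<dots> = emeasure M A'" using A'_sets by simp
    also have "\<dots> = (\<integral>\<^sup>+s\<in>S'. ennreal (g s) \<partial>lborel)"
      unfolding A'_def by (rule emeasure_up[OF S'_sets]) (auto simp: S'_def)
    also have "\<dots> = (\<integral>\<^sup>+s. ennreal (f (t0 + 1 * s)) * indicator S (t0 + 1 * s) \<partial>lborel)"
      by (intro nn_integral_cong) (auto simp: f_def S'_def indicator_def)
    also have "\<dots> = (\<integral>\<^sup>+y\<in>S. ennreal (f y) \<partial>lborel)"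
      by (subst nn_integral_real_affine[where c = 1 and t = t0]) auto
    finally have "emeasure (completion M) A = (\<integral>\<^sup>+y\<in>S. ennreal (f y) \<partial>lborel)" .
    with A_sets show "{\<omega> \<in> space M. snd (?Z (real_of_ereal (T1 ?Z \<omega>)) \<omega>) \<in> S \<and> T1 ?Z \<omega> < T2 ?Z \<omega>} \<in> sets (completion M)"
      "emeasure (completion M) {\<omega> \<in> space M. snd (?Z (real_of_ereal (T1 ?Z \<omega>)) \<omega>) \<in> S \<and> T1 ?Z \<omega> < T2 ?Z \<omega>} = (\<integral>\<^sup>+y\<in>S. ennreal (f y) \<partial>lborel)"
      unfolding A_def by blast+
  qed
  then show ?thesis unfolding is_exit_density1_def f_eq .
qed

theorem theorem18:
  fixes M :: "'a measure" and W :: "real \<Rightarrow> 'a \<Rightarrow> real" and \<gamma> x0 y0 t0 :: real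
  assumes "standard_brownian_motion M W"
    and "0 < \<gamma>" and "\<gamma> < 1"
    and "0 < x0" and "0 < y0"
    and "t0 = x0 + y0"
  shows "(\<forall>y>t0. exit_series_term t0 y0 (y - t0) summable_on UNIV) \<and>
     is_exit_density1 M (Z_process W \<gamma> x0 y0)
       (\<lambda>y. if y > t0 then
          exp (- t0 * (1 - \<gamma>) - y0 * \<gamma>) / sqrt (2 * pi)
          * (exp (- (1/2) * (1 - \<gamma>)\<^sup>2 * (y - t0)) / sqrt ((y - t0) ^ 3))
          * (\<Sum>\<^sub>\<infinity>n\<in>UNIV. exit_series_term t0 y0 (y - t0) n)
        else 0) \<and>
     (\<forall>x>t0. exit_series_term t0 x0 (x - t0) summable_on UNIV) \<and>
     is_exit_density2 M (Z_process W \<gamma> x0 y0)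
       (\<lambda>x. if x > t0 then
          exp (- t0 * \<gamma> - x0 * (1 - \<gamma>)) / sqrt (2 * pi)
          * (exp (- (1/2) * \<gamma>\<^sup>2 * (x - t0)) / sqrt ((x - t0) ^ 3))
          * (\<Sum>\<^sub>\<infinity>n\<in>UNIV. exit_series_term t0 x0 (x - t0) n)
        else 0)"
proof (intro conjI allI impI)
  have less: "\<bar>x0\<bar> < t0" "\<bar>y0\<bar> < t0" using assms by auto
  show "exit_series_term t0 y0 (y - t0) summable_on UNIV" if "t0 < y" for y
    using has_sum_exit_series[OF less(2), of "y - t0"] that by (auto simp: summable_on_def)
  show "exit_series_term t0 x0 (x - t0) summable_on UNIV" if "t0 < x" for x
    using has_sum_exit_series[OF less(1), of "x - t0"] that by (auto simp: summable_on_def)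
  show "is_exit_density1 M (Z_process W \<gamma> x0 y0)
       (\<lambda>y. if y > t0 then
          exp (- t0 * (1 - \<gamma>) - y0 * \<gamma>) / sqrt (2 * pi)
          * (exp (- (1/2) * (1 - \<gamma>)\<^sup>2 * (y - t0)) / sqrt ((y - t0) ^ 3))
          * (\<Sum>\<^sub>\<infinity>n\<in>UNIV. exit_series_term t0 y0 (y - t0) n)
        else 0)"
    by (rule is_exit_density1_series[OF assms])
  \<comment> \<open>the process driven by \<open>- W\<close> has the two coordinates exchanged\<close>
  let ?Z = "Z_process W \<gamma> x0 y0" and ?Z' = "Z_process (\<lambda>t \<omega>. - W t \<omega>) (1 - \<gamma>) y0 x0"
  have times: "T1 ?Z' = T2 ?Z" "T2 ?Z' = T1 ?Z"
    using assms(4,5) by (simp_all add: fun_eq_iff T1_Z_process T2_Z_process)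
  have swap: "snd (?Z' t \<omega>) = fst (?Z t \<omega>)" for t \<omega>
    by (simp add: Z_process_def)
  have "is_exit_density1 M ?Z'
       (\<lambda>x. if x > t0 then
          exp (- t0 * (1 - (1 - \<gamma>)) - x0 * (1 - \<gamma>)) / sqrt (2 * pi)
          * (exp (- (1/2) * (1 - (1 - \<gamma>))\<^sup>2 * (x - t0)) / sqrt ((x - t0) ^ 3))
          * (\<Sum>\<^sub>\<infinity>n\<in>UNIV. exit_series_term t0 x0 (x - t0) n)
        else 0)"
    by (rule is_exit_density1_series[OF standard_brownian_motion_uminus[OF assms(1)]]) (use assms in auto)
  moreover have "1 - (1 - \<gamma>) = \<gamma>" by simp
  ultimately show "is_exit_density2 M ?Z
       (\<lambda>x. if x > t0 then
          exp (- t0 * \<gamma> - x0 * (1 - \<gamma>)) / sqrt (2 * pi)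
          * (exp (- (1/2) * \<gamma>\<^sup>2 * (x - t0)) / sqrt ((x - t0) ^ 3))
          * (\<Sum>\<^sub>\<infinity>n\<in>UNIV. exit_series_term t0 x0 (x - t0) n)
        else 0)"
    unfolding is_exit_density1_def is_exit_density2_def times swap by (simp only:)
qed

end
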